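(* Let $p\in(1,2]$ and let $\varepsilon_0(p)$ be the John--Nirenberg constant of $\mathrm{BMO}^p((0,1))$ (defined in the context). If $Q$ is an interval and $\varphi\in\mathrm{BMO}(Q)$ with $\|\varphi\|_{\mathrm{BMO}^p(Q)}>0$, then for any subinterval $J$ of $Q$ and any $\lambda\ge0$, $$\frac1{|J|}\,\big|\{t\in J:~|\varphi(t)-\langle\varphi\rangle_J|\ge\lambda\}\big|\le (p-1)^{-\frac1{2-p}}\, e^{-\frac{\varepsilon_0(p)\lambda}{\|\varphi\|_{\mathrm{BMO}^p(Q)}}},$$ where for $p=2$ the factor $(p-1)^{-\frac1{2-p}}$ is understood as its limit $e$ as $p\to2^-$. In particular, the weak-type John--Nirenberg inequality on intervals holds with exponential constant $c_0(p)=\varepsilon_0(p)$.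
   Context: For an interval $J$, $\langle\varphi\rangle_J=\frac1{|J|}\int_J\varphi$. For an interval $Q$ and $p>0$, $\|\varphi\|_{\mathrm{BMO}^p(Q)}=\sup_{J\subset Q}\langle|\varphi-\langle\varphi\rangle_J|^p\rangle_J^{1/p}$, the supremum being over all subintervals $J$ of $Q$; $\mathrm{BMO}(Q)$ is the set of locally integrable $\varphi$ for which this is finite (the set is the same for all $p>0$). For $p>0$ and $\varepsilon\ge0$ let $C(\varepsilon,p)\in[1,\infty]$ be the smallest constant such that $\langle e^\varphi\rangle_J\le C(\varepsilon,p)\,e^{\langle\varphi\rangle_J}$ for every $\varphi\in\mathrm{BMO}((0,1))$ with $\|\varphi\|_{\mathrm{BMO}^p((0,1))}\le\varepsilon$ and every subinterval $J\subset(0,1)$. The John--Nirenberg constant $\varepsilon_0(p)$ is the largest number such that $C(\varepsilon,p)<\infty$ for all $0\le\varepsilon<\varepsilon_0(p)$. The weak-type John--Nirenberg inequality with exponential constant $c_0(p)$ is: there is $K(p)>0$ such that $\frac1{|J|}|\{t\in J:|\varphi(t)-\langle\varphi\rangle_J|\ge\lambda\}|\le K(p)e^{-c_0(p)\lambda/\|\varphi\|_{\mathrm{BMO}^p(Q)}}$ for all such $\varphi$, $J$ and $\lambda\ge0$. *)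

theory Defs
  imports "HOL-Analysis.Analysis"
begin

text \<open>Averages are taken over bounded intervals of positive length, of any kind (open, closed,
  half-open); the ambient interval \<open>Q\<close> itself may be unbounded.\<close>

definition subintervals :: "real set \<Rightarrow> real set set" where
  "subintervals Q = {J. J \<subseteq> Q \<and> is_interval J \<and> bounded J \<and> interior J \<noteq> {}}"

definition avg :: "real set \<Rightarrow> (real \<Rightarrow> real) \<Rightarrow> real" where
  "avg J f = (LINT t:J|lebesgue. f t) / measure lebesgue J"

definition nn_avg :: "real set \<Rightarrow> (real \<Rightarrow> ennreal) \<Rightarrow> ennreal" where
  "nn_avg J f = (\<integral>\<^sup>+t\<in>J. f t \<partial>lebesgue) / emeasure lebesgue J"

text \<open>Only meant for exponents \<open>a > 0\<close>.\<close>

definition epowr :: "ennreal \<Rightarrow> real \<Rightarrow> ennreal" where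
  "epowr x a = (if x = \<infinity> then \<infinity> else ennreal (enn2real x powr a))"

definition locally_integrable_on :: "(real \<Rightarrow> real) \<Rightarrow> real set \<Rightarrow> bool" where
  "locally_integrable_on f Q \<longleftrightarrow> (\<forall>K. compact K \<and> K \<subseteq> Q \<longrightarrow> set_integrable lebesgue K f)"

text \<open>If \<open>p \<ge> 1\<close> and \<open>\<phi>\<close> is locally integrable on \<open>Q\<close> but not integrable on some bounded
  subinterval \<open>J\<close>, then \<open>avg J \<phi>\<close> takes the default value \<open>0\<close>, but the average of
  \<open>\<bar>\<phi>\<bar> powr p\<close> over \<open>J\<close> is infinite, and so is the norm.\<close>

definition bmo_norm :: "real \<Rightarrow> real set \<Rightarrow> (real \<Rightarrow> real) \<Rightarrow> ennreal" where
  "bmo_norm p Q \<phi> =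
     (SUP J\<in>subintervals Q. epowr (nn_avg J (\<lambda>t. ennreal (\<bar>\<phi> t - avg J \<phi>\<bar> powr p))) (1 / p))"

definition BMO :: "real \<Rightarrow> real set \<Rightarrow> (real \<Rightarrow> real) set" where
  "BMO p Q = {\<phi>. locally_integrable_on \<phi> Q \<and> bmo_norm p Q \<phi> < \<infinity>}"

definition exp_const :: "real \<Rightarrow> real \<Rightarrow> ennreal" where
  "exp_const \<epsilon> p = Inf {C. 1 \<le> C \<and>
     (\<forall>\<phi>\<in>BMO p {0<..<1}. bmo_norm p {0<..<1} \<phi> \<le> ennreal \<epsilon> \<longrightarrow>
        (\<forall>J\<in>subintervals {0<..<1}.
           nn_avg J (\<lambda>t. ennreal (exp (\<phi> t))) \<le> C * ennreal (exp (avg J \<phi>))))}"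

text \<open>Because of the strict inequality \<open>\<epsilon> < e\<close>, the set below is closed; it contains \<open>0\<close>
  and is bounded (test with \<open>\<phi> t = - c * ln t\<close>), so its supremum is its largest element.\<close>

definition JN_constant :: "real \<Rightarrow> real" where
  "JN_constant p = Sup {e. 0 \<le> e \<and> (\<forall>\<epsilon>. 0 \<le> \<epsilon> \<and> \<epsilon> < e \<longrightarrow> exp_const \<epsilon> p < \<infinity>)}"

definition weak_type_JN :: "real \<Rightarrow> real \<Rightarrow> bool" where
  "weak_type_JN p c \<longleftrightarrow> (\<exists>K>0. \<forall>Q \<phi> J l.
     is_interval Q \<and> \<phi> \<in> BMO p Q \<and> 0 < bmo_norm p Q \<phi> \<and> J \<in> subintervals Q \<and> 0 \<le> l \<longrightarrow>
       measure lebesgue {t\<in>J. l \<le> \<bar>\<phi> t - avg J \<phi>\<bar>} / measure lebesgue J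
         \<le> K * exp (- (c * l / enn2real (bmo_norm p Q \<phi>))))"

end

theory Submission
  imports Defs
begin

text \<open>Let \<open>N\<close> be the \<open>L\<^sup>p\<close> oscillation of \<open>- ln t\<close> on \<open>(0, 1)\<close>. Since \<open>- ln t\<close> has \<open>BMO\<^sup>p\<close> norm \<open>N\<close> and its
  exponential is not integrable, the John--Nirenberg constant is at most \<open>N\<close>, and it suffices to prove
  the weak-type inequality with \<open>N\<close> in its place. Fix \<open>a \<in> (0, 1)\<close> with \<open>a \<ge> 2 - p\<close>, scale \<open>\<phi>\<close> to have norm less
  than \<open>a * N\<close>, and put \<open>C = exp (- a) / (1 - a)\<close>. For each level \<open>\<alpha>\<close> above the mean, the rising sun lemma
  gives an open set \<open>U\<close>, decreasing in \<open>\<alpha>\<close>, whose components are intervals on which \<open>\<phi>\<close> has mean \<open>\<alpha>\<close>, and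
  outside of which \<open>\<phi> \<le> \<alpha>\<close>. While \<open>\<alpha>\<close> decreases, the mean of \<open>exp \<phi>\<close> over \<open>U\<close> stays below \<open>C * exp \<alpha>\<close>: if it
  reached this bound, a Bellman function for \<open>\<bar>\<phi> - \<alpha>\<bar> powr p\<close> would force the oscillation over \<open>U\<close> to be
  at least \<open>a * N\<close>; the restriction \<open>a \<ge> 2 - p\<close> is what makes this Bellman function locally convex.
  Under that bound, with \<open>A\<close> the measure of \<open>U\<close> and \<open>X = \<langle>exp \<phi>\<rangle>\<^sub>U * exp (- \<alpha>)\<close>, the quantity
  \<open>\<alpha> + ln X / a + a * ln A\<close> increases as \<open>\<alpha>\<close> decreases. Comparing the final value with the value when the
  measure has doubled shows that each of the two tails is at most half of \<open>(1 - a) powr (- 1 / a) * exp (- \<lambda> / a)\<close>.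
  For \<open>p < 2\<close> take \<open>a = 2 - p\<close>, and for \<open>p = 2\<close> let \<open>a\<close> tend to \<open>0\<close>.\<close>

text \<open>The constants come from the model function \<open>- a * ln t\<close> on (0, 1): its mean
  is \<open>a\<close> and its exponential has mean \<open>1 / (1 - a)\<close>, so its ratio is
  exactly \<open>C\<close>, and its oscillation is exactly \<open>a * N\<close>. After rescaling,
  the exponent of the tail bound is the same for every \<open>a\<close>; only the factor
  \<open>(1 - a) powr (- 1 / a)\<close> depends on \<open>a\<close>. It increases with
  \<open>a\<close>, so the smallest admissible value is the best one. There \<phi> is replaced by
  its average, which by convexity does not raise the convex functional to be compared; outside that
  set \<phi> is bounded above. Only finitely many levels are used: the strict gap below
  \<open>a * N\<close> pays for the step size and for smoothing the absolute power at 0. The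
  doubling time yields the factor 1/2 because the added half then has the balancing mean, and a
  hyperbolic cosine bounds the mean of the exponential from below.\<close>

section \<open>Bellman functions on the domain of logarithms of weights\<close>

text \<open>Here \<open>f'' = g\<close> and \<open>M w = \<integral>\<^sub>0\<^sup>\<infinity> g (w + a * s) * exp (- s) ds\<close>. The final inequality is the local convexity, on
  the domain \<open>exp x\<^sub>1 \<le> x\<^sub>2 \<le> exp (x\<^sub>1 - a) / (1 - a)\<close>, of the Bellman candidate with boundary values \<open>f\<close>
  that is affine on the tangents to the upper boundary curve.\<close>

definition bellman_kernel ::
    "real \<Rightarrow> (real \<Rightarrow> real) \<Rightarrow> (real \<Rightarrow> real) \<Rightarrow> (real \<Rightarrow> real) \<Rightarrow> (real \<Rightarrow> real) \<Rightarrow> bool" where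
  "bellman_kernel a f f1 g M \<longleftrightarrow>
     (\<forall>v. (f has_real_derivative f1 v) (at v) \<and> (f1 has_real_derivative g v) (at v) \<and>
          (M has_real_derivative (M v - g v) / a) (at v) \<and> (1 - a) * M v \<le> g v)"

lemma bellman_kernelD:
  assumes "bellman_kernel a f f1 g M"
  shows "(f has_real_derivative f1 v) (at v)" "(f1 has_real_derivative g v) (at v)"
    "(M has_real_derivative (M v - g v) / a) (at v)" "(1 - a) * M v \<le> g v"
  using assms by (auto simp: bellman_kernel_def)

lemma bellman_kernel_shift:
  assumes "bellman_kernel a f f1 g M"
  shows "bellman_kernel a (\<lambda>v. f (v - \<kappa>)) (\<lambda>v. f1 (v - \<kappa>)) (\<lambda>v. g (v - \<kappa>)) (\<lambda>v. M (v - \<kappa>))"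
  unfolding bellman_kernel_def
proof (intro allI conjI)
  fix v
  note K = bellman_kernelD[OF assms]
  have *: "((\<lambda>v. h (v - \<kappa>)) has_real_derivative h') (at v)"
    if "(h has_real_derivative h') (at (v - \<kappa>))" for h h'
    using DERIV_shift[of h h' v "-\<kappa>"] that by simp
  show "((\<lambda>v. f (v - \<kappa>)) has_real_derivative f1 (v - \<kappa>)) (at v)"
    "((\<lambda>v. f1 (v - \<kappa>)) has_real_derivative g (v - \<kappa>)) (at v)"
    "((\<lambda>v. M (v - \<kappa>)) has_real_derivative (M (v - \<kappa>) - g (v - \<kappa>)) / a) (at v)"
    by (rule *, rule K)+
  show "(1 - a) * M (v - \<kappa>) \<le> g (v - \<kappa>)" by (rule K)
qed

text \<open>The difference of the two sides is convex in z and vanishes at 0, so its sign at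
  \<open>y0\<close> passes to all points between.\<close>

lemma exp_chord_le:
  fixes b z y0 :: real
  assumes "0 < b" "b * (exp y0 - 1) \<le> y0" "0 \<le> z" "z \<le> y0"
  shows "b * (exp z - 1) \<le> z"
proof (cases "y0 = 0")
  case True then show ?thesis using assms by simp
next
  case False
  then have y0: "y0 > 0" using assms by simp
  define t where "t = z / y0"
  have t: "0 \<le> t" "t \<le> 1" "z = (1 - t) * 0 + t * y0" using assms y0 by (auto simp: t_def)
  have "exp ((1 - t) *\<^sub>R 0 + t *\<^sub>R y0) \<le> (1 - t) * exp 0 + t * exp y0"
    by (rule convex_onD[OF exp_convex]) (use t in auto)
  then have "exp z - 1 \<le> t * (exp y0 - 1)" using t(3) by (simp add: algebra_simps)
  then have "b * (exp z - 1) \<le> b * (t * (exp y0 - 1))" using assms by simp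
  also have "\<dots> = t * (b * (exp y0 - 1))" by simp
  also have "\<dots> \<le> t * y0" using assms t by (intro mult_left_mono) auto
  finally show ?thesis using t by simp
qed

text \<open>The tangent to the upper boundary curve that starts at the lower boundary point over w
  touches the upper curve over \<open>w + a\<close> and meets the lower curve again over w + y with
  \<open>(1 - a) * (exp y - 1) = y\<close>; the condition on \<open>y0\<close> stops before that
  second point. For a fixed end point v, the plane value \<open>L u\<close> equals f v at u = v. Its
  derivative is a product: the kernel condition fixes the sign of one factor, the side of v on which
  u lies fixes that of the other, and \<open>L\<close> increases on the way from w to v.\<close>

lemma bellman_kernel_plane_le:
  assumes a: "0 < a" "a < 1" and ker: "bellman_kernel a f f1 g M"
    and y0: "(1 - a) * (exp y0 - 1) \<le> y0" "0 \<le> y0" "y \<le> y0"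
  shows "f w + f1 w * y + (1 - a) * M w * (exp y - 1 - y) \<le> f (w + y)"
proof -
  note K = bellman_kernelD[OF ker]
  define v where "v = w + y"
  define L where "L u = f u + f1 u * (v - u) + (1 - a) * M u * (exp (v - u) - 1 - (v - u))" for u
  define L' where "L' u = (1 - a) / a * ((1 - a) * M u - g u) * (exp (v - u) - 1 - (v - u) / (1 - a))" for u
  have D: "(L has_real_derivative L' u) (at u)" for u
    unfolding L_def
    by (rule derivative_eq_intros K refl | simp)+
       (use a in \<open>simp add: L'_def field_simps\<close>)
  have neg: "(1 - a) / a * ((1 - a) * M u - g u) \<le> 0" for u
    using K(4)[of u] a by (intro mult_nonneg_nonpos) auto
  have "L w \<le> L v"
  proof (cases "0 \<le> y")
    case True
    show ?thesis
    proof (rule DERIV_nonneg_imp_nondecreasing[where f = L])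
      show "w \<le> v" using True by (simp add: v_def)
      fix u assume u: "w \<le> u" "u \<le> v"
      have "(1 - a) * (exp (v - u) - 1) \<le> v - u"
        by (rule exp_chord_le[OF _ y0(1)]) (use u y0 a v_def in auto)
      then have "exp (v - u) - 1 - (v - u) / (1 - a) \<le> 0" using a by (simp add: field_simps)
      then have "0 \<le> L' u" unfolding L'_def by (intro mult_nonpos_nonpos neg)
      then show "\<exists>d. (L has_real_derivative d) (at u) \<and> 0 \<le> d" using D by blast
    qed
  next
    case False
    show ?thesis
    proof (rule DERIV_nonpos_imp_nonincreasing[where f = L])
      show "v \<le> w" using False by (simp add: v_def)
      fix u assume u: "v \<le> u" "u \<le> w"
      have "(v - u) / (1 - a) \<le> v - u" using u a by (simp add: field_simps)
      also have "\<dots> \<le> exp (v - u) - 1" using exp_ge_add_one_self[of "v - u"] by linarith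
      finally have "L' u \<le> 0" unfolding L'_def by (intro mult_nonpos_nonneg neg) simp
      then show "\<exists>d. (L has_real_derivative d) (at u) \<and> d \<le> 0" using D by blast
    qed
  qed
  then show ?thesis by (simp add: L_def v_def)
qed

text \<open>\<open>\<Lambda> A S P\<close> is \<open>A\<close> times the value at \<open>(S / A, P / A)\<close> of the affine function supporting the Bellman
  candidate along the tangent that touches the upper boundary above \<open>S / A\<close>.\<close>

lemma bellman_piece:
  fixes f f1 g M :: "real \<Rightarrow> real"
  assumes a: "0 < a" "a < 1" and ker: "bellman_kernel a f f1 g M"
  defines "\<Lambda> \<equiv> \<lambda>A S P. A * (f (S / A - a) + a * f1 (S / A - a))
        + (1 - a) * M (S / A - a) * (exp (a - S / A) * P - (1 + a) * A)"
  assumes A: "0 < A0" "0 \<le> D" and T: "0 \<le> T"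
    and s: "\<And>t. 0 \<le> t \<Longrightarrow> t \<le> T \<Longrightarrow> s \<le> (S0 + t * s) / (A0 + t * D) * D"
    and X: "\<And>t. 0 \<le> t \<Longrightarrow> t \<le> T \<Longrightarrow>
      (1 - a) * exp (a - (S0 + t * s) / (A0 + t * D)) * (P0 + t * \<pi>) \<le> A0 + t * D"
    and plane: "\<And>t w. 0 \<le> t \<Longrightarrow> t \<le> T \<Longrightarrow> w = (S0 + t * s) / (A0 + t * D) - a \<Longrightarrow>
      f w * D + f1 w * (s - w * D) + (1 - a) * M w * (exp (- w) * \<pi> - D - (s - w * D)) \<le> \<rho>"
  shows "\<Lambda> (A0 + T * D) (S0 + T * s) (P0 + T * \<pi>) \<le> \<Lambda> A0 S0 P0 + T * \<rho>"
proof -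
  note K = bellman_kernelD[OF ker]
  define H where "H t = \<Lambda> (A0 + t * D) (S0 + t * s) (P0 + t * \<pi>) - t * \<rho>" for t
  have "H T \<le> H 0"
  proof (rule DERIV_nonpos_imp_nonincreasing[OF T, where f = H])
    fix t assume t: "0 \<le> t" "t \<le> T"
    define A where "A = A0 + t * D"
    define S where "S = S0 + t * s"
    define P where "P = P0 + t * \<pi>"
    have Apos: "A > 0" using A t by (simp add: A_def add_pos_nonneg)
    define w where "w = S / A - a"
    define r where "r = s - (w + a) * D"
    have r: "r \<le> 0" using s[OF t] by (simp add: r_def w_def A_def S_def)
    define Y where "Y = (1 - a) * exp (- w) * P"
    have Y: "Y \<le> A" using X[OF t] by (simp add: Y_def w_def A_def S_def P_def)
    have dA: "((\<lambda>t. A0 + t * D) has_real_derivative D) (at t)"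
      and dS: "((\<lambda>t. S0 + t * s) has_real_derivative s) (at t)"
      and dP: "((\<lambda>t. P0 + t * \<pi>) has_real_derivative \<pi>) (at t)"
      by (auto intro!: derivative_eq_intros)
    have "((\<lambda>t. (S0 + t * s) / (A0 + t * D) - a) has_real_derivative
        (s * A - S * D) / (A * A) - 0) (at t)"
      using DERIV_diff[OF DERIV_divide[OF dS dA] DERIV_const[of a]] Apos by (simp add: A_def S_def)
    moreover have "(s * A - S * D) / (A * A) - 0 = r / A"
      using Apos by (simp add: r_def w_def field_simps)
    ultimately have dw: "((\<lambda>t. (S0 + t * s) / (A0 + t * D) - a) has_real_derivative r / A) (at t)"
      by simp
    have chain: "((\<lambda>t. h ((S0 + t * s) / (A0 + t * D) - a)) has_real_derivative h' * (r / A)) (at t)"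
      if "(h has_real_derivative h') (at w)" for h h'
      by (rule DERIV_chain2[OF _ dw]) (use that in \<open>simp add: w_def S_def A_def\<close>)
    have "((\<lambda>v. exp (- v)) has_real_derivative - exp (- w)) (at w)"
      by (auto intro!: derivative_eq_intros)
    from chain[OF this]
    have de: "((\<lambda>t. exp (a - (S0 + t * s) / (A0 + t * D))) has_real_derivative - exp (- w) * (r / A)) (at t)"
      by simp
    define M' where "M' = (M w - g w) / a"
    define H' where "H' = D * (f w + a * f1 w) + A * (f1 w + a * g w) * (r / A)
       + (1 - a) * M' * (r / A) * (exp (- w) * P - (1 + a) * A)
       + (1 - a) * M w * (- exp (- w) * (r / A) * P + exp (- w) * \<pi> - (1 + a) * D) - \<rho>"
    have e1: "exp (a - S / A) = exp (- w)"
      by (simp add: w_def)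
    have e2: "w = (S0 + t * s) / (A0 + t * D) - a" by (simp add: w_def S_def A_def)
    have d\<rho>: "((\<lambda>t. t * \<rho>) has_real_derivative \<rho>) (at t)"
      by (auto intro!: derivative_eq_intros)
    have DH: "(H has_real_derivative H') (at t)"
      unfolding H_def \<Lambda>_def
      by (rule DERIV_cong[OF DERIV_diff[OF DERIV_add[OF
            DERIV_mult[OF dA DERIV_add[OF chain[OF K(1)] DERIV_cmult[OF chain[OF K(2)]]]]
            DERIV_mult[OF DERIV_cmult[OF chain[OF K(3)]]
              DERIV_diff[OF DERIV_mult[OF de dP] DERIV_cmult[OF dA]]]] d\<rho>]])
         (simp only: A_def[symmetric] P_def[symmetric] S_def[symmetric] w_def[symmetric] e1 M'_def[symmetric],
          use Apos in \<open>simp add: H'_def field_simps\<close>)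
    have eq: "H' = (D * f w + a * D * f1 w + f1 w * r + a * g w * r - (1 - a) * (1 + a) * M' * r
       + (1 - a) * M w * (exp (- w) * \<pi> - (1 + a) * D) - \<rho>) + r * (M' - M w) * (Y / A)"
      using Apos by (simp add: H'_def Y_def field_simps)
    \<comment> \<open>Up to algebra, the derivative is the supporting plane at w applied to the
      increments, minus \<rho>, minus \<open>r * (M' - M w) * (1 - Y / A)\<close>. The last product
      is nonnegative: the added part has a lower mean, the kernel condition gives the sign of
      \<open>M' - M w\<close>, and \<open>Y \<le> A\<close> holds inside the domain.\<close>
    have "M' - M w \<le> 0" using K(4)[of w] a by (simp add: M'_def field_simps)
    then have "0 \<le> r * (M' - M w)" using r by (simp add: mult_nonpos_nonpos)
    moreover have "Y / A \<le> 1" using Y Apos by simp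
    ultimately have "r * (M' - M w) * (Y / A) \<le> r * (M' - M w)"
      using mult_left_le by blast
    then have "H' \<le> (D * f w + a * D * f1 w + f1 w * r + a * g w * r - (1 - a) * (1 + a) * M' * r
       + (1 - a) * M w * (exp (- w) * \<pi> - (1 + a) * D) - \<rho>) + r * (M' - M w)"
      unfolding eq by simp
    also have "\<dots> = D * f w + a * D * f1 w + f1 w * r + r * (a * g w + a * (a * M') - M w)
       + (1 - a) * M w * (exp (- w) * \<pi> - (1 + a) * D) - \<rho>"
      by (simp add: algebra_simps)
    also have "a * M' = M w - g w" using a by (simp add: M'_def)
    also have "D * f w + a * D * f1 w + f1 w * r + r * (a * g w + a * (M w - g w) - M w)
       + (1 - a) * M w * (exp (- w) * \<pi> - (1 + a) * D) - \<rho>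
      = f w * D + f1 w * (s - w * D) + (1 - a) * M w * (exp (- w) * \<pi> - D - (s - w * D)) - \<rho>"
      by (simp add: r_def algebra_simps)
    also have "\<dots> \<le> 0" using plane[OF t e2] by simp
    finally show "\<exists>d. (H has_real_derivative d) (at t) \<and> d \<le> 0" using DH by blast
  qed
  then show ?thesis by (simp add: H_def)
qed

text \<open>With \<alpha> = S / A and X = P / A * exp (- \<alpha>), this \<open>Z\<close> is the
  increasing quantity of the overview. Its derivative is estimated by the tangent of exp at
  \<open>S / A - a\<close>, the starting abscissa of the Bellman tangent, together with the domain
  bound on \<open>P\<close>; the resulting lower bound is exactly 0, whatever is added.\<close>

lemma weak_type_piece:
  fixes a :: real
  assumes a: "0 < a" "a < 1"
  defines "Z \<equiv> \<lambda>A S P. (1 - 1 / a) * (S / A) + (1 / a) * ln P + (a - 1 / a) * ln A"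
  assumes A: "0 < A0" "0 \<le> D" and P: "0 < P0" "0 \<le> \<pi>" and T: "0 \<le> T0" "T0 \<le> T"
    and X: "\<And>t. 0 \<le> t \<Longrightarrow> t \<le> T \<Longrightarrow>
      (1 - a) * exp (a - (S0 + t * s) / (A0 + t * D)) * (P0 + t * \<pi>) \<le> A0 + t * D"
    and jensen: "\<And>z. exp z * ((1 - z) * D + s) \<le> \<pi>"
  shows "Z (A0 + T0 * D) (S0 + T0 * s) (P0 + T0 * \<pi>) \<le> Z (A0 + T * D) (S0 + T * s) (P0 + T * \<pi>)"
proof (rule DERIV_nonneg_imp_nondecreasing[OF T(2), where f = "\<lambda>t. Z (A0 + t * D) (S0 + t * s) (P0 + t * \<pi>)"])
  fix t assume t0: "T0 \<le> t" "t \<le> T"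
  have t: "0 \<le> t" "t \<le> T" using t0 T by auto
  define A where "A = A0 + t * D"
  define S where "S = S0 + t * s"
  define P where "P = P0 + t * \<pi>"
  have Apos: "A > 0" using A t by (simp add: A_def add_pos_nonneg)
  have Ppos: "P > 0" using P t by (simp add: P_def add_pos_nonneg)
  define d where "d = (1 - 1 / a) * ((s - S / A * D) / A) + (1 / a) * (\<pi> / P) + (a - 1 / a) * (D / A)"
  have dA: "((\<lambda>t. A0 + t * D) has_real_derivative D) (at t)"
    and dS: "((\<lambda>t. S0 + t * s) has_real_derivative s) (at t)"
    and dP: "((\<lambda>t. P0 + t * \<pi>) has_real_derivative \<pi>) (at t)"
    by (auto intro!: derivative_eq_intros)
  have D: "((\<lambda>t. Z (A0 + t * D) (S0 + t * s) (P0 + t * \<pi>)) has_real_derivative d) (at t)"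
    unfolding Z_def
    by (rule DERIV_cong[OF DERIV_add[OF DERIV_add[OF
          DERIV_cmult[OF DERIV_divide[OF dS dA]]
          DERIV_cmult[OF DERIV_chain2[OF DERIV_ln_divide dP]]]
          DERIV_cmult[OF DERIV_chain2[OF DERIV_ln_divide dA]]]])
       (use Apos Ppos in \<open>simp_all only: A_def[symmetric] P_def[symmetric] S_def[symmetric]\<close>,
        use Apos Ppos a in \<open>simp_all add: d_def field_simps\<close>)
  define z where "z = S / A - a"
  have "exp (- z) * (exp z * ((1 - z) * D + s)) \<le> exp (- z) * \<pi>"
    by (intro mult_left_mono jensen) simp
  then have *: "(1 - z) * D + s \<le> exp (- z) * \<pi>" by (simp add: mult.assoc[symmetric] exp_add[symmetric])
  have "(1 - a) * exp (- z) * P \<le> A"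
    using X[OF t] by (simp add: z_def A_def S_def P_def)
  then have "(1 - a) * exp (- z) * P * \<pi> \<le> A * \<pi>" using P(2) by (rule mult_right_mono)
  then have "(1 - a) * (exp (- z) * \<pi>) \<le> A * (\<pi> / P)" using Ppos by (simp add: field_simps)
  moreover have "(1 - a) * ((1 - z) * D + s) \<le> (1 - a) * (exp (- z) * \<pi>)"
    using * a by (intro mult_left_mono) auto
  ultimately have **: "(1 - a) * ((1 - z) * D + s) \<le> A * (\<pi> / P)" by linarith
  have "a * A * d = (a - 1) * (s - (z + a) * D) + A * (\<pi> / P) + (a * a - 1) * D"
    using a Apos Ppos by (simp add: d_def z_def field_simps)
  also have "\<dots> \<ge> (a - 1) * (s - (z + a) * D) + (1 - a) * ((1 - z) * D + s) + (a * a - 1) * D"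
    using ** by simp
  also have "(a - 1) * (s - (z + a) * D) + (1 - a) * ((1 - z) * D + s) + (a * a - 1) * D = 0"
    by (simp add: algebra_simps)
  finally have "0 \<le> (a * A) * d" .
  moreover have "0 < a * A" using a Apos by simp
  ultimately have "0 \<le> d" by (simp only: zero_le_mult_iff) auto
  then show "\<exists>d. ((\<lambda>t. Z (A0 + t * D) (S0 + t * s) (P0 + t * \<pi>)) has_real_derivative d) (at t) \<and> 0 \<le> d"
    using D by blast
qed

section \<open>Chains of sets: discrete levels joined by linear interpolation\<close>

lemma first_zero:
  fixes u :: "real \<Rightarrow> real"
  assumes "continuous_on {0..t} u" "0 \<le> t" "u 0 \<le> 0" "0 < u t"
  obtains \<tau> where "0 \<le> \<tau>" "\<tau> \<le> t" "u \<tau> = 0" "\<And>x. 0 \<le> x \<Longrightarrow> x \<le> \<tau> \<Longrightarrow> u x \<le> 0"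
proof -
  define Z where "Z = {0..t} \<inter> u -` {0..}"
  have cl: "closed Z" unfolding Z_def
    using continuous_on_closed_vimage[THEN iffD1, rule_format, of "{0..t}" u "{0..}"] assms(1)
    by (simp add: Int_commute)
  have ne: "Z \<noteq> {}" and bb: "bdd_below Z" using assms by (auto simp: Z_def intro!: bdd_belowI[of _ 0])
  define \<tau> where "\<tau> = Inf Z"
  have \<tau>: "\<tau> \<in> Z" unfolding \<tau>_def by (rule closed_contains_Inf[OF ne bb cl])
  have below: "u x < 0" if "0 \<le> x" "x < \<tau>" for x
  proof (rule ccontr)
    assume "\<not> u x < 0"
    then have "x \<in> Z" using that \<tau> by (auto simp: Z_def)
    then have "\<tau> \<le> x" unfolding \<tau>_def by (rule cInf_lower[OF _ bb])
    then show False using that by simp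
  qed
  have "u \<tau> = 0"
  proof (rule ccontr)
    assume "u \<tau> \<noteq> 0"
    then have "0 < u \<tau>" using \<tau> by (auto simp: Z_def)
    moreover have "continuous_on {0..\<tau>} u" using assms(1) \<tau> by (auto simp: Z_def intro: continuous_on_subset)
    ultimately obtain x where "0 \<le> x" "x \<le> \<tau>" "u x = 0"
      using IVT'[of u 0 0 \<tau>] assms(3) \<tau> by (auto simp: Z_def)
    then show False using below[of x] \<open>0 < u \<tau>\<close> by (cases "x = \<tau>") auto
  qed
  then show ?thesis using that[of \<tau>] \<tau> below by (force simp: Z_def less_le)
qed

lemma interpolated_ratio:
  fixes A0 A1 S0 S1 t :: real
  assumes "0 < A0" "A0 \<le> A1" "0 \<le> t" "t \<le> 1" "S1 / A1 \<le> S0 / A0"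
  shows "0 < A0 + t * (A1 - A0)"
    "S1 / A1 \<le> (S0 + t * (S1 - S0)) / (A0 + t * (A1 - A0))"
    "(S0 + t * (S1 - S0)) / (A0 + t * (A1 - A0)) \<le> S0 / A0"
    "S1 - S0 \<le> (S0 + t * (S1 - S0)) / (A0 + t * (A1 - A0)) * (A1 - A0)"
proof -
  show pos: "0 < A0 + t * (A1 - A0)" using assms by (simp add: add_pos_nonneg)
  define r0 where "r0 = S0 / A0"
  define r1 where "r1 = S1 / A1"
  have S: "S0 = r0 * A0" "S1 = r1 * A1" and r: "r1 \<le> r0" using assms by (auto simp: r0_def r1_def)
  have eq: "S0 + t * (S1 - S0) = (1 - t) * A0 * r0 + t * A1 * r1" by (simp add: S algebra_simps)
  have A: "A0 + t * (A1 - A0) = (1 - t) * A0 + t * A1" by (simp add: algebra_simps)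
  have "(1 - t) * A0 * r1 \<le> (1 - t) * A0 * r0" "t * A1 * r1 \<le> t * A1 * r0"
    using r assms by (auto intro!: mult_left_mono)
  then have "r1 * (A0 + t * (A1 - A0)) \<le> S0 + t * (S1 - S0)" "S0 + t * (S1 - S0) \<le> r0 * (A0 + t * (A1 - A0))"
    unfolding eq A by (auto simp: algebra_simps)
  then show 1: "S1 / A1 \<le> (S0 + t * (S1 - S0)) / (A0 + t * (A1 - A0))"
    "(S0 + t * (S1 - S0)) / (A0 + t * (A1 - A0)) \<le> S0 / A0"
    using pos by (auto simp: pos_le_divide_eq pos_divide_le_eq r0_def[symmetric] r1_def[symmetric])
  have "S1 - S0 = r1 * (A1 - A0) + (r1 - r0) * A0" by (simp add: S algebra_simps)
  also have "\<dots> \<le> r1 * (A1 - A0)" using r assms by (simp add: mult_nonpos_nonneg)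
  also have "\<dots> \<le> (S0 + t * (S1 - S0)) / (A0 + t * (A1 - A0)) * (A1 - A0)"
    using 1(1) assms by (intro mult_right_mono) (auto simp: r1_def)
  finally show "S1 - S0 \<le> (S0 + t * (S1 - S0)) / (A0 + t * (A1 - A0)) * (A1 - A0)" .
qed

text \<open>For a chain of sets \<open>U\<^sub>i\<close>, the numbers \<open>A i\<close>, \<open>S i\<close>, \<open>P i\<close> and \<open>R i \<kappa>\<close> are the integrals over \<open>U\<^sub>i\<close> of
  \<open>1\<close>, \<open>\<phi>\<close>, \<open>exp \<phi>\<close> and \<open>f (\<phi> - \<kappa>)\<close>, with \<open>\<phi>\<close> replaced by its average on \<open>U\<^sub>0\<close>. Linear interpolation
  turns the chain into a path; the conclusion says that it never leaves the domain: at the first exit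
  point \<open>\<kappa>\<close> the quantity \<open>\<Lambda>\<close> centred at \<open>\<kappa>\<close> would exceed \<open>b\<close> times the mass.\<close>

lemma bellman_chain:
  fixes A S P :: "nat \<Rightarrow> real" and R :: "nat \<Rightarrow> real \<Rightarrow> real"
  assumes a: "0 < a" "a < 1" and ker: "bellman_kernel a f f1 g M"
    and h: "(1 - a) * (exp (a + h) - 1) \<le> a + h" "0 \<le> h"
    and A: "0 < A 0" "\<And>i. i < n \<Longrightarrow> A i \<le> A (Suc i)"
    and step: "\<And>i. i < n \<Longrightarrow> S (Suc i) / A (Suc i) \<le> S i / A i"
      "\<And>i. i < n \<Longrightarrow> S i / A i \<le> S (Suc i) / A (Suc i) + h"
    and P0: "P 0 = A 0 * exp (S 0 / A 0)"
    and plane: "\<And>i \<kappa> w. i < n \<Longrightarrow> S i / A i \<le> w + a + h \<Longrightarrow>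
        f (w - \<kappa>) * (A (Suc i) - A i) + f1 (w - \<kappa>) * (S (Suc i) - S i - w * (A (Suc i) - A i))
        + (1 - a) * M (w - \<kappa>) * (exp (- w) * (P (Suc i) - P i) - (A (Suc i) - A i)
            - (S (Suc i) - S i - w * (A (Suc i) - A i)))
        \<le> R (Suc i) \<kappa> - R i \<kappa>"
    and R0: "\<And>\<kappa>. R 0 \<kappa> = A 0 * f (S 0 / A 0 - \<kappa>)"
    and Rb: "\<And>i \<kappa>. i \<le> n \<Longrightarrow> \<bar>\<kappa> - S i / A i\<bar> \<le> h \<Longrightarrow> R i \<kappa> \<le> b * A i"
    and b: "b < f (- a) + a * f1 (- a) + a\<^sup>2 * M (- a)"
    and i: "i < n" and t: "0 \<le> t" "t \<le> 1"
  shows "(1 - a) * exp (a - (S i + t * (S (Suc i) - S i)) / (A i + t * (A (Suc i) - A i)))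
       * (P i + t * (P (Suc i) - P i)) \<le> A i + t * (A (Suc i) - A i)"
  using i t
proof (induction i arbitrary: t rule: less_induct)
  case (less i)
  have Apos: "0 < A j" if "j \<le> n" for j
    using that A by (induction j) (auto intro: less_le_trans)
  note I = interpolated_ratio[OF Apos A(2) _ _ step(1)]
  define u where "u t = (1 - a) * exp (a - (S i + t * (S (Suc i) - S i)) / (A i + t * (A (Suc i) - A i)))
       * (P i + t * (P (Suc i) - P i)) - (A i + t * (A (Suc i) - A i))" for t
  have "u t \<le> 0"
  proof (rule ccontr)
    assume "\<not> u t \<le> 0"
    then have ut: "0 < u t" by simp
    \<comment> \<open>\<open>u\<close> is the excess over the upper boundary. The chain starts on
      the lower boundary, which is below the upper one because
      \<open>(1 - a) * exp a \<le> 1\<close>; a later piece starts where the previous one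
      ended.\<close>
    have u0: "u 0 \<le> 0"
    proof (cases i)
      case 0
      have "(1 - a) * exp a \<le> 1"
        using exp_ge_add_one_self[of "- a"] a by (simp add: exp_minus field_simps)
      then have "A 0 * ((1 - a) * exp a) \<le> A 0 * 1" using A by (intro mult_left_mono) auto
      moreover have "(1 - a) * exp (a - S 0 / A 0) * (A 0 * exp (S 0 / A 0)) = A 0 * ((1 - a) * exp a)"
        by (simp add: exp_diff)
      ultimately have "(1 - a) * exp (a - S 0 / A 0) * (A 0 * exp (S 0 / A 0)) \<le> A 0"
        by linarith
      then show ?thesis by (simp add: u_def 0 P0)
    next
      case (Suc j)
      show ?thesis using less.IH[of j 1] less.prems Suc by (simp add: u_def)
    qed
    have cont: "continuous_on {0..t} u"
      unfolding u_def using I(1)[of i] less.prems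
      by (intro continuous_intros) (auto simp: less_le)
    obtain \<tau> where \<tau>: "0 \<le> \<tau>" "\<tau> \<le> t" "u \<tau> = 0" "\<And>x. 0 \<le> x \<Longrightarrow> x \<le> \<tau> \<Longrightarrow> u x \<le> 0"
      using first_zero[OF cont less.prems(2) u0 ut] by blast
    have \<tau>1: "\<tau> \<le> 1" using \<tau> less.prems by simp
    \<comment> \<open>Centring at the mean reached at the exit time moves the tangent parameter to
      \<open>- a\<close>, where the value per unit of mass is
      \<open>f (- a) + a * f1 (- a) + a\<^sup>2 * M (- a)\<close>, the number assumed to exceed
      \<open>b\<close>.\<close>
    define \<kappa> where "\<kappa> = (S i + \<tau> * (S (Suc i) - S i)) / (A i + \<tau> * (A (Suc i) - A i))"
    define \<Lambda> where "\<Lambda> A S P = A * (f (S / A - a - \<kappa>) + a * f1 (S / A - a - \<kappa>))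
        + (1 - a) * M (S / A - a - \<kappa>) * (exp (a - S / A) * P - (1 + a) * A)" for A S P
    note kers = bellman_kernel_shift[OF ker, of \<kappa>]
    have piece: "\<Lambda> (A j + T * (A (Suc j) - A j)) (S j + T * (S (Suc j) - S j)) (P j + T * (P (Suc j) - P j))
        \<le> \<Lambda> (A j) (S j) (P j) + T * (R (Suc j) \<kappa> - R j \<kappa>)"
      if j: "j < n" and T: "0 \<le> T" "T \<le> 1" and ok: "\<And>t. 0 \<le> t \<Longrightarrow> t \<le> T \<Longrightarrow>
          (1 - a) * exp (a - (S j + t * (S (Suc j) - S j)) / (A j + t * (A (Suc j) - A j)))
            * (P j + t * (P (Suc j) - P j)) \<le> A j + t * (A (Suc j) - A j)" for j T
      unfolding \<Lambda>_def
    proof (rule bellman_piece[OF a kers])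
      show "0 < A j" "0 \<le> A (Suc j) - A j" "0 \<le> T" using Apos[of j] A(2)[OF j] j T by auto
      fix t assume t: "0 \<le> t" "t \<le> T"
      show "S (Suc j) - S j \<le> (S j + t * (S (Suc j) - S j)) / (A j + t * (A (Suc j) - A j)) * (A (Suc j) - A j)"
        using I(4)[of j t] j t T by auto
      show "(1 - a) * exp (a - (S j + t * (S (Suc j) - S j)) / (A j + t * (A (Suc j) - A j)))
            * (P j + t * (P (Suc j) - P j)) \<le> A j + t * (A (Suc j) - A j)" by (rule ok[OF t])
      fix w assume w: "w = (S j + t * (S (Suc j) - S j)) / (A j + t * (A (Suc j) - A j)) - a"
      have "S j / A j \<le> w + a + h"
        using step(2)[OF j] I(2)[of j t] j t T by (auto simp: w)
      from plane[OF j this]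
      show "f (w - \<kappa>) * (A (Suc j) - A j) + f1 (w - \<kappa>) * (S (Suc j) - S j - w * (A (Suc j) - A j))
        + (1 - a) * M (w - \<kappa>) * (exp (- w) * (P (Suc j) - P j) - (A (Suc j) - A j)
            - (S (Suc j) - S j - w * (A (Suc j) - A j)))
        \<le> R (Suc j) \<kappa> - R j \<kappa>" .
    qed
    \<comment> \<open>The starting point is on the lower boundary, at distance \<open>a\<close> to
      the right of the tangent parameter, so this is the plane inequality with
      \<open>y = a\<close>.\<close>
    have start: "\<Lambda> (A 0) (S 0) (P 0) \<le> R 0 \<kappa>"
    proof -
      have "f (S 0 / A 0 - a - \<kappa>) + f1 (S 0 / A 0 - a - \<kappa>) * a
            + (1 - a) * M (S 0 / A 0 - a - \<kappa>) * (exp a - 1 - a) \<le> f (S 0 / A 0 - a - \<kappa> + a)"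
        by (rule bellman_kernel_plane_le[OF a ker h(1)]) (use a h in auto)
      then have "A 0 * (f (S 0 / A 0 - a - \<kappa>) + f1 (S 0 / A 0 - a - \<kappa>) * a
            + (1 - a) * M (S 0 / A 0 - a - \<kappa>) * (exp a - 1 - a)) \<le> A 0 * f (S 0 / A 0 - \<kappa>)"
        using A by simp
      moreover have "exp (a - S 0 / A 0) * P 0 = A 0 * exp a" by (simp add: P0 exp_diff)
      ultimately show ?thesis unfolding \<Lambda>_def R0 by (simp add: algebra_simps)
    qed
    have "\<Lambda> (A j) (S j) (P j) \<le> R j \<kappa>" if "j \<le> i" for j
      using that
    proof (induction j)
      case (Suc j)
      have "\<Lambda> (A j + 1 * (A (Suc j) - A j)) (S j + 1 * (S (Suc j) - S j)) (P j + 1 * (P (Suc j) - P j))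
        \<le> \<Lambda> (A j) (S j) (P j) + 1 * (R (Suc j) \<kappa> - R j \<kappa>)"
        by (rule piece) (use Suc.prems less in auto)
      then show ?case using Suc by simp
    qed (use start in simp)
    from this[of i]
    have "\<Lambda> (A i + \<tau> * (A (Suc i) - A i)) (S i + \<tau> * (S (Suc i) - S i)) (P i + \<tau> * (P (Suc i) - P i))
        \<le> R i \<kappa> + \<tau> * (R (Suc i) \<kappa> - R i \<kappa>)"
      using piece[of i \<tau>] \<tau> \<tau>1 less.prems by (auto simp: u_def)
    also have "\<dots> = (1 - \<tau>) * R i \<kappa> + \<tau> * R (Suc i) \<kappa>" by (simp add: algebra_simps)
    also have "\<dots> \<le> (1 - \<tau>) * (b * A i) + \<tau> * (b * A (Suc i))"
    proof -
      \<comment> \<open>The exit mean lies between two consecutive means, which differ by at most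
        \<open>h\<close>, so \<open>Rb\<close> applies at both ends of the piece.\<close>
      have "\<bar>\<kappa> - S i / A i\<bar> \<le> h" "\<bar>\<kappa> - S (Suc i) / A (Suc i)\<bar> \<le> h"
        using I(2,3)[of i \<tau>] step(2)[of i] less.prems \<tau> \<tau>1 by (auto simp: \<kappa>_def)
      then show ?thesis using Rb[of i \<kappa>] Rb[of "Suc i" \<kappa>] less.prems \<tau> \<tau>1
        by (intro add_mono mult_left_mono) auto
    qed
    also have "\<dots> = b * (A i + \<tau> * (A (Suc i) - A i))" by (simp add: algebra_simps)
    finally have le: "\<Lambda> (A i + \<tau> * (A (Suc i) - A i)) (S i + \<tau> * (S (Suc i) - S i)) (P i + \<tau> * (P (Suc i) - P i))
      \<le> b * (A i + \<tau> * (A (Suc i) - A i))" .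
    define At where "At = A i + \<tau> * (A (Suc i) - A i)"
    define Pt where "Pt = P i + \<tau> * (P (Suc i) - P i)"
    have At: "At > 0" using I(1)[of i \<tau>] less.prems \<tau> \<tau>1 by (auto simp: At_def)
    have At_eq: "(1 - a) * (exp (a - \<kappa>) * Pt) = At" using \<tau>(3) by (simp add: u_def \<kappa>_def Pt_def At_def)
    have "(1 - a) * M (- a) * (exp (a - \<kappa>) * Pt - (1 + a) * At)
        = M (- a) * ((1 - a) * (exp (a - \<kappa>) * Pt) - (1 - a) * (1 + a) * At)"
      by (simp add: algebra_simps)
    also have "\<dots> = M (- a) * (At - (1 - a) * (1 + a) * At)" by (simp only: At_eq)
    also have "\<dots> = At * (a\<^sup>2 * M (- a))" by (simp add: algebra_simps power2_eq_square)
    finally have "(1 - a) * M (- a) * (exp (a - \<kappa>) * Pt - (1 + a) * At) = At * (a\<^sup>2 * M (- a))" .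
    moreover have "At * (f (- a) + a * f1 (- a)) + (1 - a) * M (- a) * (exp (a - \<kappa>) * Pt - (1 + a) * At) \<le> b * At"
      using le[unfolded \<Lambda>_def, folded \<kappa>_def, folded At_def Pt_def] by simp
    ultimately have "At * (f (- a) + a * f1 (- a)) + At * (a\<^sup>2 * M (- a)) \<le> b * At" by linarith
    then have "At * (f (- a) + a * f1 (- a) + a\<^sup>2 * M (- a)) \<le> At * b" by (simp add: algebra_simps)
    then show False using At b by simp
  qed
  then show ?case by (simp add: u_def)
qed

text \<open>The supremum of the left-hand side over y, a Legendre transform of ln cosh, is
  \<open>((1 + a) * ln (1 + a) + (1 - a) * ln (1 - a)) / 2\<close>; the upper bound follows from
  convexity of exp with weights (1 + a) / 2 and (1 - a) / 2. Then \<open>E a \<le> 0\<close> removes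
  ln (1 + a), leaving only the logarithm that occurs in the domain constant.\<close>

lemma linear_minus_ln_cosh_le:
  fixes a y :: real
  assumes a: "0 < a" "a < 1"
  shows "a * y - ln (cosh y) \<le> a + (1 - a) * ln (1 - a)"
proof -
  define E where "E x = (1 + x) * ln (1 + x) - (1 - x) * ln (1 - x) - 2 * x" for x :: real
  have "E a \<le> E 0"
  proof (rule DERIV_nonpos_imp_nonincreasing[where f = E])
    fix x assume x: "0 \<le> x" "x \<le> a"
    have "(E has_real_derivative ln (1 + x) + ln (1 - x)) (at x)"
      unfolding E_def using x a by (auto intro!: derivative_eq_intros)
    moreover have "ln (1 + x) + ln (1 - x) = ln ((1 + x) * (1 - x))"
      using x a by (simp add: ln_mult)
    moreover have "0 < (1 + x) * (1 - x)" "(1 + x) * (1 - x) \<le> 1"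
      using x a by (simp, simp add: algebra_simps)
    then have "ln ((1 + x) * (1 - x)) \<le> 0" by (simp only: ln_le_zero_iff)
    ultimately show "\<exists>d. (E has_real_derivative d) (at x) \<and> d \<le> 0" by auto
  qed (use a in simp)
  then have E: "(1 + a) * ln (1 + a) - (1 - a) * ln (1 - a) \<le> 2 * a" by (simp add: E_def)
  define t where "t = (1 - a) / 2"
  have t: "0 \<le> t" "t \<le> 1" "1 - t = (1 + a) / 2" using a by (auto simp: t_def field_simps)
  have "exp ((1 - t) *\<^sub>R (y - ln (1 + a)) + t *\<^sub>R (- y - ln (1 - a)))
      \<le> (1 - t) * exp (y - ln (1 + a)) + t * exp (- y - ln (1 - a))"
    by (rule convex_onD[OF exp_convex]) (use t in auto)
  also have "\<dots> = cosh y"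
  proof -
    have "c / 2 * (x / c) = x / 2" if "c \<noteq> 0" for c x :: real using that by simp
    from this[of "1 + a" "exp y"] this[of "1 - a" "exp (- y)"]
    have "(1 + a) / 2 * (exp y / (1 + a)) = exp y / 2" "(1 - a) / 2 * (exp (- y) / (1 - a)) = exp (- y) / 2"
      using a by simp_all
    then show ?thesis unfolding t(3) using a by (simp add: t_def exp_diff cosh_def)
  qed
  finally have "exp ((1 - t) * (y - ln (1 + a)) + t * (- y - ln (1 - a))) \<le> cosh y" by simp
  then have "(1 - t) * (y - ln (1 + a)) + t * (- y - ln (1 - a)) \<le> ln (cosh y)"
    by (subst ln_ge_iff) (auto simp: cosh_real_pos)
  moreover have "(1 - t) * (y - ln (1 + a)) + t * (- y - ln (1 - a))
      = a * y - ((1 + a) * ln (1 + a) + (1 - a) * ln (1 - a)) / 2"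
    unfolding t(3) by (simp add: t_def field_simps)
  ultimately show ?thesis using E by (simp add: field_simps)
qed

text \<open>If the measure does not exceed twice its initial value, the domain bound at the end
  alone limits \<open>lam\<close>. Otherwise the monotonicity of \<open>Z\<close> from the doubling
  time to the end turns into exponential decay of the initial measure. In the first alternative the
  exponential factor of the second one is at least 1, so the tail bound is trivial there.\<close>

lemma weak_type_chain:
  fixes A S P :: "nat \<Rightarrow> real"
  assumes a: "0 < a" "a < 1" and n: "0 < n"
    and A: "0 < A 0" "\<And>i. i < n \<Longrightarrow> A i \<le> A (Suc i)"
    and P: "P 0 = A 0 * exp (S 0 / A 0)" "\<And>i. i < n \<Longrightarrow> P i \<le> P (Suc i)"
    and jensen: "\<And>i z. i < n \<Longrightarrow> exp z * ((1 - z) * (A (Suc i) - A i) + (S (Suc i) - S i)) \<le> P (Suc i) - P i"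
    and ok: "\<And>i t. i < n \<Longrightarrow> 0 \<le> t \<Longrightarrow> t \<le> 1 \<Longrightarrow>
       (1 - a) * exp (a - (S i + t * (S (Suc i) - S i)) / (A i + t * (A (Suc i) - A i)))
       * (P i + t * (P (Suc i) - P i)) \<le> A i + t * (A (Suc i) - A i)"
  defines "lam \<equiv> S 0 / A 0 - S n / A n"
  assumes lam: "0 \<le> lam"
  shows "lam \<le> - ln (1 - a) \<or> 2 * A 0 \<le> A n * exp ((- ln (1 - a) - lam) / a)"
proof -
  have Apos: "0 < A j" if "j \<le> n" for j
    using that A by (induction j) (auto intro: less_le_trans)
  have Ppos: "0 < P j" if "j \<le> n" for j
    using that A P by (induction j) (auto intro: less_le_trans)
  have sum: "exp z * ((1 - z) * (A i - A 0) + (S i - S 0)) \<le> P i - P 0" if "i \<le> n" for i z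
    using that
  proof (induction i)
    case (Suc i)
    have "exp z * ((1 - z) * (A (Suc i) - A 0) + (S (Suc i) - S 0)) =
       exp z * ((1 - z) * (A i - A 0) + (S i - S 0)) +
       exp z * ((1 - z) * (A (Suc i) - A i) + (S (Suc i) - S i))" by (simp add: algebra_simps)
    also have "\<dots> \<le> (P i - P 0) + (P (Suc i) - P i)"
      using Suc jensen[of i z] by (intro add_mono) auto
    finally show ?case by simp
  qed simp
  have final: "(1 - a) * exp (a - S n / A n) * P n \<le> A n"
    using ok[of "n - 1" 1] n by simp
  define \<alpha> where "\<alpha> = S n / A n"
  have Sn: "S n = \<alpha> * A n" using Apos[of n] by (simp add: \<alpha>_def)
  have S0: "S 0 = (\<alpha> + lam) * A 0" using A by (simp add: lam_def \<alpha>_def)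
  have P0: "P 0 = A 0 * exp (\<alpha> + lam)" using P(1) by (simp add: lam_def \<alpha>_def)
  show ?thesis
  proof (cases "A n \<le> 2 * A 0")
    case True
    \<comment> \<open>If the measure exactly doubled, the added part would have mean \<alpha> - lam,
      and the tangent of exp at that point would give the hyperbolic cosine. A smaller added part
      only helps, because \<open>exp lam \<ge> exp (- lam) * (1 + 2 * lam)\<close>.\<close>
    have "A n * exp \<alpha> * cosh lam \<le> P n"
    proof -
      have "exp (2 * lam) \<ge> 1 + 2 * lam" by simp
      then have "exp (- lam) * (1 + 2 * lam) \<le> exp (- lam) * exp (2 * lam)" by (intro mult_left_mono) auto
      then have "0 \<le> exp lam - exp (- lam) * (1 + 2 * lam)" by (simp add: exp_add[symmetric])
      then have "0 \<le> (2 * A 0 - A n) * (exp lam - exp (- lam) * (1 + 2 * lam))" using True by simp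
      then have "A n * (exp lam + exp (- lam)) \<le> 2 * (A 0 * exp lam + exp (- lam) * (A n * (1 + lam) - A 0 * (1 + 2 * lam)))"
        by (simp add: algebra_simps)
      then have "A n * cosh lam \<le> A 0 * exp lam + exp (- lam) * (A n * (1 + lam) - A 0 * (1 + 2 * lam))"
        by (simp add: cosh_def)
      then have "exp \<alpha> * (A n * cosh lam) \<le> exp \<alpha> * (A 0 * exp lam + exp (- lam) * (A n * (1 + lam) - A 0 * (1 + 2 * lam)))"
        by simp
      also have "\<dots> = P 0 + exp (\<alpha> - lam) * ((1 - (\<alpha> - lam)) * (A n - A 0) + (S n - S 0))"
        unfolding P0 Sn S0 by (simp add: exp_add exp_diff exp_minus field_simps)
      also have "\<dots> \<le> P n" using sum[of n "\<alpha> - lam"] by simp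
      finally show ?thesis by (simp add: algebra_simps)
    qed
    then have "(1 - a) * exp (a - \<alpha>) * (A n * exp \<alpha> * cosh lam) \<le> (1 - a) * exp (a - \<alpha>) * P n"
      using a by (intro mult_left_mono) auto
    also have "\<dots> \<le> A n" using final by (simp add: \<alpha>_def)
    also have "(1 - a) * exp (a - \<alpha>) * (A n * exp \<alpha> * cosh lam)
        = A n * ((1 - a) * (exp (a - \<alpha>) * exp \<alpha>) * cosh lam)" by simp
    also have "exp (a - \<alpha>) * exp \<alpha> = exp a" by (simp add: exp_add[symmetric])
    finally have "A n * ((1 - a) * exp a * cosh lam) \<le> A n * 1" by simp
    then have "(1 - a) * exp a * cosh lam \<le> 1" using Apos[of n] by (subst (asm) mult_le_cancel_left_pos) auto
    then have "ln ((1 - a) * exp a * cosh lam) \<le> 0"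
      using a by (subst ln_le_zero_iff) (auto intro!: mult_pos_pos simp: cosh_real_pos)
    then have "ln (1 - a) + a + ln (cosh lam) \<le> 0"
      using a by (simp add: ln_mult cosh_real_pos)
    then have "a * lam \<le> a * (- ln (1 - a))"
      using linear_minus_ln_cosh_le[OF a, of lam] by (simp add: algebra_simps)
    then show ?thesis using a by (simp only: mult_le_cancel_left_pos simp_thms)
  next
    case False
    \<comment> \<open>The first piece on which the measure reaches twice its initial value;
      \<open>t\<close> below locates the point of exact doubling inside it.\<close>
    define i where "i = (LEAST i. 2 * A 0 \<le> A (Suc i))"
    have ex: "2 * A 0 \<le> A (Suc (n - 1))" using False n by simp
    have i1: "2 * A 0 \<le> A (Suc i)" unfolding i_def using LeastI[of "\<lambda>i. 2 * A 0 \<le> A (Suc i)", OF ex] .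
    have "i \<le> n - 1" unfolding i_def using Least_le[of "\<lambda>i. 2 * A 0 \<le> A (Suc i)", OF ex] .
    then have i_n: "i < n" using n by simp
    have i0: "A i \<le> 2 * A 0"
    proof (cases i)
      case (Suc j)
      then have "\<not> 2 * A 0 \<le> A (Suc j)" using not_less_Least[of j "\<lambda>i. 2 * A 0 \<le> A (Suc i)"] i_def by simp
      then show ?thesis using Suc by simp
    qed (use A in simp)
    obtain t where t: "0 \<le> t" "t \<le> 1" "A i + t * (A (Suc i) - A i) = 2 * A 0"
    proof (cases "A (Suc i) = A i")
      case True
      then show ?thesis using that[of 0] i0 i1 by simp
    next
      case neq: False
      then have "A i < A (Suc i)" using A(2)[OF i_n] by simp
      then show ?thesis using that[of "(2 * A 0 - A i) / (A (Suc i) - A i)"] i0 i1 by (simp add: field_simps)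
    qed
    define St where "St = S i + t * (S (Suc i) - S i)"
    define Pt where "Pt = P i + t * (P (Suc i) - P i)"
    define \<beta> where "\<beta> = St / (2 * A 0)"
    have St: "St = 2 * A 0 * \<beta>" using A by (simp add: \<beta>_def)
    have sumt: "exp z * ((1 - z) * A 0 + (St - S 0)) \<le> Pt - P 0" for z
    proof -
      have "t * (exp z * ((1 - z) * (A (Suc i) - A i) + (S (Suc i) - S i))) \<le> t * (P (Suc i) - P i)"
        using jensen[OF i_n, of z] t by (intro mult_left_mono) auto
      moreover have "exp z * ((1 - z) * (A i - A 0) + (S i - S 0)) \<le> P i - P 0"
        using sum[of i z] i_n by simp
      moreover have "exp z * ((1 - z) * (A i - A 0) + (S i - S 0)) + t * (exp z * ((1 - z) * (A (Suc i) - A i) + (S (Suc i) - S i)))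
        = exp z * ((1 - z) * ((A i + t * (A (Suc i) - A i)) - A 0) + (St - S 0))"
        by (simp add: St_def algebra_simps)
      ultimately show ?thesis unfolding t(3) Pt_def by simp
    qed
    \<comment> \<open>At the doubling point the initial half has mean \<open>\<beta> + y\<close>, so
      the added half, of equal measure, has mean \<open>\<beta> - y\<close>. The tangent of exp at
      the latter gives the bound by \<open>cosh y\<close>.\<close>
    define y where "y = \<alpha> + lam - \<beta>"
    have Pt: "2 * A 0 * exp \<beta> * cosh y \<le> Pt"
    proof -
      have "exp (\<beta> - y) * ((1 - (\<beta> - y)) * A 0 + (St - S 0)) = exp (\<beta> - y) * A 0"
        unfolding St S0 y_def by (simp add: algebra_simps)
      then have "P 0 + exp (\<beta> - y) * A 0 \<le> Pt" using sumt[of "\<beta> - y"] by simp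
      moreover have "P 0 = A 0 * exp (\<beta> + y)" unfolding P0 by (simp add: y_def)
      ultimately show ?thesis by (simp add: cosh_def exp_add exp_diff exp_minus field_simps)
    qed
    define Z where "Z A S P = (1 - 1 / a) * (S / A) + (1 / a) * ln P + (a - 1 / a) * ln A" for A S P
    have piece: "Z (A j + T0 * (A (Suc j) - A j)) (S j + T0 * (S (Suc j) - S j)) (P j + T0 * (P (Suc j) - P j))
      \<le> Z (A j + 1 * (A (Suc j) - A j)) (S j + 1 * (S (Suc j) - S j)) (P j + 1 * (P (Suc j) - P j))"
      if "j < n" "0 \<le> T0" "T0 \<le> 1" for j T0
      unfolding Z_def
      by (rule weak_type_piece[OF a]) (use that Apos[of j] Ppos[of j] A(2)[of j] P(2)[of j] jensen[of j] ok[of j] in auto)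
    have mono: "Z (A (Suc i)) (S (Suc i)) (P (Suc i)) \<le> Z (A n) (S n) (P n)"
    proof -
      have "Z (A (Suc i)) (S (Suc i)) (P (Suc i)) \<le> Z (A m) (S m) (P m)" if "Suc i \<le> m" "m \<le> n" for m
        using that
      proof (induction m rule: dec_induct)
        case (step m)
        then show ?case using piece[of m 0] by simp
      qed simp
      then show ?thesis using i_n by simp
    qed
    have "Z (2 * A 0) St Pt \<le> Z (A (Suc i)) (S (Suc i)) (P (Suc i))"
      using piece[OF i_n t(1,2)] unfolding t(3) by (simp add: St_def Pt_def)
    also note mono
    finally have Z: "Z (2 * A 0) St Pt \<le> Z (A n) (S n) (P n)" .
    have pos: "0 < 2 * A 0" "0 < A n" "0 < P n" "0 < cosh y"
      using A Apos[of n] Ppos[of n] by (auto simp: cosh_real_pos)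
    have "ln (2 * A 0 * exp \<beta> * cosh y) \<le> ln Pt"
      using Pt pos by (intro ln_mono) (auto intro!: mult_pos_pos)
    then have l1: "ln (2 * A 0) + \<beta> + ln (cosh y) \<le> ln Pt" using pos by (simp add: ln_mult)
    have "ln ((1 - a) * exp (a - \<alpha>) * P n) \<le> ln (A n)"
      using final pos a by (intro ln_mono) (auto simp: \<alpha>_def)
    then have l2: "ln (1 - a) + (a - \<alpha>) + ln (P n) \<le> ln (A n)" using pos a by (simp add: ln_mult)
    have "a * Z (2 * A 0) St Pt = (a - 1) * \<beta> + ln Pt + (a * a - 1) * ln (2 * A 0)"
      using a pos by (simp add: Z_def \<beta>_def field_simps)
    moreover have "a * Z (A n) (S n) (P n) = (a - 1) * \<alpha> + ln (P n) + (a * a - 1) * ln (A n)"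
      unfolding Z_def \<alpha>_def[symmetric] using a by (simp add: field_simps)
    ultimately have "(a - 1) * \<beta> + ln Pt + (a * a - 1) * ln (2 * A 0)
      \<le> (a - 1) * \<alpha> + ln (P n) + (a * a - 1) * ln (A n)"
      using Z a by (metis mult_le_cancel_left_pos)
    then have "a * \<beta> + ln (cosh y) + a * a * ln (2 * A 0) \<le> a * \<alpha> - a - ln (1 - a) + a * a * ln (A n)"
      using l1 l2 by (simp add: algebra_simps)
    then have "a * lam + a * a * ln (2 * A 0) \<le> a * y - ln (cosh y) - a - ln (1 - a) + a * a * ln (A n)"
      by (simp add: y_def algebra_simps)
    also have "\<dots> \<le> a * (- ln (1 - a)) + a * a * ln (A n)"
      using linear_minus_ln_cosh_le[OF a, of y] by (simp add: algebra_simps)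
    finally have "a * (lam + a * ln (2 * A 0)) \<le> a * (- ln (1 - a) + a * ln (A n))"
      by (simp add: algebra_simps)
    then have "lam + a * ln (2 * A 0) \<le> - ln (1 - a) + a * ln (A n)" using a by simp
    then have "ln (2 * A 0) \<le> ln (A n) + (- ln (1 - a) - lam) / a" using a by (simp add: field_simps)
    then have "exp (ln (2 * A 0)) \<le> exp (ln (A n) + (- ln (1 - a) - lam) / a)" by simp
    then show ?thesis using pos by (simp add: exp_add)
  qed
qed

section \<open>The kernel of the absolute power\<close>

text \<open>For \<open>q = p - 1\<close> and up to the factor p, this is the derivative of the p-th
  power of the absolute value.\<close>

definition signed_powr :: "real \<Rightarrow> real \<Rightarrow> real" where
  "signed_powr q v = sgn v * \<bar>v\<bar> powr q"

lemma signed_powr_eq: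
  assumes "0 < q"
  shows "signed_powr q v = max v 0 powr q - max (- v) 0 powr q"
  using assms by (auto simp: signed_powr_def max_def sgn_if)

lemma continuous_on_signed_powr:
  assumes "0 < q" shows "continuous_on S (signed_powr q)"
proof -
  have "continuous_on S (\<lambda>v. max v 0 powr q - max (- v) 0 powr q)"
    using assms by (intro continuous_on_diff continuous_on_powr' continuous_on_max continuous_intros) auto
  then show ?thesis by (simp add: signed_powr_eq[OF assms])
qed

lemma mono_signed_powr:
  assumes "0 < q" "u \<le> v" shows "signed_powr q u \<le> signed_powr q v"
  unfolding signed_powr_eq[OF assms(1)] using assms
  by (intro diff_mono powr_mono2) auto

lemma signed_powr_scale:
  assumes "0 < c" shows "signed_powr q (c * v) = c powr q * signed_powr q v"
  using assms by (simp add: signed_powr_def sgn_mult abs_mult powr_mult)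

lemma DERIV_abs_powr_nonzero:
  assumes "v \<noteq> 0"
  shows "((\<lambda>v. \<bar>v\<bar> powr q) has_real_derivative q * signed_powr (q - 1) v) (at v)"
proof (cases "v > 0")
  case True
  have "((\<lambda>v. v powr q) has_real_derivative q * v powr (q - 1)) (at v)"
    using True by (auto intro!: derivative_eq_intros)
  moreover have "eventually (\<lambda>v. v powr q = \<bar>v\<bar> powr q) (nhds v)"
    using eventually_nhds_in_open[of "{0<..}" v] True by (auto elim!: eventually_mono)
  ultimately show ?thesis
    using True by (subst (asm) DERIV_cong_ev[OF refl _ refl]) (auto simp: signed_powr_def)
next
  case False
  then have v: "v < 0" using assms by simp
  have "((\<lambda>v. (- v) powr q) has_real_derivative - q * (- v) powr (q - 1)) (at v)"
    using v by (auto intro!: derivative_eq_intros)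
  moreover have "eventually (\<lambda>v. (- v) powr q = \<bar>v\<bar> powr q) (nhds v)"
    using eventually_nhds_in_open[of "{..<0}" v] v by (auto elim!: eventually_mono)
  ultimately show ?thesis
    using v by (subst (asm) DERIV_cong_ev[OF refl _ refl]) (auto simp: signed_powr_def)
qed

lemma DERIV_abs_powr:
  assumes "1 < q"
  shows "((\<lambda>v. \<bar>v\<bar> powr q) has_real_derivative q * signed_powr (q - 1) v) (at v)"
proof (cases "v = 0")
  case False then show ?thesis by (rule DERIV_abs_powr_nonzero)
next
  case True
  have "signed_powr (q - 1) \<midarrow>0\<rightarrow> signed_powr (q - 1) 0"
    using continuous_on_signed_powr[of "q - 1" UNIV] assms
    by (simp add: continuous_on_eq_continuous_at isCont_def)
  then have "signed_powr (q - 1) \<midarrow>0\<rightarrow> 0" by (simp add: signed_powr_def)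
  moreover have eq: "signed_powr (q - 1) h = (\<bar>0 + h\<bar> powr q - \<bar>0\<bar> powr q) / h" for h :: real
    using powr_mult_base[of "\<bar>h\<bar>" "q - 1"] by (cases "h = 0") (auto simp: signed_powr_def sgn_if field_simps split: if_splits)
  ultimately have "(\<lambda>h. (\<bar>0 + h\<bar> powr q - \<bar>0::real\<bar> powr q) / h) \<midarrow>0\<rightarrow> 0"
    unfolding eq[symmetric] by blast
  then show ?thesis using True by (simp add: DERIV_def signed_powr_def)
qed

lemma DERIV_signed_powr_nonzero:
  assumes "v \<noteq> 0"
  shows "(signed_powr q has_real_derivative q * \<bar>v\<bar> powr (q - 1)) (at v)"
proof -
  have "((\<lambda>x. sgn v * \<bar>x\<bar> powr q) has_real_derivative sgn v * (q * signed_powr (q - 1) v)) (at v)"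
    by (intro DERIV_cmult DERIV_abs_powr_nonzero assms)
  moreover have "eventually (\<lambda>x. sgn v * \<bar>x\<bar> powr q = signed_powr q x) (nhds v)"
  proof (cases "v > 0")
    case True
    then show ?thesis using eventually_nhds_in_open[of "{0<..}" v]
      by (auto elim!: eventually_mono simp: signed_powr_def)
  next
    case False
    then show ?thesis using eventually_nhds_in_open[of "{..<0}" v] assms
      by (auto elim!: eventually_mono simp: signed_powr_def)
  qed
  ultimately have "(signed_powr q has_real_derivative sgn v * (q * signed_powr (q - 1) v)) (at v)"
    by (subst (asm) DERIV_cong_ev[OF refl _ refl]) auto
  then show ?thesis using assms by (simp add: signed_powr_def sgn_if split: if_splits)
qed

text \<open>An antiderivative of the absolute power: its symmetric difference quotients are local
  averages of that power.\<close>

lemma DERIV_times_abs_powr: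
  assumes "1 < q"
  shows "((\<lambda>v. v * \<bar>v\<bar> powr q / (q + 1)) has_real_derivative \<bar>v\<bar> powr q) (at v)"
proof -
  have "v * signed_powr (q - 1) v = \<bar>v\<bar> powr q"
    using powr_mult_base[of "\<bar>v\<bar>" "q - 1"] by (auto simp: signed_powr_def sgn_if)
  then have "\<bar>v\<bar> powr q * (q + 1) = 1 * \<bar>v\<bar> powr q + q * signed_powr (q - 1) v * v"
    by (simp add: algebra_simps)
  moreover have "((\<lambda>v. v * \<bar>v\<bar> powr q) has_real_derivative 1 * \<bar>v\<bar> powr q + q * signed_powr (q - 1) v * v) (at v)"
    by (intro DERIV_mult DERIV_ident DERIV_abs_powr assms)
  ultimately have "((\<lambda>v. v * \<bar>v\<bar> powr q) has_real_derivative \<bar>v\<bar> powr q * (q + 1)) (at v)" by simp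
  from DERIV_cdivide[OF this, of "q + 1"] show ?thesis using assms by simp
qed

section \<open>Exponential tail integrals and the sign condition of the kernel\<close>

lemma nonneg_of_nonincreasing_to_0:
  fixes F :: "real \<Rightarrow> real"
  assumes D: "\<And>x. y \<le> x \<Longrightarrow> \<exists>d. (F has_real_derivative d) (at x) \<and> d \<le> 0"
    and lim: "(F \<longlongrightarrow> 0) at_top"
  shows "0 \<le> F y"
proof -
  have "F x \<le> F y" if "y \<le> x" for x
    using that D by (intro DERIV_nonpos_imp_nonincreasing[where f = F]) auto
  then show ?thesis
    by (intro tendsto_upperbound[OF lim]) (auto simp: eventually_at_top_linorder)
qed

text \<open>The tail integral of \<open>signed_powr (p - 1) r * exp (- r)\<close> over \<open>[y, \<infinity>)\<close>.\<close>

definition is_exp_tail :: "real \<Rightarrow> (real \<Rightarrow> real) \<Rightarrow> bool" where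
  "is_exp_tail p J \<longleftrightarrow>
     (\<forall>y. (J has_real_derivative - (signed_powr (p - 1) y * exp (- y))) (at y)) \<and> (J \<longlongrightarrow> 0) at_top"

definition exp_tail :: "real \<Rightarrow> real \<Rightarrow> real" where
  "exp_tail p = (SOME J. is_exp_tail p J)"

lemma exp_tail_exists:
  assumes p: "1 < p" "p \<le> 2"
  shows "\<exists>J. is_exp_tail p J"
proof -
  define k where "k r = signed_powr (p - 1) r * exp (- r)" for r
  have "continuous_on UNIV k"
    unfolding k_def using p by (intro continuous_intros continuous_on_signed_powr) auto
  then have "isCont k x" for x by (simp add: continuous_on_eq_continuous_at)
  then obtain F where F: "\<And>x. (F has_real_derivative k x) (at x)"
    using einterval_antiderivative[of "-\<infinity>" \<infinity> k] by (auto simp: has_real_derivative_iff_has_vector_derivative)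
  have k0: "0 \<le> k x" if "0 \<le> x" for x using that by (simp add: k_def signed_powr_def)
  have k2: "k x \<le> 2 * exp (- x / 2)" if "1 \<le> x" for x
  proof -
    have "x powr (p - 1) \<le> x powr 1" using that p by (intro powr_mono) auto
    also have "\<dots> \<le> 2 * exp (x / 2)" using that exp_ge_add_one_self[of "x / 2"] by (simp del: exp_ge_add_one_self)
    finally have "k x \<le> 2 * exp (x / 2) * exp (- x)"
      using that by (simp add: k_def signed_powr_def)
    also have "\<dots> = 2 * exp (- x / 2)" by (simp add: exp_add[symmetric])
    finally show ?thesis .
  qed
  \<comment> \<open>On the half-line from 1, \<open>F\<close> increases and
    \<open>F x + 4 * exp (- x / 2)\<close> decreases, so \<open>F\<close> has a limit
    \<open>L\<close> at infinity with an explicit error, and \<open>L - F\<close> is the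
    tail.\<close>
  have inc: "F x \<le> F z" if "1 \<le> x" "x \<le> z" for x z
    using that k0 F by (intro DERIV_nonneg_imp_nondecreasing[where f = F]) (auto intro!: exI[of _ "k _"])
  have dec: "F z \<le> F x + 4 * exp (- x / 2)" if "1 \<le> x" "x \<le> z" for x z
  proof -
    have "F z + 4 * exp (- z / 2) \<le> F x + 4 * exp (- x / 2)"
    proof (rule DERIV_nonpos_imp_nonincreasing[OF that(2), where f = "\<lambda>x. F x + 4 * exp (- x / 2)"])
      fix y assume y: "x \<le> y" "y \<le> z"
      have "((\<lambda>x. F x + 4 * exp (- x / 2)) has_real_derivative k y - 2 * exp (- y / 2)) (at y)"
        by (auto intro!: derivative_eq_intros F)
      then show "\<exists>d. ((\<lambda>x. F x + 4 * exp (- x / 2)) has_real_derivative d) (at y) \<and> d \<le> 0"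
        using k2[of y] that y by (intro exI[of _ "k y - 2 * exp (- y / 2)"]) auto
    qed
    then show ?thesis using exp_ge_zero[of "- z / 2"] by linarith
  qed
  define L where "L = Sup (F ` {1..})"
  have bdd: "bdd_above (F ` {1..})" using dec[of 1] by (auto intro!: bdd_aboveI2[of _ _ "F 1 + 4 * exp (- 1 / 2)"])
  have L1: "F x \<le> L" if "1 \<le> x" for x unfolding L_def using that bdd by (intro cSup_upper) auto
  have L2: "L \<le> F x + 4 * exp (- x / 2)" if "1 \<le> x" for x unfolding L_def
  proof (rule cSup_least)
    fix v assume "v \<in> F ` {1..}"
    then obtain z where z: "1 \<le> z" "v = F z" by auto
    show "v \<le> F x + 4 * exp (- x / 2)"
    proof (cases "x \<le> z")
      case True then show ?thesis using dec[of x z] that z by simp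
    next
      case False
      then have "F z \<le> F x" using inc[of z x] z by simp
      then show ?thesis using z by (simp add: add_increasing2)
    qed
  qed auto
  have "((\<lambda>x. L - F x) \<longlongrightarrow> 0) at_top"
  proof (rule tendsto_sandwich)
    show "\<forall>\<^sub>F x in at_top. 0 \<le> L - F x" "\<forall>\<^sub>F x in at_top. L - F x \<le> 4 * exp (- x / 2)"
      using L1 L2 by (auto simp: eventually_at_top_linorder algebra_simps intro!: exI[of _ 1])
    have "filterlim (\<lambda>x::real. (1 / 2) * x) at_top at_top"
      by (rule filterlim_tendsto_pos_mult_at_top[OF tendsto_const _ filterlim_ident]) simp
    then have "filterlim (\<lambda>x::real. - x / 2) at_bot at_top"
      by (simp add: filterlim_uminus_at_bot)
    then have "((\<lambda>x::real. exp (- x / 2)) \<longlongrightarrow> 0) at_top"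
      using exp_at_bot by (rule filterlim_compose[rotated])
    then show "((\<lambda>x::real. 4 * exp (- x / 2)) \<longlongrightarrow> 0) at_top"
      by (rule tendsto_mult_right_zero)
  qed simp
  moreover have "((\<lambda>x. L - F x) has_real_derivative - k y) (at y)" for y
    by (auto intro!: derivative_eq_intros F)
  ultimately show ?thesis unfolding is_exp_tail_def k_def by blast
qed

lemma exp_tail:
  assumes p: "1 < p" "p \<le> 2"
  shows DERIV_exp_tail: "(exp_tail p has_real_derivative - (signed_powr (p - 1) y * exp (- y))) (at y)"
    and exp_tail_tendsto_0: "(exp_tail p \<longlongrightarrow> 0) at_top"
proof -
  have "is_exp_tail p (exp_tail p)"
    unfolding exp_tail_def by (rule someI_ex[OF exp_tail_exists[OF p]])
  then show "(exp_tail p has_real_derivative - (signed_powr (p - 1) y * exp (- y))) (at y)"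
    "(exp_tail p \<longlongrightarrow> 0) at_top" by (auto simp: is_exp_tail_def)
qed

lemma abs_powr_exp_tendsto_0:
  "((\<lambda>y. \<bar>y\<bar> powr q * exp (- y)) \<longlongrightarrow> 0) at_top" for q :: real
proof -
  obtain n :: nat where n: "q \<le> real n" using real_arch_simple by blast
  have lim: "((\<lambda>y::real. y ^ n / exp y) \<longlongrightarrow> 0) at_top" by (rule tendsto_power_div_exp_0)
  show ?thesis
  proof (rule tendsto_sandwich[OF _ _ tendsto_const lim])
    show "\<forall>\<^sub>F y in at_top. 0 \<le> \<bar>y\<bar> powr q * exp (- y)" by simp
    show "\<forall>\<^sub>F y in at_top. \<bar>y\<bar> powr q * exp (- y) \<le> y ^ n / exp y"
    proof (rule eventually_at_top_linorderI[of 1])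
      fix y :: real assume y: "1 \<le> y"
      have "y powr q \<le> y powr n" using y n by (intro powr_mono) auto
      then show "\<bar>y\<bar> powr q * exp (- y) \<le> y ^ n / exp y"
        using y by (simp add: powr_realpow exp_minus field_simps)
    qed
  qed
qed

text \<open>The power \<open>(z\<^sup>2) powr (p / 2)\<close> is concave in \<open>z\<^sup>2\<close>
  and lies below its tangent at 1.\<close>

lemma abs_powr_le_quadratic:
  fixes z :: real
  assumes p: "1 < p" "p \<le> 2"
  shows "\<bar>z\<bar> powr p \<le> 1 + p / 2 * (z\<^sup>2 - 1)"
proof (cases "z = 0")
  case True then show ?thesis using p by simp
next
  case False
  define t where "t = p / 2"
  have t: "0 \<le> t" "t \<le> 1" using p by (auto simp: t_def)
  have "exp ((1 - t) *\<^sub>R 0 + t *\<^sub>R ln (z\<^sup>2)) \<le> (1 - t) * exp 0 + t * exp (ln (z\<^sup>2))"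
    by (rule convex_onD[OF exp_convex]) (use t in auto)
  also have "exp ((1 - t) *\<^sub>R 0 + t *\<^sub>R ln (z\<^sup>2)) = (z\<^sup>2) powr t" using False by (simp add: powr_def)
  also have "(z\<^sup>2) powr t = \<bar>z\<bar> powr p"
  proof -
    have "z\<^sup>2 = \<bar>z\<bar> powr 2" using False by simp
    then show ?thesis by (simp only: powr_powr t_def) simp
  qed
  finally show ?thesis using False by (simp add: t_def algebra_simps)
qed

text \<open>A standard exponential variable minus 1 has mean 0 and variance 1, so by the quadratic
  bound its absolute p-th moment \<open>1 + p * exp_tail p (- 1) / exp 1\<close> is at most 1.
  \<open>F y\<close> is, in closed form, the integral over x > y of the gap in the quadratic bound
  times exp (- x).\<close>

lemma exp_tail_minus_1_nonpos:
  assumes p: "1 < p" "p \<le> 2"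
  shows "exp_tail p (- 1) \<le> 0"
proof -
  define F where "F y = exp (- y) * (1 + p / 2 * (y + 1)\<^sup>2) - (p * exp_tail p y + \<bar>y\<bar> powr p * exp (- y))" for y
  have "0 \<le> F (- 1)"
  proof (rule nonneg_of_nonincreasing_to_0[where F = F])
    fix x :: real
    have "(F has_real_derivative - (exp (- x) * (1 + p / 2 * (x\<^sup>2 - 1))) + \<bar>x\<bar> powr p * exp (- x)) (at x)"
      unfolding F_def
    proof (rule DERIV_cong[OF DERIV_diff[OF _ DERIV_add[OF DERIV_cmult[OF DERIV_exp_tail[OF p]]
          DERIV_mult[OF DERIV_abs_powr[OF p(1)]]]]])
      show "((\<lambda>y. exp (- y) * (1 + p / 2 * (y + 1)\<^sup>2)) has_real_derivative
          exp (- x) * (p * (x + 1) - (1 + p / 2 * (x + 1)\<^sup>2))) (at x)"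
        by (auto intro!: derivative_eq_intros simp: field_simps power2_eq_square)
      show "((\<lambda>y. exp (- y)) has_real_derivative - exp (- x)) (at x)"
        by (auto intro!: derivative_eq_intros)
    qed (simp add: field_simps power2_eq_square)
    moreover have "\<bar>x\<bar> powr p * exp (- x) \<le> (1 + p / 2 * (x\<^sup>2 - 1)) * exp (- x)"
      by (intro mult_right_mono abs_powr_le_quadratic p) simp
    ultimately show "\<exists>d. (F has_real_derivative d) (at x) \<and> d \<le> 0"
      by (intro exI[of _ "- (exp (- x) * (1 + p / 2 * (x\<^sup>2 - 1))) + \<bar>x\<bar> powr p * exp (- x)"])
         (simp add: mult.commute)
  next
    have l: "((\<lambda>y::real. y ^ n / exp y) \<longlongrightarrow> 0) at_top" for n by (rule tendsto_power_div_exp_0)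
    have "((\<lambda>y. (1 + p / 2) * (y ^ 0 / exp y) + p * (y ^ 1 / exp y) + p / 2 * (y ^ 2 / exp y)
        - (p * exp_tail p y + \<bar>y\<bar> powr p * exp (- y)))
      \<longlongrightarrow> (1 + p / 2) * 0 + p * 0 + p / 2 * 0 - (p * 0 + 0)) at_top"
      by (intro tendsto_intros l exp_tail_tendsto_0 p abs_powr_exp_tendsto_0)
    moreover have "(1 + p / 2) * (y ^ 0 / exp y) + p * (y ^ 1 / exp y) + p / 2 * (y ^ 2 / exp y)
        - (p * exp_tail p y + \<bar>y\<bar> powr p * exp (- y)) = F y" for y
      by (simp add: F_def exp_minus field_simps power2_eq_square)
    ultimately show "(F \<longlongrightarrow> 0) at_top" by simp
  qed
  then have "p * exp_tail p (- 1) \<le> 0" by (simp add: F_def)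
  then show ?thesis using p by (simp add: mult_le_0_iff)
qed

text \<open>By parts, the left-hand side is \<open>p - 1\<close> times the integral of
  \<open>\<bar>y + s\<bar> powr (p - 2) * exp (- s)\<close> over s > 0. For positive y this power
  does not increase with s. For negative y the singularity lies in the range of integration; there
  the difference \<open>F\<close> has its minimum at - 1, where
  \<open>exp_tail_minus_1_nonpos\<close> gives the sign.\<close>

lemma exp_tail_le:
  assumes p: "1 < p" "p \<le> 2" and y: "y \<noteq> 0"
  shows "exp y * exp_tail p y - signed_powr (p - 1) y \<le> \<bar>y\<bar> powr (p - 2)"
proof (cases "y > 0")
  case True
  define F where "F y = (\<bar>y\<bar> powr (p - 1) + \<bar>y\<bar> powr (p - 2)) * exp (- y) - exp_tail p y" for y
  have "0 \<le> F y"
  proof (rule nonneg_of_nonincreasing_to_0[where F = F])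
    fix x :: real assume "y \<le> x"
    then have x: "x > 0" using True by simp
    define d where "d = exp (- x) * ((p - 2) * x powr (p - 2) + (p - 2) * x powr (p - 3))"
    have D: "(F has_real_derivative d) (at x)"
      unfolding F_def
    proof (rule DERIV_cong[OF DERIV_diff[OF DERIV_mult[OF DERIV_add[OF
          DERIV_abs_powr_nonzero DERIV_abs_powr_nonzero]] DERIV_exp_tail[OF p]]])
      show "((\<lambda>y. exp (- y)) has_real_derivative - exp (- x)) (at x)"
        by (auto intro!: derivative_eq_intros)
    qed (use x in \<open>simp_all add: d_def signed_powr_def algebra_simps\<close>)
    have "d \<le> 0" unfolding d_def using p
      by (intro mult_nonneg_nonpos add_nonpos_nonpos mult_nonpos_nonneg) auto
    then show "\<exists>d. (F has_real_derivative d) (at x) \<and> d \<le> 0" using D by blast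
  next
    have "((\<lambda>y. \<bar>y\<bar> powr (p - 1) * exp (- y) + \<bar>y\<bar> powr (p - 2) * exp (- y) - exp_tail p y) \<longlongrightarrow> 0 + 0 - 0) at_top"
      by (intro tendsto_intros abs_powr_exp_tendsto_0 exp_tail_tendsto_0 p)
    then show "(F \<longlongrightarrow> 0) at_top" by (simp add: F_def[abs_def] algebra_simps)
  qed
  then have "exp y * exp_tail p y \<le> exp y * ((\<bar>y\<bar> powr (p - 1) + \<bar>y\<bar> powr (p - 2)) * exp (- y))"
    by (simp add: F_def)
  also have "\<dots> = \<bar>y\<bar> powr (p - 1) + \<bar>y\<bar> powr (p - 2)" by (simp add: exp_minus)
  finally show ?thesis using True by (simp add: signed_powr_def)
next
  case False
  then have y: "y < 0" using y by simp
  define F where "F y = (\<bar>y\<bar> powr (p - 2) + signed_powr (p - 1) y) * exp (- y) - exp_tail p y" for y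
  define d where "d x = (2 - p) * exp (- x) * \<bar>x\<bar> powr (p - 3) * (x + 1)" for x
  have D: "(F has_real_derivative d x) (at x)" if "x < 0" for x
  proof -
    have e: "(- x) powr (p - 2) = (- x) powr (p - 3) * (- x)"
      using powr_mult_base[of "\<bar>x\<bar>" "p - 3"] that by (simp add: mult.commute)
    have "(F has_real_derivative ((p - 2) * signed_powr (p - 2 - 1) x + (p - 1) * \<bar>x\<bar> powr (p - 1 - 1)) * exp (- x)
       + - exp (- x) * (\<bar>x\<bar> powr (p - 2) + signed_powr (p - 1) x) - - (signed_powr (p - 1) x * exp (- x))) (at x)"
      unfolding F_def using that
      by (intro DERIV_diff DERIV_mult DERIV_add DERIV_exp_tail[OF p] DERIV_abs_powr_nonzero DERIV_signed_powr_nonzero)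
         (auto intro!: derivative_eq_intros)
    moreover have "((p - 2) * signed_powr (p - 2 - 1) x + (p - 1) * \<bar>x\<bar> powr (p - 1 - 1)) * exp (- x)
       + - exp (- x) * (\<bar>x\<bar> powr (p - 2) + signed_powr (p - 1) x) - - (signed_powr (p - 1) x * exp (- x)) = d x"
      using that by (simp add: d_def signed_powr_def e algebra_simps)
    ultimately show ?thesis by simp
  qed
  have "F (- 1) \<le> F y"
  proof (cases "y \<le> - 1")
    case True
    show ?thesis
    proof (rule DERIV_nonpos_imp_nonincreasing[OF True, where f = F])
      fix x assume x: "y \<le> x" "x \<le> - 1"
      then have "d x \<le> 0" unfolding d_def using p by (intro mult_nonneg_nonpos) auto
      then show "\<exists>d. (F has_real_derivative d) (at x) \<and> d \<le> 0" using D[of x] x by auto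
    qed
  next
    case False
    show ?thesis
    proof (rule DERIV_nonneg_imp_nondecreasing[where f = F])
      show "- 1 \<le> y" using False by simp
      fix x assume x: "- 1 \<le> x" "x \<le> y"
      then have "0 \<le> d x" unfolding d_def using p by (intro mult_nonneg_nonneg) auto
      then show "\<exists>d. (F has_real_derivative d) (at x) \<and> 0 \<le> d" using D[of x] x y by auto
    qed
  qed
  moreover have "0 \<le> F (- 1)" using exp_tail_minus_1_nonpos[OF p] by (simp add: F_def signed_powr_def)
  ultimately have "exp y * exp_tail p y \<le> exp y * ((\<bar>y\<bar> powr (p - 2) + signed_powr (p - 1) y) * exp (- y))"
    by (simp add: F_def)
  also have "\<dots> = \<bar>y\<bar> powr (p - 2) + signed_powr (p - 1) y" by (simp add: exp_minus)
  finally show ?thesis by simp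
qed

text \<open>This is where \<open>2 - p \<le> a\<close> enters: off 0 the derivative is
  \<open>(p - 1) * \<bar>y\<bar> powr (p - 2)\<close> minus \<open>1 - a\<close> times the left-hand
  side of \<open>exp_tail_le\<close>, and 1 - a \<le> p - 1. The monotonicity is the kernel
  condition \<open>(1 - a) * M v \<le> g v\<close> in integrated form, which makes sense across the
  singularity at 0.\<close>

lemma signed_powr_minus_exp_tail_mono:
  assumes p: "1 < p" "p \<le> 2" and a: "2 - p \<le> a" "a < 1" and uv: "u \<le> v"
  shows "signed_powr (p - 1) u - (1 - a) * (exp u * exp_tail p u)
    \<le> signed_powr (p - 1) v - (1 - a) * (exp v * exp_tail p v)"
proof -
  define W where "W y = signed_powr (p - 1) y - (1 - a) * (exp y * exp_tail p y)" for y
  have "continuous_on UNIV (exp_tail p)"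
    using DERIV_exp_tail[OF p] by (meson DERIV_isCont continuous_at_imp_continuous_on)
  then have cont: "continuous_on S W" for S
    unfolding W_def using p
    by (intro continuous_intros continuous_on_signed_powr) (auto intro: continuous_on_subset)
  have D: "\<exists>d. (W has_real_derivative d) (at y) \<and> 0 \<le> d" if "y \<noteq> 0" for y
  proof -
    define r where "r = exp y * exp_tail p y - signed_powr (p - 1) y"
    have "(W has_real_derivative (p - 1) * \<bar>y\<bar> powr (p - 1 - 1)
        - (1 - a) * (exp y * exp_tail p y + - (signed_powr (p - 1) y * exp (- y)) * exp y)) (at y)"
      unfolding W_def
      by (intro DERIV_diff DERIV_cmult DERIV_mult DERIV_exp DERIV_exp_tail[OF p] DERIV_signed_powr_nonzero that)
    then have "(W has_real_derivative (p - 1) * \<bar>y\<bar> powr (p - 2) - (1 - a) * r) (at y)"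
      by (simp add: r_def mult.assoc exp_add[symmetric])
    moreover have "(1 - a) * r \<le> (p - 1) * \<bar>y\<bar> powr (p - 2)"
    proof (cases "r \<le> 0")
      case True
      then have "(1 - a) * r \<le> 0" using a by (intro mult_nonneg_nonpos) auto
      also have "0 \<le> (p - 1) * \<bar>y\<bar> powr (p - 2)" using p by simp
      finally show ?thesis .
    next
      case False
      then show ?thesis using exp_tail_le[OF p that] a p by (intro mult_mono) (auto simp: r_def)
    qed
    ultimately show ?thesis by (intro exI[of _ "(p - 1) * \<bar>y\<bar> powr (p - 2) - (1 - a) * r"]) simp
  qed
  have mono: "W u \<le> W v" if "u \<le> v" "0 \<le> u \<or> v \<le> 0" for u v
    using that by (intro DERIV_nonneg_imp_increasing_open[of u v W] D cont) auto
  have "W u \<le> W v"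
    using mono[of u v] mono[of u 0] mono[of 0 v] uv by linarith
  then show ?thesis by (simp add: W_def)
qed

section \<open>Symmetric difference quotients and the regularised kernel\<close>

definition sym_quot :: "real \<Rightarrow> (real \<Rightarrow> real) \<Rightarrow> real \<Rightarrow> real" where
  "sym_quot \<delta> h v = (h (v + \<delta>) - h (v - \<delta>)) / (2 * \<delta>)"

lemma DERIV_sym_quot:
  assumes "\<And>v. (h has_real_derivative h' v) (at v)"
  shows "(sym_quot \<delta> h has_real_derivative sym_quot \<delta> h' v) (at v)"
proof -
  have "((\<lambda>v. h (v + \<delta>)) has_real_derivative h' (v + \<delta>)) (at v)"
    "((\<lambda>v. h (v - \<delta>)) has_real_derivative h' (v - \<delta>)) (at v)"
    using DERIV_shift[of h "h' (v + \<delta>)" v \<delta>] DERIV_shift[of h "h' (v - \<delta>)" v "- \<delta>"] assms by auto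
  from DERIV_cdivide[OF DERIV_diff[OF this], of "2 * \<delta>"]
  show ?thesis by (simp add: sym_quot_def[abs_def])
qed

lemma sym_quot_tendsto:
  assumes "(h has_real_derivative d) (at v)"
  shows "((\<lambda>\<delta>. sym_quot \<delta> h v) \<longlongrightarrow> d) (at_right 0)"
proof -
  have 1: "((\<lambda>\<delta>. (h (v + \<delta>) - h v) / \<delta>) \<longlongrightarrow> d) (at 0)" using assms by (simp add: DERIV_def)
  have "filterlim uminus (at (- 0)) (at (0::real))"
    by (simp only: filterlim_def filtermap_at_minus order_refl)
  from filterlim_compose[OF _ this, of "\<lambda>\<delta>. (h (v + \<delta>) - h v) / \<delta>" "nhds d"] 1
  have 2: "((\<lambda>\<delta>. (h (v - \<delta>) - h v) / (- \<delta>)) \<longlongrightarrow> d) (at 0)" by simp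
  have "((\<lambda>\<delta>. ((h (v + \<delta>) - h v) / \<delta> + (h (v - \<delta>) - h v) / (- \<delta>)) / 2) \<longlongrightarrow> (d + d) / 2) (at 0)"
    by (intro tendsto_intros 1 2) simp
  moreover have "((h (v + \<delta>) - h v) / \<delta> + (h (v - \<delta>) - h v) / (- \<delta>)) / 2 = sym_quot \<delta> h v" for \<delta>
    by (cases "\<delta> = 0") (auto simp: sym_quot_def field_simps)
  ultimately show ?thesis by (auto intro: tendsto_within_subset[of _ _ _ UNIV])
qed

text \<open>The value of \<open>\<integral>\<^sub>0\<^sup>1 \<bar>- ln u - 1\<bar> powr p du\<close>.\<close>

definition log_osc :: "real \<Rightarrow> real" where
  "log_osc p = 1 + p * exp_tail p (- 1) / exp 1"

text \<open>The kernel of \<open>\<bar>v\<bar> powr p\<close> is not twice differentiable at \<open>0\<close>; symmetric difference quotients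
  regularise it, and they preserve the defining differential relations because these are
  translation invariant.\<close>

lemma bellman_kernel_exists:
  assumes p: "1 < p" "p \<le> 2" and a: "0 < a" "2 - p \<le> a" "a < 1"
    and B: "0 < B" "B powr p < a powr p * log_osc p"
  obtains f f1 g M \<delta> where "0 < \<delta>" "bellman_kernel a f f1 g M"
    "\<And>v. 0 \<le> f v" "\<And>v. f v \<le> (\<bar>v\<bar> + \<delta>) powr p" "\<And>u v. f u + f1 u * (v - u) \<le> f v"
    "(B + 2 * \<delta>) powr p < f (- a) + a * f1 (- a) + a\<^sup>2 * M (- a)"
proof -
  \<comment> \<open>After substitution, \<open>m w\<close> is the integral of
    \<open>F1 (w + a * s) * exp (- s)\<close> over s > 0: the kernel integral one derivative lower,
    whose symmetric quotient becomes \<open>M\<close>.\<close>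
  define m where "m w = p * a powr (p - 1) * (exp (w / a) * exp_tail p (w / a))" for w
  define \<Phi> :: "real \<Rightarrow> real" where "\<Phi> v = v * \<bar>v\<bar> powr p / (p + 1)" for v
  define F :: "real \<Rightarrow> real" where "F v = \<bar>v\<bar> powr p" for v
  define F1 where "F1 v = p * signed_powr (p - 1) v" for v
  have d\<Phi>: "(\<Phi> has_real_derivative F v) (at v)" for v
    unfolding \<Phi>_def F_def by (rule DERIV_times_abs_powr[OF p(1)])
  have dF: "(F has_real_derivative F1 v) (at v)" for v
    unfolding F_def F1_def by (rule DERIV_abs_powr[OF p(1)])
  have sc: "a powr (p - 1) * signed_powr (p - 1) (w / a) = signed_powr (p - 1) w" for w
    using signed_powr_scale[of a "p - 1" "w / a"] a by simp
  have dm: "(m has_real_derivative (m w - F1 w) / a) (at w)" for w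
  proof -
    have e: "((\<lambda>w. exp (w / a)) has_real_derivative exp (w / a) / a) (at w)"
      using a by (auto intro!: derivative_eq_intros)
    have t: "((\<lambda>w. exp_tail p (w / a)) has_real_derivative - (signed_powr (p - 1) (w / a) * exp (- (w / a))) * (1 / a)) (at w)"
      by (rule DERIV_chain2[OF DERIV_exp_tail[OF p]]) (use a in \<open>auto intro!: derivative_eq_intros\<close>)
    have "(m has_real_derivative p * a powr (p - 1) * (exp (w / a) / a * exp_tail p (w / a)
       + - (signed_powr (p - 1) (w / a) * exp (- (w / a))) * (1 / a) * exp (w / a))) (at w)"
      unfolding m_def by (intro DERIV_cmult DERIV_mult e t)
    also have "p * a powr (p - 1) * (exp (w / a) / a * exp_tail p (w / a)
       + - (signed_powr (p - 1) (w / a) * exp (- (w / a))) * (1 / a) * exp (w / a))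
      = (m w - p * (a powr (p - 1) * signed_powr (p - 1) (w / a))) / a"
      by (simp add: m_def exp_minus diff_divide_distrib algebra_simps)
    finally show ?thesis by (simp add: sc F1_def)
  qed
  have W: "F1 u - (1 - a) * m u \<le> F1 v - (1 - a) * m v" if "u \<le> v" for u v
  proof -
    have eq: "F1 u - (1 - a) * m u = p * a powr (p - 1) * (signed_powr (p - 1) (u / a)
        - (1 - a) * (exp (u / a) * exp_tail p (u / a)))" for u
      unfolding F1_def m_def sc[of u, symmetric] by (simp add: algebra_simps)
    have "u / a \<le> v / a" using that a by (simp add: divide_right_mono)
    from signed_powr_minus_exp_tail_mono[OF p a(2,3) this]
    show ?thesis unfolding eq using p by (intro mult_left_mono) auto
  qed
  have ker: "bellman_kernel a (sym_quot \<delta> \<Phi>) (sym_quot \<delta> F) (sym_quot \<delta> F1) (sym_quot \<delta> m)" if "0 < \<delta>" for \<delta>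
    unfolding bellman_kernel_def
  proof (intro allI conjI)
    fix v
    show "(sym_quot \<delta> \<Phi> has_real_derivative sym_quot \<delta> F v) (at v)" by (rule DERIV_sym_quot[OF d\<Phi>])
    show "(sym_quot \<delta> F has_real_derivative sym_quot \<delta> F1 v) (at v)" by (rule DERIV_sym_quot[OF dF])
    have "sym_quot \<delta> (\<lambda>w. (m w - F1 w) / a) v = (sym_quot \<delta> m v - sym_quot \<delta> F1 v) / a"
      using a that by (simp add: sym_quot_def field_simps)
    then show "(sym_quot \<delta> m has_real_derivative (sym_quot \<delta> m v - sym_quot \<delta> F1 v) / a) (at v)"
      using DERIV_sym_quot[OF dm, of \<delta> v] by simp
    have "(1 - a) * (m (v + \<delta>) - m (v - \<delta>)) \<le> F1 (v + \<delta>) - F1 (v - \<delta>)"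
      using W[of "v - \<delta>" "v + \<delta>"] that by (simp add: algebra_simps)
    then have "(1 - a) * (m (v + \<delta>) - m (v - \<delta>)) / (2 * \<delta>) \<le> (F1 (v + \<delta>) - F1 (v - \<delta>)) / (2 * \<delta>)"
      using that by (intro divide_right_mono) auto
    then show "(1 - a) * sym_quot \<delta> m v \<le> sym_quot \<delta> F1 v" by (simp add: sym_quot_def)
  qed
  have bounds: "0 \<le> sym_quot \<delta> \<Phi> v \<and> sym_quot \<delta> \<Phi> v \<le> (\<bar>v\<bar> + \<delta>) powr p" if \<delta>: "0 < \<delta>" for \<delta> v
  proof -
    obtain z where z: "v - \<delta> < z" "z < v + \<delta>" "\<Phi> (v + \<delta>) - \<Phi> (v - \<delta>) = (v + \<delta> - (v - \<delta>)) * F z"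
      using MVT2[of "v - \<delta>" "v + \<delta>" \<Phi> F] d\<Phi> \<delta> by auto
    have "sym_quot \<delta> \<Phi> v = F z" using z(3) \<delta> by (simp add: sym_quot_def)
    moreover have "F z \<le> (\<bar>v\<bar> + \<delta>) powr p" unfolding F_def
      using z p by (intro powr_mono2) auto
    ultimately show ?thesis by (simp add: F_def)
  qed
  have tangent: "sym_quot \<delta> \<Phi> u + sym_quot \<delta> F u * (v - u) \<le> sym_quot \<delta> \<Phi> v" if \<delta>: "0 < \<delta>" for \<delta> u v
  proof -
    have "0 \<le> sym_quot \<delta> F1 x" for x
      using mono_signed_powr[of "p - 1" "x - \<delta>" "x + \<delta>"] p \<delta> by (simp add: sym_quot_def F1_def)
    then have "convex_on UNIV (sym_quot \<delta> \<Phi>)"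
      using DERIV_sym_quot[OF d\<Phi>] DERIV_sym_quot[OF dF]
      by (intro f''_ge0_imp_convex[of UNIV _ "sym_quot \<delta> F" "sym_quot \<delta> F1"]) auto
    from convex_on_imp_above_tangent[OF this, of u v "sym_quot \<delta> F u", simplified] DERIV_sym_quot[OF d\<Phi>, of \<delta> u]
    show ?thesis by (simp add: algebra_simps)
  qed
  \<comment> \<open>The symmetric quotient of \<Psi> at \<open>- a\<close> is the quantity to be
    bounded below. For \<delta> tending to 0 it tends to the derivative, which is
    \<open>a powr p * log_osc p\<close>, so the strict hypothesis on \<open>B\<close> leaves room
    for some positive \<delta>.\<close>
  define \<Psi> where "\<Psi> v = \<Phi> v + a * F v + a\<^sup>2 * m v" for v
  have \<Psi>: "sym_quot \<delta> \<Psi> v = sym_quot \<delta> \<Phi> v + a * sym_quot \<delta> F v + a\<^sup>2 * sym_quot \<delta> m v" for \<delta> v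
    by (simp add: sym_quot_def \<Psi>_def diff_divide_distrib add_divide_distrib algebra_simps)
  have "(\<Psi> has_real_derivative F (- a) + a * F1 (- a) + a\<^sup>2 * ((m (- a) - F1 (- a)) / a)) (at (- a))"
    unfolding \<Psi>_def by (intro DERIV_add DERIV_cmult d\<Phi> dF dm)
  also have "F (- a) + a * F1 (- a) + a\<^sup>2 * ((m (- a) - F1 (- a)) / a) = F (- a) + a * m (- a)"
    using a by (simp add: field_simps power2_eq_square)
  also have "\<dots> = a powr p * log_osc p"
    using a powr_mult_base[of a "p - 1"]
    by (simp add: F_def m_def log_osc_def exp_minus field_simps)
  finally have l1: "((\<lambda>\<delta>. sym_quot \<delta> \<Psi> (- a)) \<longlongrightarrow> a powr p * log_osc p) (at_right 0)"
    by (rule sym_quot_tendsto)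
  have "((\<lambda>\<delta>. (B + 2 * \<delta>) powr p) \<longlongrightarrow> (B + 2 * 0) powr p) (at_right 0)"
    using B by (intro tendsto_intros) auto
  then have l2: "((\<lambda>\<delta>. (B + 2 * \<delta>) powr p) \<longlongrightarrow> B powr p) (at_right 0)" by simp
  obtain c where c: "B powr p < c" "c < a powr p * log_osc p" using dense[OF B(2)] by blast
  have "\<forall>\<^sub>F \<delta> in at_right 0. (B + 2 * \<delta>) powr p < sym_quot \<delta> \<Psi> (- a)"
    using order_tendstoD(2)[OF l2 c(1)] order_tendstoD(1)[OF l1 c(2)] by eventually_elim simp
  moreover have "\<forall>\<^sub>F \<delta> in at_right (0::real). 0 < \<delta>" by (simp add: eventually_at_right_less)
  ultimately have "\<forall>\<^sub>F \<delta> in at_right 0. 0 < \<delta> \<and> (B + 2 * \<delta>) powr p < sym_quot \<delta> \<Psi> (- a)"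
    by eventually_elim simp
  then obtain \<delta> where \<delta>: "0 < \<delta>" "(B + 2 * \<delta>) powr p < sym_quot \<delta> \<Psi> (- a)"
    using eventually_happens'[OF trivial_limit_at_right_real] by blast
  show ?thesis
    by (rule that[OF \<delta>(1) ker[OF \<delta>(1)]])
       (use bounds[OF \<delta>(1)] tangent[OF \<delta>(1)] \<delta>(2) in \<open>auto simp: \<Psi>\<close>)
qed

section \<open>Rising sun sets\<close>

lemma component_of_open_real:
  fixes W :: "real set"
  assumes W: "open W" "W \<subseteq> {c<..<d}" and C: "C \<in> components W"
  obtains u v where "C = {u<..<v}" "u < v" "c \<le> u" "v \<le> d" "u \<notin> W" "v \<notin> W"
proof -
  have CW: "C \<subseteq> W" "C \<noteq> {}" "open C"
    using C W in_components_subset in_components_nonempty open_components by blast+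
  have iv: "is_interval C" using in_components_connected[OF C] by (simp add: is_interval_connected_1)
  have bdd: "bdd_below C" "bdd_above C" using CW W by (auto intro!: bdd_belowI[of _ c] bdd_aboveI[of _ d] dest!: subsetD)
  define u where "u = Inf C"
  define v where "v = Sup C"
  have eq: "C = {u<..<v}"
  proof (intro equalityI subsetI)
    fix x assume x: "x \<in> C"
    then obtain e where e: "e > 0" "ball x e \<subseteq> C" using CW(3) open_contains_ball by blast
    have "x - e / 2 \<in> C" "x + e / 2 \<in> C" using e by (auto intro!: subsetD[OF e(2)] simp: dist_real_def)
    then have "u \<le> x - e / 2" "x + e / 2 \<le> v" unfolding u_def v_def by (auto intro: cInf_lower cSup_upper bdd)
    then show "x \<in> {u<..<v}" using e(1) by auto
  next
    fix x assume x: "x \<in> {u<..<v}"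
    then obtain y z where "y \<in> C" "y < x" "z \<in> C" "x < z"
      unfolding u_def v_def using cInf_less_iff[OF CW(2) bdd(1)] less_cSup_iff[OF CW(2) bdd(2)] by auto
    then show "x \<in> C" using iv unfolding is_interval_1 by (meson less_imp_le)
  qed
  have uv: "u < v" using CW(2) eq by auto
  have sub: "{u<..<v} \<subseteq> W" using CW eq by simp
  have "u \<notin> W"
  proof
    assume "u \<in> W"
    then have "{u..<v} \<subseteq> W" using sub by (force simp: less_le)
    moreover have "C \<inter> {u..<v} = C" using eq by auto
    then have "C \<inter> {u..<v} \<noteq> {}" using CW(2) by simp
    ultimately have "{u..<v} \<subseteq> C" by (intro components_maximal[OF C]) auto
    then show False using uv eq by auto
  qed
  moreover have "v \<notin> W"
  proof
    assume "v \<in> W"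
    then have "{u<..v} \<subseteq> W" using sub by (force simp: less_le)
    moreover have "C \<inter> {u<..v} = C" using eq by auto
    then have "C \<inter> {u<..v} \<noteq> {}" using CW(2) by simp
    ultimately have "{u<..v} \<subseteq> C" by (intro components_maximal[OF C]) auto
    then show False using uv eq by auto
  qed
  moreover have "c \<le> u" unfolding u_def using CW W by (intro cInf_greatest) (auto dest!: subsetD)
  moreover have "v \<le> d" unfolding v_def using CW W by (intro cSup_least) (auto dest!: subsetD)
  ultimately show ?thesis using that eq uv by blast
qed

lemma set_integral_open_nonpos:
  fixes g :: "real \<Rightarrow> real"
  assumes W: "open W" and g: "set_integrable lebesgue W g"
    and comp: "\<And>C. C \<in> components W \<Longrightarrow> (LINT t:C|lebesgue. g t) \<le> 0"
  shows "(LINT t:W|lebesgue. g t) \<le> 0"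
proof -
  have op: "open C" if "C \<in> components W" for C using open_components[OF W that] .
  have cnt: "countable (components W)"
    by (rule countable_disjoint_open_subsets) (use op pairwise_disjoint_components[of W] in \<open>auto simp: disjnt_def[abs_def]\<close>)
  \<comment> \<open>Padding with empty sets covers the case of finitely many components, and
    restricting the index to the range of \<open>to_nat_on\<close> prevents repetitions.\<close>
  define A where "A n = (if n \<in> to_nat_on (components W) ` components W then from_nat_into (components W) n else {})" for n
  have A: "A n = {} \<or> A n \<in> components W" for n
    using cnt by (auto simp: A_def)
  have W_eq: "(\<Union>n. A n) = W"
  proof
    show "(\<Union>n. A n) \<subseteq> W" using A in_components_subset by blast
    show "W \<subseteq> (\<Union>n. A n)"
    proof
      fix x assume "x \<in> W"
      then obtain C where C: "C \<in> components W" "x \<in> C" using Union_components[of W] by blast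
      then have "A (to_nat_on (components W) C) = C" using cnt by (auto simp: A_def)
      then show "x \<in> (\<Union>n. A n)" using C by blast
    qed
  qed
  have disj: "disjoint_family A"
    unfolding disjoint_family_on_def
  proof (intro ballI impI)
    fix m n :: nat assume "m \<noteq> n"
    show "A m \<inter> A n = {}"
    proof (rule ccontr)
      assume ne: "A m \<inter> A n \<noteq> {}"
      then have m: "m \<in> to_nat_on (components W) ` components W" and n: "n \<in> to_nat_on (components W) ` components W"
        and "A m \<in> components W" "A n \<in> components W" using A[of m] A[of n] by (auto simp: A_def split: if_splits)
      then have "A m = A n" using ne components_eq by blast
      moreover have "to_nat_on (components W) (A m) = m" "to_nat_on (components W) (A n) = n"
        using m n cnt by (auto simp: A_def)
      ultimately show False using \<open>m \<noteq> n\<close> by simp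
    qed
  qed
  have opA: "open (A n)" for n using A[of n] op by auto
  have meas: "A n \<in> sets lebesgue" for n using opA[of n] by simp
  have gA: "set_integrable lebesgue (A n) g" for n
    by (rule set_integrable_subset[OF g meas]) (use W_eq in auto)
  have neg: "(LINT t:A n|lebesgue. g t) \<le> 0" for n
    using A[of n] comp by (auto simp: set_lebesgue_integral_def)
  define T where "T n = (\<Union>i<n. A i)" for n
  have "(LINT t:T n|lebesgue. g t) = (\<Sum>i<n. LINT t:A i|lebesgue. g t)" for n
    unfolding T_def by (rule set_integral_finite_Union) (use disj gA meas in \<open>auto simp: disjoint_family_on_def\<close>)
  then have Tneg: "(LINT t:T n|lebesgue. g t) \<le> 0" for n using neg by (simp add: sum_nonpos)
  have UT: "(\<Union>n. T n) = W" unfolding T_def W_eq[symmetric] by auto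
  have "(\<lambda>n. LINT t:T n|lebesgue. g t) \<longlonglongrightarrow> (LINT t:(\<Union>n. T n)|lebesgue. g t)"
  proof (rule set_integral_cont_up)
    show "T n \<in> sets lebesgue" for n unfolding T_def using meas by auto
    show "incseq T" unfolding T_def by (intro monoI UN_mono) auto
    show "set_integrable lebesgue (\<Union>n. T n) g" using g UT by simp
  qed
  then show ?thesis unfolding UT by (rule LIMSEQ_le_const2) (use Tneg in auto)
qed

text \<open>Open sets are treated component by component; the bounded support keeps the components
  bounded. The set where h is positive is, up to a null set, a decreasing intersection of open sets,
  so the integral of h over it is nonpositive, which makes this set null.\<close>

lemma AE_nonpos_if_interval_integrals_nonpos:
  fixes h :: "real \<Rightarrow> real"
  assumes h: "integrable lebesgue h"
    and le: "\<And>x y. x < y \<Longrightarrow> (LINT t:{x<..<y}|lebesgue. h t) \<le> 0"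
    and supp: "\<And>t. t \<notin> {c<..<d} \<Longrightarrow> h t = 0"
  shows "AE t in lebesgue. h t \<le> 0"
proof -
  have hS: "set_integrable lebesgue S h" if "S \<in> sets lebesgue" for S
    using integrable_mult_indicator[OF that h] by (simp add: set_integrable_def)
  have cut: "(LINT t:S|lebesgue. h t) = (LINT t:S \<inter> {c<..<d}|lebesgue. h t)" for S
    unfolding set_lebesgue_integral_def
    by (rule Bochner_Integration.integral_cong) (use supp in \<open>auto split: split_indicator\<close>)
  have op: "(LINT t:W|lebesgue. h t) \<le> 0" if "open W" for W
    unfolding cut[of W]
  proof (rule set_integral_open_nonpos)
    show "open (W \<inter> {c<..<d})" using that by auto
    then show "set_integrable lebesgue (W \<inter> {c<..<d}) h" by (intro hS) auto
    fix C assume "C \<in> components (W \<inter> {c<..<d})"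
    then obtain u v where "C = {u<..<v}" "u < v"
      by (rule component_of_open_real[OF \<open>open (W \<inter> {c<..<d})\<close> Int_lower2])
    then show "(LINT t:C|lebesgue. h t) \<le> 0" using le by simp
  qed
  define S where "S = {t. 0 < h t}"
  have hm: "h \<in> borel_measurable lebesgue" using h by (rule borel_measurable_integrable)
  have Sm: "S \<in> sets lebesgue"
    using measurable_sets[OF hm, of "{0<..}"] by (simp add: S_def vimage_def)
  obtain D T where DT: "gdelta D" "T \<in> null_sets lebesgue" "S \<union> T = D" "disjnt S T"
    using lebesgue_set_almost_gdelta[OF Sm] by blast
  from DT(1) obtain F :: "nat \<Rightarrow> real set" where F: "\<And>n. open (F n)" "D = (\<Inter>n. F n)"
    by (auto elim!: gdelta.cases)
  define V where "V n = (\<Inter>k\<le>n. F k)" for n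
  have V: "open (V n)" for n unfolding V_def using F by (intro open_INT) auto
  have VD: "(\<Inter>n. V n) = D" unfolding V_def F(2) by auto
  have "(\<lambda>n. LINT t:V n|lebesgue. h t) \<longlonglongrightarrow> (LINT t:(\<Inter>n. V n)|lebesgue. h t)"
  proof (rule set_integral_cont_down)
    show "V n \<in> sets lebesgue" for n using V[of n] by simp
    show "decseq V" unfolding V_def by (rule decseq_SucI) auto
    show "set_integrable lebesgue (V 0) h" using V[of 0] by (intro hS) simp
  qed
  then have "(LINT t:D|lebesgue. h t) \<le> 0" unfolding VD by (rule LIMSEQ_le_const2) (use op V in auto)
  moreover have "(LINT t:D|lebesgue. h t) = (LINT t:S|lebesgue. h t)"
    unfolding set_lebesgue_integral_def
  proof (rule integral_cong_AE)
    show "(\<lambda>t. indicator D t *\<^sub>R h t) \<in> borel_measurable lebesgue" "(\<lambda>t. indicator S t *\<^sub>R h t) \<in> borel_measurable lebesgue"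
      using hm Sm DT(2,3) by (auto intro!: borel_measurable_scaleR borel_measurable_indicator)
    show "AE t in lebesgue. indicator D t *\<^sub>R h t = indicator S t *\<^sub>R h t"
      using AE_not_in[OF DT(2)] by eventually_elim (use DT(3) in \<open>auto split: split_indicator\<close>)
  qed
  ultimately have "(LINT t|lebesgue. indicator S t *\<^sub>R h t) \<le> 0" by (simp add: set_lebesgue_integral_def)
  moreover have nn: "0 \<le> indicator S t *\<^sub>R h t" for t by (auto simp: S_def split: split_indicator)
  ultimately have "(LINT t|lebesgue. indicator S t *\<^sub>R h t) = 0"
    by (simp add: antisym integral_nonneg_AE)
  moreover have "integrable lebesgue (\<lambda>t. indicator S t *\<^sub>R h t)" using hS[OF Sm] by (simp add: set_integrable_def)
  ultimately have "AE t in lebesgue. indicator S t *\<^sub>R h t = 0"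
    using integral_nonneg_eq_0_iff_AE[of lebesgue "\<lambda>t. indicator S t *\<^sub>R h t"] nn by auto
  then show ?thesis by eventually_elim (auto simp: S_def split: split_indicator_asm)
qed

section \<open>Functions of bounded oscillation on one interval, and their shadow sets\<close>

locale osc_bounded =
  fixes p B c d :: real and \<phi> :: "real \<Rightarrow> real"
  assumes cd: "c < d"
    and integrable: "set_integrable lebesgue {c<..<d} \<phi>"
    and integrable_powr: "\<And>\<kappa>. set_integrable lebesgue {c<..<d} (\<lambda>t. \<bar>\<phi> t - \<kappa>\<bar> powr p)"
    and osc: "\<And>u v. c \<le> u \<Longrightarrow> u < v \<Longrightarrow> v \<le> d \<Longrightarrow>
      (LINT t:{u<..<v}|lebesgue. \<bar>\<phi> t - (LINT t:{u<..<v}|lebesgue. \<phi> t) / (v - u)\<bar> powr p)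
        \<le> B powr p * (v - u)"
begin

definition mean :: real where "mean = (LINT t:{c<..<d}|lebesgue. \<phi> t) / (d - c)"

definition prim :: "real \<Rightarrow> real \<Rightarrow> real" where
  "prim \<alpha> x = integral {c..x} \<phi> - \<alpha> * (x - c)"

lemma set_integrable_sub:
  "S \<in> sets lebesgue \<Longrightarrow> S \<subseteq> {c<..<d} \<Longrightarrow> set_integrable lebesgue S \<phi>"
  "S \<in> sets lebesgue \<Longrightarrow> S \<subseteq> {c<..<d} \<Longrightarrow> set_integrable lebesgue S (\<lambda>t. \<bar>\<phi> t - \<kappa>\<bar> powr p)"
  using set_integrable_subset[OF integrable] set_integrable_subset[OF integrable_powr] by auto

lemma set_integrable_const:
  assumes "S \<in> sets lebesgue" "S \<subseteq> {c<..<d}"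
  shows "set_integrable lebesgue S (\<lambda>t. k :: real)"
    and "(LINT t:S|lebesgue. k) = k * measure lebesgue S"
proof -
  have "emeasure lebesgue S \<le> emeasure lebesgue {c<..<d}" using assms by (intro emeasure_mono) auto
  also have "\<dots> < \<infinity>" using cd by simp
  finally have fin: "emeasure lebesgue S < \<infinity>" .
  then show "set_integrable lebesgue S (\<lambda>t. k)" using assms by (simp add: set_integrable_def)
  show "(LINT t:S|lebesgue. k) = k * measure lebesgue S"
    using fin assms by (simp add: set_lebesgue_integral_def mult.commute)
qed

lemma integrable_closed: "\<phi> integrable_on {c..d}"
  using set_lebesgue_integral_eq_integral(1)[OF integrable] by (simp add: integrable_on_open_interval_real)

lemma prim_c: "prim \<alpha> c = 0" by (simp add: prim_def)

lemma continuous_prim: "continuous_on {c..d} (prim \<alpha>)"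
  unfolding prim_def by (intro continuous_intros indefinite_integral_continuous_1 integrable_closed)

lemma integral_interval:
  assumes "c \<le> u" "u \<le> v" "v \<le> d"
  shows "(LINT t:{u<..<v}|lebesgue. \<phi> t - \<alpha>) = prim \<alpha> v - prim \<alpha> u"
proof -
  have sub: "{u<..<v} \<subseteq> {c<..<d}" using assms by auto
  have "(LINT t:{u<..<v}|lebesgue. \<phi> t) = integral {u..v} \<phi>"
    using set_lebesgue_integral_eq_integral(2)[OF set_integrable_sub(1)[OF _ sub]]
    by (simp add: integral_open_interval_real)
  also have "\<dots> = integral {c..v} \<phi> - integral {c..u} \<phi>"
    using Henstock_Kurzweil_Integration.integral_combine[of c u v \<phi>] integrable_subinterval_real[OF integrable_closed, of c v] assms by auto
  finally show ?thesis
    using set_integral_diff(2)[OF set_integrable_sub(1)[OF _ sub] set_integrable_const(1)[OF _ sub, of \<alpha>]]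
      set_integrable_const(2)[OF _ sub, of \<alpha>] assms
    by (simp add: prim_def algebra_simps)
qed

lemma prim_d: "prim \<alpha> d = (mean - \<alpha>) * (d - c)"
proof -
  have "integral {c..d} \<phi> = (LINT t:{c<..<d}|lebesgue. \<phi> t)"
    using set_lebesgue_integral_eq_integral(2)[OF integrable] by (simp add: integral_open_interval_real)
  then show ?thesis using cd by (simp add: prim_def mean_def field_simps)
qed

text \<open>The shadow set of the rising sun lemma; the second alternative, comparison with the value \<open>0\<close>
  at the left end point, makes the average of \<open>\<phi>\<close> over the component starting at \<open>c\<close>
  equal to \<open>\<alpha>\<close> as well.\<close>

definition shadow :: "real \<Rightarrow> real set" where
  "shadow \<alpha> = {x \<in> {c<..<d}. \<exists>y\<in>{x<..d}. min (prim \<alpha> x) 0 < prim \<alpha> y}"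

lemma shadow_subset: "shadow \<alpha> \<subseteq> {c<..<d}" by (auto simp: shadow_def)

lemma end_points_notin_shadow: "c \<notin> shadow \<alpha>" "d \<notin> shadow \<alpha>" by (auto simp: shadow_def)

text \<open>Lowering the level from \<beta> to \<alpha> raises the increment of \<open>prim\<close>
  from x to y by \<open>(\<beta> - \<alpha>) * (y - x)\<close>, so a witness y for \<beta> is also
  one for \<alpha>; the same holds for increments from c.\<close>

lemma shadow_antimono:
  assumes "\<alpha> \<le> \<beta>" shows "shadow \<beta> \<subseteq> shadow \<alpha>"
proof
  fix x assume "x \<in> shadow \<beta>"
  then obtain y where x: "c < x" "x < d" and y: "x < y" "y \<le> d" "min (prim \<beta> x) 0 < prim \<beta> y"
    by (auto simp: shadow_def)
  have "\<alpha> * (y - c) \<le> \<beta> * (y - c)" "\<alpha> * (y - x) \<le> \<beta> * (y - x)"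
    using assms x y by (auto intro!: mult_right_mono)
  then have "min (prim \<alpha> x) 0 < prim \<alpha> y"
    using y(3) by (auto simp: prim_def min_less_iff_disj algebra_simps)
  then show "x \<in> shadow \<alpha>" using x y by (auto simp: shadow_def)
qed

lemma open_shadow: "open (shadow \<alpha>)"
proof -
  have cont: "continuous_on {c<..<d} (\<lambda>x. min (prim \<alpha> x) 0)"
    by (intro continuous_intros continuous_on_subset[OF continuous_prim]) auto
  have "shadow \<alpha> = (\<Union>y\<in>{..d}. {c<..<y} \<inter> ({c<..<d} \<inter> (\<lambda>x. min (prim \<alpha> x) 0) -` {..<prim \<alpha> y}))"
    by (auto simp: shadow_def)
  moreover have "open ({c<..<d} \<inter> (\<lambda>x. min (prim \<alpha> x) 0) -` {..<prim \<alpha> y})" for y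
    using continuous_on_open_vimage[of "{c<..<d}" "\<lambda>x. min (prim \<alpha> x) 0"] cont
    by (simp add: Int_commute)
  then have "open ({c<..<y} \<inter> ({c<..<d} \<inter> (\<lambda>x. min (prim \<alpha> x) 0) -` {..<prim \<alpha> y}))" for y
    by (rule open_Int[OF open_greaterThanLessThan])
  ultimately show ?thesis by (metis (no_types, lifting) open_UN)
qed

lemma shadow_sets: "shadow \<alpha> \<in> sets lebesgue" using open_shadow by simp

lemma prim_le_after:
  assumes "v \<notin> shadow \<alpha>" "c < v" "v < y" "y \<le> d"
  shows "prim \<alpha> y \<le> prim \<alpha> v" "prim \<alpha> y \<le> 0"
  using assms by (auto simp: shadow_def not_less min_le_iff_disj)

context
  fixes \<alpha> assumes \<alpha>: "mean \<le> \<alpha>"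
begin

lemma prim_d_nonpos: "prim \<alpha> d \<le> 0"
  unfolding prim_d using \<alpha> cd by (simp add: mult_nonpos_nonneg)

text \<open>To the right of an interior point off the shadow all values of \<open>prim\<close> are
  nonpositive, and continuity gives the value at the point. At d the sign comes from
  \<open>mean \<le> \<alpha>\<close>.\<close>

lemma prim_nonpos:
  assumes v: "c \<le> v" "v \<le> d" "v \<notin> shadow \<alpha>"
  shows "prim \<alpha> v \<le> 0"
proof (cases "v = c \<or> v = d")
  case True then show ?thesis using prim_c prim_d_nonpos by auto
next
  case False
  then have v': "c < v" "v < d" using v by auto
  have "(prim \<alpha> \<longlongrightarrow> prim \<alpha> v) (at v within {v..d})"
    using continuous_prim[of \<alpha>] v by (meson atLeastAtMost_iff atLeastatMost_subset_iff continuous_on_def order_refl tendsto_within_subset)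
  then have lim: "(prim \<alpha> \<longlongrightarrow> prim \<alpha> v) (at_right v)"
    using v' by (simp add: at_within_Icc_at_right)
  have "\<forall>\<^sub>F y in at_right v. prim \<alpha> y \<le> 0"
    using prim_le_after(2)[OF v(3) v'(1)] v'(2) by (auto simp: eventually_at_right intro!: exI[of _ d])
  then show ?thesis by (rule tendsto_upperbound[OF lim]) simp
qed

lemma prim_antimono_off_shadow:
  assumes "c \<le> x" "x < y" "y \<le> d" "x \<notin> shadow \<alpha>" "y \<notin> shadow \<alpha>"
  shows "prim \<alpha> y \<le> prim \<alpha> x"
proof (cases "x = c")
  case True then show ?thesis using prim_nonpos[of y] assms by (simp add: prim_c)
next
  case False then show ?thesis using prim_le_after(1)[of x \<alpha> y] assms by simp
qed

text \<open>If the value dropped across the gap, take a level \<open>k\<close> strictly between and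
  the last point of the gap where \<open>prim\<close> is at least \<open>k\<close>. This
  \<open>k\<close> is negative, so the truncation at 0 in \<open>shadow\<close> does not interfere,
  and some later point has a value above \<open>k\<close>. Inside the gap that contradicts the
  choice of the last point; beyond v it contradicts v being off the shadow.\<close>

lemma prim_shadow_gap:
  assumes uv: "c \<le> u" "u < v" "v \<le> d" "u \<notin> shadow \<alpha>" "v \<notin> shadow \<alpha>" and sub: "{u<..<v} \<subseteq> shadow \<alpha>"
  shows "prim \<alpha> u = prim \<alpha> v"
proof (rule ccontr)
  assume "prim \<alpha> u \<noteq> prim \<alpha> v"
  then have less: "prim \<alpha> v < prim \<alpha> u" using prim_antimono_off_shadow[of u v] uv by simp
  define k where "k = (prim \<alpha> u + prim \<alpha> v) / 2"
  have k: "prim \<alpha> v < k" "k < prim \<alpha> u" "k < 0"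
    using less prim_nonpos[of u] uv by (auto simp: k_def)
  have cont: "continuous_on {u..v} (prim \<alpha>)" using uv by (intro continuous_on_subset[OF continuous_prim]) auto
  obtain z where z: "u \<le> z" "z \<le> v" "prim \<alpha> z = k"
    using IVT2'[of "prim \<alpha>" v k u] k uv cont by auto
  define Z where "Z = {u..v} \<inter> prim \<alpha> -` {k..}"
  have "closed Z" unfolding Z_def
    using continuous_on_closed_vimage[THEN iffD1, rule_format, of "{u..v}" "prim \<alpha>" "{k..}"] cont
    by (simp add: Int_commute)
  moreover have zZ: "z \<in> Z" using z by (simp add: Z_def)
  moreover have bdd: "bdd_above Z" by (auto simp: Z_def intro!: bdd_aboveI[of _ v])
  ultimately have x: "Sup Z \<in> Z" by (intro closed_contains_Sup) auto
  define x where "x = Sup Z"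
  have "z \<le> x" unfolding x_def by (rule cSup_upper[OF zZ bdd])
  moreover have "z \<noteq> u" using z k by auto
  moreover have "x \<noteq> v" using x k by (auto simp: x_def Z_def)
  ultimately have "x \<in> {u<..<v}" using x z by (auto simp: x_def Z_def)
  then have "x \<in> shadow \<alpha>" using sub by blast
  then obtain y where y: "x < y" "y \<le> d" "min (prim \<alpha> x) 0 < prim \<alpha> y"
    by (auto simp: shadow_def)
  moreover have "k \<le> prim \<alpha> x" using x by (simp add: x_def Z_def)
  ultimately have ky: "k < prim \<alpha> y" using k by linarith
  show False
  proof (cases "y \<le> v")
    case True
    then have "y \<in> Z" using ky y x by (auto simp: x_def Z_def)
    then have "y \<le> x" unfolding x_def by (rule cSup_upper[OF _ bdd])
    then show False using y by simp
  next
    case False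
    then have "prim \<alpha> y \<le> prim \<alpha> v" using prim_le_after(1)[of v \<alpha> y] uv y by simp
    then show False using ky k by simp
  qed
qed

lemma integral_component:
  assumes xy: "c \<le> x" "y \<le> d" "x \<notin> shadow \<alpha>" "y \<notin> shadow \<alpha>"
    and C: "C \<in> components (shadow \<alpha> \<inter> {x<..<y})"
  obtains u v where "C = {u<..<v}" "c \<le> u" "u < v" "v \<le> d" "(LINT t:C|lebesgue. \<phi> t - \<alpha>) = 0"
proof -
  obtain u v where uv: "C = {u<..<v}" "u < v" "x \<le> u" "v \<le> y"
    "u \<notin> shadow \<alpha> \<inter> {x<..<y}" "v \<notin> shadow \<alpha> \<inter> {x<..<y}"
    by (rule component_of_open_real[OF _ Int_lower2 C]) (use open_shadow in auto)
  have "u \<notin> shadow \<alpha>" "v \<notin> shadow \<alpha>"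
    using uv xy by (cases "u = x"; force)+
  moreover have "{u<..<v} \<subseteq> shadow \<alpha>" using in_components_subset[OF C] uv by auto
  ultimately have "prim \<alpha> u = prim \<alpha> v" using uv xy by (intro prim_shadow_gap) auto
  then show ?thesis using that[OF uv(1)] integral_interval[of u v \<alpha>] uv xy by simp
qed

lemma integral_shadow_Int:
  assumes xy: "c \<le> x" "y \<le> d" "x \<notin> shadow \<alpha>" "y \<notin> shadow \<alpha>"
  shows "(LINT t:shadow \<alpha> \<inter> {x<..<y}|lebesgue. \<phi> t - \<alpha>) = 0"
proof -
  let ?W = "shadow \<alpha> \<inter> {x<..<y}"
  have W: "open ?W" "?W \<in> sets lebesgue" "?W \<subseteq> {c<..<d}"
    using open_shadow shadow_subset by auto
  have i: "set_integrable lebesgue ?W (\<lambda>t. \<phi> t - \<alpha>)"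
    using set_integrable_sub(1)[OF W(2,3)] set_integrable_const(1)[OF W(2,3)] by (rule set_integral_diff)
  have i': "set_integrable lebesgue ?W (\<lambda>t. - (\<phi> t - \<alpha>))"
    using set_integral_diff(1)[OF set_integrable_const(1)[OF W(2,3), of 0] i] by simp
  have iC: "set_integrable lebesgue C (\<lambda>t. \<phi> t - \<alpha>)" if "C \<in> components ?W" for C
    using that in_components_subset open_components[OF W(1)] by (intro set_integrable_subset[OF i]) auto
  have "(LINT t:?W|lebesgue. \<phi> t - \<alpha>) \<le> 0"
    by (rule set_integral_open_nonpos[OF W(1) i]) (rule integral_component[OF xy], auto)
  moreover have "(LINT t:?W|lebesgue. - (\<phi> t - \<alpha>)) \<le> 0"
  proof (rule set_integral_open_nonpos[OF W(1) i'])
    fix C assume C: "C \<in> components ?W"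
    show "(LINT t:C|lebesgue. - (\<phi> t - \<alpha>)) \<le> 0"
      unfolding set_integral_uminus[OF iC[OF C]] by (rule integral_component[OF xy C]) simp
  qed
  ultimately show ?thesis using set_integral_uminus[OF i] by linarith
qed

lemma integral_shadow: "(LINT t:shadow \<alpha>|lebesgue. \<phi> t) = \<alpha> * measure lebesgue (shadow \<alpha>)"
proof -
  have "shadow \<alpha> \<inter> {c<..<d} = shadow \<alpha>" using shadow_subset by auto
  then have "(LINT t:shadow \<alpha>|lebesgue. \<phi> t - \<alpha>) = 0"
    using integral_shadow_Int[of c d] end_points_notin_shadow by simp
  then show ?thesis
    using set_integral_diff(2)[OF set_integrable_sub(1)[OF shadow_sets shadow_subset]
        set_integrable_const(1)[OF shadow_sets shadow_subset, of \<alpha> \<alpha>]]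
      set_integrable_const(2)[OF shadow_sets shadow_subset, of \<alpha> \<alpha>] by simp
qed

text \<open>On each component \<alpha> is the mean of \<phi>, so \<open>osc\<close> applies there,
  and the components are summed.\<close>

lemma osc_shadow:
  "(LINT t:shadow \<alpha>|lebesgue. \<bar>\<phi> t - \<alpha>\<bar> powr p) \<le> B powr p * measure lebesgue (shadow \<alpha>)"
proof -
  let ?g = "\<lambda>t. \<bar>\<phi> t - \<alpha>\<bar> powr p"
  have sh: "shadow \<alpha> \<inter> {c<..<d} = shadow \<alpha>" using shadow_subset by auto
  have "(LINT t:shadow \<alpha>|lebesgue. ?g t - B powr p) \<le> 0"
  proof (rule set_integral_open_nonpos[OF open_shadow])
    show "set_integrable lebesgue (shadow \<alpha>) (\<lambda>t. ?g t - B powr p)"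
      using set_integrable_sub(2)[OF shadow_sets shadow_subset] set_integrable_const(1)[OF shadow_sets shadow_subset]
      by (rule set_integral_diff)
    fix C assume C: "C \<in> components (shadow \<alpha>)"
    obtain u v where uv: "C = {u<..<v}" "c \<le> u" "u < v" "v \<le> d" "(LINT t:C|lebesgue. \<phi> t - \<alpha>) = 0"
      by (rule integral_component[of c d C]) (use C sh end_points_notin_shadow in auto)
    have sub: "{u<..<v} \<subseteq> {c<..<d}" using uv by auto
    have m: "measure lebesgue {u<..<v} = v - u" using uv by simp
    have "(LINT t:{u<..<v}|lebesgue. \<phi> t) = \<alpha> * (v - u)"
      using uv(5) set_integral_diff(2)[OF set_integrable_sub(1)[OF _ sub] set_integrable_const(1)[OF _ sub, of \<alpha>]]
        set_integrable_const(2)[OF _ sub, of \<alpha>] m by (simp add: uv(1))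
    then have "(LINT t:{u<..<v}|lebesgue. ?g t) \<le> B powr p * (v - u)"
      using osc[of u v] uv by simp
    then show "(LINT t:C|lebesgue. ?g t - B powr p) \<le> 0"
      using set_integral_diff(2)[OF set_integrable_sub(2)[OF _ sub] set_integrable_const(1)[OF _ sub, of "B powr p"]]
        set_integrable_const(2)[OF _ sub, of "B powr p"] m by (simp add: uv(1))
  qed
  then show ?thesis
    using set_integral_diff(2)[OF set_integrable_sub(2)[OF shadow_sets shadow_subset]
        set_integrable_const(1)[OF shadow_sets shadow_subset, of \<alpha> "B powr p"]]
      set_integrable_const(2)[OF shadow_sets shadow_subset, of \<alpha> "B powr p"] by simp
qed

text \<open>The function \<phi> - \<alpha>, restricted to the complement of the shadow, is tested on
  intervals. An interval can be shrunk to the extreme points u and v of that complement inside it.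
  The shadow contributes 0 between them, so the integral is
  \<open>prim \<alpha> v - prim \<alpha> u\<close>, and \<open>prim\<close> does not increase
  between points off the shadow.\<close>

lemma AE_le_off_shadow: "AE t in lebesgue. t \<in> {c<..<d} - shadow \<alpha> \<longrightarrow> \<phi> t \<le> \<alpha>"
proof -
  let ?E = "{c<..<d} - shadow \<alpha>"
  define h where "h t = indicator ?E t * (\<phi> t - \<alpha>)" for t
  have E: "?E \<in> sets lebesgue" "?E \<subseteq> {c<..<d}" using shadow_sets by auto
  have hi: "integrable lebesgue h"
    using set_integral_diff(1)[OF set_integrable_sub(1)[OF E] set_integrable_const(1)[OF E]]
    by (simp add: set_integrable_def h_def[abs_def])
  have "AE t in lebesgue. h t \<le> 0"
  proof (rule AE_nonpos_if_interval_integrals_nonpos[OF hi])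
    show "h t = 0" if "t \<notin> {c<..<d}" for t using that by (auto simp: h_def)
    fix x y :: real assume "x < y"
    define K where "K = ({x..y} \<inter> {c..d}) - shadow \<alpha>"
    have K: "compact K" unfolding K_def by (intro compact_diff open_shadow) (auto simp: compact_Int)
    show "(LINT t:{x<..<y}|lebesgue. h t) \<le> 0"
    proof (cases "K = {}")
      case True
      moreover have "t \<in> K" if "t \<in> {x<..<y}" "t \<in> ?E" for t using that by (auto simp: K_def)
      ultimately have "\<not> (t \<in> {x<..<y} \<and> t \<in> ?E)" for t by blast
      then have "indicator {x<..<y} t *\<^sub>R h t = 0" for t
        unfolding h_def by (metis indicator_simps(2) mult_zero_left real_scaleR_def scale_eq_0_iff)
      then show ?thesis unfolding set_lebesgue_integral_def by (simp only: integral_zero order_refl)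
    next
      case False
      define u where "u = Inf K"
      define v where "v = Sup K"
      have bdd: "bdd_below K" "bdd_above K" using compact_imp_bounded[OF K] by (auto intro: bounded_imp_bdd_below bounded_imp_bdd_above)
      have uK: "u \<in> K" "v \<in> K" unfolding u_def v_def
        using False bdd compact_imp_closed[OF K] by (auto intro: closed_contains_Inf closed_contains_Sup)
      have uv: "u \<le> t" "t \<le> v" if "t \<in> K" for t
        using that bdd unfolding u_def v_def by (auto intro: cInf_lower cSup_upper)
      have u: "c \<le> u" "u \<notin> shadow \<alpha>" and v: "v \<le> d" "v \<notin> shadow \<alpha>" and "u \<le> v"
        using uK uv by (auto simp: K_def)
      have sub: "{u<..<v} \<subseteq> {c<..<d}" using u v by auto
      have ii: "set_integrable lebesgue {u<..<v} (\<lambda>t. \<phi> t - \<alpha>)"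
        using set_integrable_sub(1)[OF _ sub] set_integrable_const(1)[OF _ sub] by (intro set_integral_diff) auto
      have "(LINT t:{x<..<y}|lebesgue. h t) = (LINT t:{u<..<v} - shadow \<alpha> \<inter> {u<..<v}|lebesgue. \<phi> t - \<alpha>)"
        unfolding set_lebesgue_integral_def
      proof (rule integral_cong_AE)
        show "(\<lambda>t. indicator {x<..<y} t *\<^sub>R h t) \<in> borel_measurable lebesgue"
          using borel_measurable_integrable[OF hi] by (intro borel_measurable_scaleR borel_measurable_indicator) auto
        have "set_integrable lebesgue ({u<..<v} - shadow \<alpha> \<inter> {u<..<v}) (\<lambda>t. \<phi> t - \<alpha>)"
          by (intro set_integrable_subset[OF ii] sets.Diff sets.Int shadow_sets) auto
        then show "(\<lambda>t. indicator ({u<..<v} - shadow \<alpha> \<inter> {u<..<v}) t *\<^sub>R (\<phi> t - \<alpha>)) \<in> borel_measurable lebesgue"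
          unfolding set_integrable_def by (rule borel_measurable_integrable)
        have "{u, v} \<in> null_sets lebesgue" by (simp add: negligible_iff_null_sets[symmetric])
        from AE_not_in[OF this]
        show "AE t in lebesgue. indicator {x<..<y} t *\<^sub>R h t = indicator ({u<..<v} - shadow \<alpha> \<inter> {u<..<v}) t *\<^sub>R (\<phi> t - \<alpha>)"
        proof eventually_elim
          case (elim t)
          then have "(t \<in> {x<..<y} \<and> t \<in> ?E) \<longleftrightarrow> t \<in> {u<..<v} - shadow \<alpha> \<inter> {u<..<v}"
            using uv[of t] uK u v by (fastforce simp: K_def)
          then show ?case unfolding h_def by (auto split: split_indicator)
        qed
      qed
      also have "\<dots> = (LINT t:{u<..<v}|lebesgue. \<phi> t - \<alpha>) - (LINT t:shadow \<alpha> \<inter> {u<..<v}|lebesgue. \<phi> t - \<alpha>)"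
      proof -
        have "(LINT t:({u<..<v} - shadow \<alpha> \<inter> {u<..<v}) \<union> (shadow \<alpha> \<inter> {u<..<v})|lebesgue. \<phi> t - \<alpha>)
          = (LINT t:{u<..<v} - shadow \<alpha> \<inter> {u<..<v}|lebesgue. \<phi> t - \<alpha>) + (LINT t:shadow \<alpha> \<inter> {u<..<v}|lebesgue. \<phi> t - \<alpha>)"
          by (intro set_integral_Un set_integrable_subset[OF ii] sets.Diff sets.Int shadow_sets) auto
        moreover have "({u<..<v} - shadow \<alpha> \<inter> {u<..<v}) \<union> (shadow \<alpha> \<inter> {u<..<v}) = {u<..<v}" by auto
        ultimately show ?thesis by simp
      qed
      also have "\<dots> = prim \<alpha> v - prim \<alpha> u"
        using integral_shadow_Int[OF u(1) v(1) u(2) v(2)] integral_interval[OF u(1) \<open>u \<le> v\<close> v(1)] by simp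
      also have "\<dots> \<le> 0"
        using prim_antimono_off_shadow[of u v] u v \<open>u \<le> v\<close> by (cases "u = v") auto
      finally show ?thesis .
    qed
  qed
  then show ?thesis by eventually_elim (auto simp: h_def)
qed

end

end

section \<open>The one-sided tail\<close>

text \<open>A substitute for Minkowski's inequality that is affine in \<open>x powr p\<close>, from
  convexity with weights \<open>B / (B + \<eta>)\<close> and \<open>\<eta> / (B + \<eta>)\<close>.
  Equality holds at x = B, so if the mean of \<open>x powr p\<close> is at most
  \<open>B powr p\<close>, integration gives the bound \<open>(B + \<eta>) powr p\<close>.\<close>

lemma powr_add_le:
  fixes x B \<eta> p :: real
  assumes "0 \<le> x" "0 < B" "0 < \<eta>" "1 \<le> p"
  shows "(x + \<eta>) powr p \<le> ((B + \<eta>) / B) powr (p - 1) * x powr p + (B + \<eta>) powr (p - 1) * \<eta>"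
proof (cases "x = 0")
  case True
  have "\<eta> * \<eta> powr (p - 1) \<le> \<eta> * (B + \<eta>) powr (p - 1)"
    using assms by (intro mult_left_mono powr_mono2) auto
  then show ?thesis using True assms powr_mult_base[of \<eta> "p - 1"] by (simp add: mult.commute)
next
  case False
  then have x: "0 < x" using assms by simp
  define s where "s = \<eta> / (B + \<eta>)"
  have s: "0 \<le> s" "s \<le> 1" "1 - s = B / (B + \<eta>)" using assms by (auto simp: s_def field_simps)
  define r where "r = (B + \<eta>) / B"
  have r: "0 < r" "(1 - s) * r = 1" using assms s by (auto simp: r_def)
  have "((1 - s) *\<^sub>R (r * x) + s *\<^sub>R (B + \<eta>)) powr p \<le> (1 - s) * (r * x) powr p + s * (B + \<eta>) powr p"
    by (rule convex_onD[OF powr_convex[OF assms(4)]]) (use assms s r x in auto)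
  also have "(1 - s) *\<^sub>R (r * x) + s *\<^sub>R (B + \<eta>) = x + \<eta>"
    using r assms by (simp add: s_def mult.assoc[symmetric])
  also have "(1 - s) * (r * x) powr p = r powr (p - 1) * x powr p"
  proof -
    have "(r * x) powr p = r * r powr (p - 1) * x powr p"
      using assms r by (simp add: powr_mult powr_mult_base)
    then have "(1 - s) * (r * x) powr p = ((1 - s) * r) * r powr (p - 1) * x powr p" by (simp only: mult.assoc)
    then show ?thesis by (simp only: r(2) mult_1)
  qed
  also have "s * (B + \<eta>) powr p = (B + \<eta>) powr (p - 1) * \<eta>"
    using assms powr_mult_base[of "B + \<eta>" "p - 1"] by (simp add: s_def field_simps)
  finally show ?thesis by (simp add: r_def)
qed

context osc_bounded begin

lemma measurable_compose_phi:
  fixes f :: "real \<Rightarrow> real"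
  assumes "continuous_on UNIV f" "S \<in> sets lebesgue" "S \<subseteq> {c<..<d}"
  shows "set_borel_measurable lebesgue S (\<lambda>t. f (\<phi> t))"
proof -
  have "(\<lambda>t. indicator {c<..<d} t *\<^sub>R \<phi> t) \<in> borel_measurable lebesgue"
    using integrable unfolding set_integrable_def by (rule borel_measurable_integrable)
  then have "(\<lambda>t. f (indicator {c<..<d} t *\<^sub>R \<phi> t)) \<in> borel_measurable lebesgue"
    using borel_measurable_continuous_onI[OF assms(1)] by (rule measurable_compose)
  then have "(\<lambda>t. indicator S t *\<^sub>R f (indicator {c<..<d} t *\<^sub>R \<phi> t)) \<in> borel_measurable lebesgue"
    using assms(2) by (intro borel_measurable_scaleR borel_measurable_indicator)
  moreover have "(\<lambda>t. indicator S t *\<^sub>R f (indicator {c<..<d} t *\<^sub>R \<phi> t)) = (\<lambda>t. indicator S t *\<^sub>R f (\<phi> t))"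
    using assms(3) by (auto simp: fun_eq_iff split: split_indicator)
  ultimately show ?thesis by (simp add: set_borel_measurable_def)
qed

lemma superlevel_sets: "{t \<in> {c<..<d}. \<beta> < \<phi> t} \<in> sets lebesgue"
proof -
  have "\<phi> -` {\<beta><..} \<inter> {c<..<d} \<in> sets lebesgue"
    by (rule set_borel_measurable_sets) (use measurable_compose_phi[OF continuous_on_id, of "{c<..<d}"] in auto)
  moreover have "\<phi> -` {\<beta><..} \<inter> {c<..<d} = {t \<in> {c<..<d}. \<beta> < \<phi> t}" by auto
  ultimately show ?thesis by simp
qed

theorem upper_tail:
  assumes p: "1 < p" "p \<le> 2" and a: "0 < a" "2 - p \<le> a" "a < 1"
    and B: "0 < B" "B powr p < a powr p * log_osc p" and l: "0 < l"
  shows "l \<le> - ln (1 - a) \<or>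
    2 * measure lebesgue {t \<in> {c<..<d}. mean + l < \<phi> t} \<le> (d - c) * exp ((- ln (1 - a) - l) / a)"
proof -
  obtain f f1 g M \<delta> where \<delta>: "0 < \<delta>" and ker: "bellman_kernel a f f1 g M"
    and f0: "\<And>v. 0 \<le> f v" and fle: "\<And>v. f v \<le> (\<bar>v\<bar> + \<delta>) powr p"
    and ftan: "\<And>u v. f u + f1 u * (v - u) \<le> f v"
    and big: "(B + 2 * \<delta>) powr p < f (- a) + a * f1 (- a) + a\<^sup>2 * M (- a)"
    using bellman_kernel_exists[OF p a B] by metis
  have fcont: "continuous_on UNIV f"
    using bellman_kernelD(1)[OF ker] by (meson DERIV_isCont continuous_at_imp_continuous_on)
  \<comment> \<open>\<open>0 < E 0\<close> is the strict form of the plane condition at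
    \<open>y0 = a\<close>; by continuity the condition persists at \<open>a + h\<close>, which
    allows for \<phi> exceeding the interpolated mean by up to one step h.\<close>
  define E where "E h = a + h - (1 - a) * (exp (a + h) - 1)" for h
  have "0 < E 0"
  proof -
    have "1 + - a < exp (- a)" using exp_minus_greater[of a] a by simp
    then have "(1 - a) * exp a < 1" by (simp add: exp_minus field_simps)
    then show ?thesis by (simp add: E_def algebra_simps)
  qed
  moreover have "isCont E 0" unfolding E_def by (intro continuous_intros)
  ultimately have "\<forall>\<^sub>F h in nhds 0. 0 < E h"
    by (intro order_tendstoD(1)[of E "E 0"]) (auto simp: isCont_def tendsto_at_iff_tendsto_nhds)
  then obtain \<eta> where \<eta>: "0 < \<eta>" "\<And>h. \<bar>h\<bar> < \<eta> \<Longrightarrow> 0 < E h"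
    unfolding eventually_nhds_metric by (auto simp: dist_real_def)
  \<comment> \<open>The n equal steps from \<open>mean + l\<close> down to \<open>mean\<close> must
    be shorter than both the slack in \<open>E\<close> and the smoothing width \<delta>.\<close>
  obtain n where n: "l / min \<eta> \<delta> < real n" using reals_Archimedean2 by blast
  have n0: "0 < n" using n l \<eta>(1) \<delta> by (cases n) (auto simp: divide_less_0_iff not_less)
  define h where "h = l / n"
  define \<mu> where "\<mu> = min \<eta> \<delta>"
  have "0 < \<mu>" using \<eta>(1) \<delta> by (simp add: \<mu>_def)
  then have "h < \<mu>" using n n0 by (simp add: h_def \<mu>_def[symmetric] field_simps)
  then have h: "0 < h" "h < \<eta>" "h < \<delta>" using n0 l by (auto simp: h_def \<mu>_def)
  have h1: "(1 - a) * (exp (a + h) - 1) \<le> a + h" using \<eta>(2)[of h] h by (simp add: E_def)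
  define \<alpha> where "\<alpha> i = mean + l - real i * h" for i :: nat
  have \<alpha>n: "\<alpha> n = mean" using n0 by (simp add: \<alpha>_def h_def)
  have \<alpha>0: "\<alpha> 0 = mean + l" by (simp add: \<alpha>_def)
  have \<alpha>Suc: "\<alpha> (Suc i) = \<alpha> i - h" for i by (simp add: \<alpha>_def algebra_simps)
  have \<alpha>ge: "mean \<le> \<alpha> i" if "i \<le> n" for i
  proof -
    have "real i * h \<le> real n * h" using that h by simp
    then show ?thesis using \<alpha>n by (simp add: \<alpha>_def)
  qed
  \<comment> \<open>The last set is the whole interval, whose average is the last level
    \<open>mean\<close>; the shadow at that level can be smaller.\<close>
  define U where "U i = (if i < n then shadow (\<alpha> i) else {c<..<d})" for i
  have U: "U i \<in> sets lebesgue" "U i \<subseteq> {c<..<d}" for i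
    using shadow_sets shadow_subset by (auto simp: U_def)
  have Umono: "U i \<subseteq> U (Suc i)" for i
    using shadow_subset shadow_antimono[of "\<alpha> (Suc i)" "\<alpha> i"] h by (auto simp: U_def \<alpha>Suc)
  have U0: "U 0 \<subseteq> U i" for i by (induction i) (use Umono in auto)
  define A where "A i = measure lebesgue (U i)" for i
  have D: "U i - U j \<in> sets lebesgue" "U i - U j \<subseteq> {c<..<d}" for i j using U by auto
  have An: "A n = d - c" using cd by (simp add: A_def U_def)
  have fin: "emeasure lebesgue (U i) < \<infinity>" for i
  proof -
    have "emeasure lebesgue (U i) \<le> emeasure lebesgue {c<..<d}" using U by (intro emeasure_mono) auto
    then show ?thesis using cd by (simp add: le_less_trans)
  qed
  have Adiff: "measure lebesgue (U (Suc i) - U i) = A (Suc i) - A i" for i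
    unfolding A_def using U fin Umono by (intro measure_Diff) (auto simp: fmeasurable_def less_top)
  have Aint: "(LINT t:U i|lebesgue. \<phi> t) = \<alpha> i * A i" if "i \<le> n" for i
  proof (cases "i = n")
    case True then show ?thesis using cd An by (simp add: U_def \<alpha>n mean_def)
  next
    case False then show ?thesis using integral_shadow[OF \<alpha>ge[OF that]] that by (simp add: U_def A_def)
  qed
  have Aosc: "(LINT t:U i|lebesgue. \<bar>\<phi> t - \<alpha> i\<bar> powr p) \<le> B powr p * A i" if "i \<le> n" for i
  proof (cases "i = n")
    case True then show ?thesis using osc[of c d] cd An by (simp add: U_def \<alpha>n mean_def)
  next
    case False then show ?thesis using osc_shadow[OF \<alpha>ge[OF that]] that by (simp add: U_def A_def)
  qed
  have AEle: "AE t in lebesgue. t \<in> U j - U i \<longrightarrow> \<phi> t \<le> \<alpha> i" if "i \<le> n" for i j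
  proof (cases "i = n")
    case True
    then have "U i = {c<..<d}" by (simp add: U_def)
    then have "t \<notin> U j - U i" for t using U(2)[of j] by auto
    then show ?thesis by blast
  next
    case False
    then have "U i = shadow (\<alpha> i)" using that by (simp add: U_def)
    then show ?thesis using AE_le_off_shadow[OF \<alpha>ge[OF that]] U(2)[of j] by (auto elim!: eventually_mono)
  qed
  have sub_le: "measure lebesgue {t \<in> {c<..<d}. mean + l < \<phi> t} \<le> A 0"
  proof -
    have "emeasure lebesgue {t \<in> {c<..<d}. mean + l < \<phi> t} \<le> emeasure lebesgue (U 0)"
    proof (rule emeasure_mono_AE[OF _ U(1)])
      show "AE t in lebesgue. t \<in> {t \<in> {c<..<d}. mean + l < \<phi> t} \<longrightarrow> t \<in> U 0"
        using AEle[of 0 n, OF le0] by eventually_elim (auto simp: U_def[of n] \<alpha>0)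
    qed
    then show ?thesis unfolding A_def measure_def using fin[of 0] by (intro enn2real_mono) auto
  qed
  show ?thesis
  proof (cases "A 0 = 0")
    case True
    then have "2 * measure lebesgue {t \<in> {c<..<d}. mean + l < \<phi> t} \<le> 0" using sub_le by simp
    also have "0 \<le> (d - c) * exp ((- ln (1 - a) - l) / a)" using cd by simp
    finally show ?thesis by simp
  next
    case False
    then have A0: "0 < A 0" by (simp add: A_def less_le)
    have Amono: "A i \<le> A (Suc i)" for i
      using Adiff[of i, symmetric] measure_nonneg[of lebesgue "U (Suc i) - U i"] by linarith
    have Apos: "0 < A i" for i using A0 Amono by (induction i) (auto intro: less_le_trans)
    \<comment> \<open>Off \<open>U i\<close> the function is almost everywhere at most
      \<open>\<alpha> i\<close>, so its exponential is integrable on differences of chain sets,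
      although integrability on \<open>U 0\<close> is not known.\<close>
    have int_exp: "set_integrable lebesgue (U j - U i) (\<lambda>t. exp (\<phi> t))" if "i \<le> n" for i j
    proof (rule set_integrable_bound[OF set_integrable_const(1)[OF D, where k = "exp (\<alpha> i)"]])
      show "set_borel_measurable lebesgue (U j - U i) (\<lambda>t. exp (\<phi> t))"
        by (rule measurable_compose_phi[OF _ D]) (intro continuous_intros)
      show "AE t in lebesgue. t \<in> U j - U i \<longrightarrow> norm (exp (\<phi> t)) \<le> norm (exp (\<alpha> i))"
        using AEle[OF that] by eventually_elim auto
    qed
    have int_f: "set_integrable lebesgue S (\<lambda>t. f (\<phi> t - \<kappa>))" if S: "S \<in> sets lebesgue" "S \<subseteq> {c<..<d}" for S \<kappa>
    proof (rule set_integrable_bound)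
      let ?g = "\<lambda>t. ((B + \<delta>) / B) powr (p - 1) * \<bar>\<phi> t - \<kappa>\<bar> powr p + (B + \<delta>) powr (p - 1) * \<delta>"
      show "set_integrable lebesgue S (\<lambda>t. ?g t)"
        by (intro set_integral_add set_integrable_mult_right set_integrable_sub(2) set_integrable_const(1) S)
      show "set_borel_measurable lebesgue S (\<lambda>t. f (\<phi> t - \<kappa>))"
        by (rule measurable_compose_phi[OF _ S])
           (auto intro!: continuous_on_compose2[OF fcont] continuous_intros)
      show "AE t in lebesgue. t \<in> S \<longrightarrow> norm (f (\<phi> t - \<kappa>))
          \<le> norm (?g t)"
      proof (rule AE_I2, rule impI)
        fix t
        have "f (\<phi> t - \<kappa>) \<le> (\<bar>\<phi> t - \<kappa>\<bar> + \<delta>) powr p" by (rule fle)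
        also have "\<dots> \<le> ?g t"
          by (rule powr_add_le) (use B \<delta> p in auto)
        finally show "norm (f (\<phi> t - \<kappa>))
          \<le> norm (?g t)"
          using f0[of "\<phi> t - \<kappa>"] by simp
      qed
    qed
    have split: "(LINT t:U (Suc i) - U 0|lebesgue. F t)
        = (LINT t:U i - U 0|lebesgue. F t) + (LINT t:U (Suc i) - U i|lebesgue. F t)"
      if "set_integrable lebesgue (U (Suc i) - U 0) F" for i and F :: "real \<Rightarrow> real"
    proof -
      have eq: "U (Suc i) - U 0 = (U i - U 0) \<union> (U (Suc i) - U i)" using Umono[of i] U0[of i] by auto
      show ?thesis unfolding eq
        by (rule set_integral_Un) (use D Umono[of i] U0[of i] in \<open>auto intro!: set_integrable_subset[OF that]\<close>)
    qed
    define S where "S i = \<alpha> i * A i" for i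
    \<comment> \<open>On \<open>U 0\<close> the function is replaced by its mean
      \<open>\<alpha> 0\<close>, both here and in \<open>R\<close>. This avoids integrating exp
      \<phi> over \<open>U 0\<close> and puts the start of the chain on the lower boundary.\<close>
    define P where "P i = A 0 * exp (\<alpha> 0) + (LINT t:U i - U 0|lebesgue. exp (\<phi> t))" for i
    define R where "R i \<kappa> = A 0 * f (\<alpha> 0 - \<kappa>) + (LINT t:U i - U 0|lebesgue. f (\<phi> t - \<kappa>))" for i \<kappa>
    have SA: "S i / A i = \<alpha> i" for i using Apos[of i] by (simp add: S_def)
    have Sdiff: "S (Suc i) - S i = (LINT t:U (Suc i) - U i|lebesgue. \<phi> t)" if "i < n" for i
    proof -
      have "(LINT t:U i \<union> (U (Suc i) - U i)|lebesgue. \<phi> t)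
          = (LINT t:U i|lebesgue. \<phi> t) + (LINT t:U (Suc i) - U i|lebesgue. \<phi> t)"
        by (rule set_integral_Un) (auto intro!: set_integrable_sub U D)
      moreover have "U i \<union> (U (Suc i) - U i) = U (Suc i)" using Umono by auto
      ultimately show ?thesis using Aint[of i] Aint[of "Suc i"] that by (simp add: S_def)
    qed
    have Pdiff: "P (Suc i) - P i = (LINT t:U (Suc i) - U i|lebesgue. exp (\<phi> t))" for i
      using split[OF int_exp[of 0]] by (simp add: P_def)
    have Rdiff: "R (Suc i) \<kappa> - R i \<kappa> = (LINT t:U (Suc i) - U i|lebesgue. f (\<phi> t - \<kappa>))" for i \<kappa>
      using split[OF int_f[OF D]] by (simp add: R_def)
    have lin: "(LINT t:U (Suc i) - U i|lebesgue. k0 + k1 * \<phi> t + k2 * exp (\<phi> t))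
        = k0 * (A (Suc i) - A i) + k1 * (S (Suc i) - S i) + k2 * (P (Suc i) - P i)"
      and lin_int: "set_integrable lebesgue (U (Suc i) - U i) (\<lambda>t. k0 + k1 * \<phi> t + k2 * exp (\<phi> t))"
      if i: "i < n" for i k0 k1 k2
    proof -
      have 0: "set_integrable lebesgue (U (Suc i) - U i) (\<lambda>t. k0)" by (rule set_integrable_const(1)[OF D])
      have 1: "set_integrable lebesgue (U (Suc i) - U i) (\<lambda>t. k1 * \<phi> t)"
        by (intro set_integrable_mult_right set_integrable_sub(1) D)
      have 2: "set_integrable lebesgue (U (Suc i) - U i) (\<lambda>t. k2 * exp (\<phi> t))"
        by (intro set_integrable_mult_right int_exp) (use i in simp)
      show "set_integrable lebesgue (U (Suc i) - U i) (\<lambda>t. k0 + k1 * \<phi> t + k2 * exp (\<phi> t))"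
        by (intro set_integral_add 0 1 2)
      have "(LINT t:U (Suc i) - U i|lebesgue. k0 + k1 * \<phi> t + k2 * exp (\<phi> t))
        = (LINT t:U (Suc i) - U i|lebesgue. k0) + (LINT t:U (Suc i) - U i|lebesgue. k1 * \<phi> t)
          + (LINT t:U (Suc i) - U i|lebesgue. k2 * exp (\<phi> t))"
        by (simp only: set_integral_add(2)[OF set_integral_add(1)[OF 0 1] 2] set_integral_add(2)[OF 0 1])
      then show "(LINT t:U (Suc i) - U i|lebesgue. k0 + k1 * \<phi> t + k2 * exp (\<phi> t))
        = k0 * (A (Suc i) - A i) + k1 * (S (Suc i) - S i) + k2 * (P (Suc i) - P i)"
        by (simp add: set_integrable_const(2)[OF D] Adiff Sdiff[OF i] Pdiff)
    qed
    have P0: "P 0 = A 0 * exp (S 0 / A 0)" by (simp add: P_def SA set_lebesgue_integral_def)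
    have jensen: "exp z * ((1 - z) * (A (Suc i) - A i) + (S (Suc i) - S i)) \<le> P (Suc i) - P i" if i: "i < n" for i z
    proof -
      have "(LINT t:U (Suc i) - U i|lebesgue. exp z * (1 - z) + exp z * \<phi> t + 0 * exp (\<phi> t))
        \<le> (LINT t:U (Suc i) - U i|lebesgue. exp (\<phi> t))"
      proof (rule set_integral_mono[OF lin_int[OF i] int_exp])
        fix t
        have "exp z * (1 + (\<phi> t - z)) \<le> exp z * exp (\<phi> t - z)"
          by (intro mult_left_mono exp_ge_add_one_self) simp
        then show "exp z * (1 - z) + exp z * \<phi> t + 0 * exp (\<phi> t) \<le> exp (\<phi> t)"
          by (simp add: exp_diff algebra_simps)
      qed (use i in simp)
      then show ?thesis unfolding lin[OF i] Pdiff[symmetric] by (simp add: algebra_simps)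
    qed
    have plane: "f (w - \<kappa>) * (A (Suc i) - A i) + f1 (w - \<kappa>) * (S (Suc i) - S i - w * (A (Suc i) - A i))
        + (1 - a) * M (w - \<kappa>) * (exp (- w) * (P (Suc i) - P i) - (A (Suc i) - A i)
            - (S (Suc i) - S i - w * (A (Suc i) - A i)))
        \<le> R (Suc i) \<kappa> - R i \<kappa>" if i: "i < n" and w: "S i / A i \<le> w + a + h" for i \<kappa> w
    proof -
      define m where "m = (1 - a) * M (w - \<kappa>)"
      define k0 where "k0 = f (w - \<kappa>) - f1 (w - \<kappa>) * w + m * (w - 1)"
      define k1 where "k1 = f1 (w - \<kappa>) - m"
      define k2 where "k2 = m * exp (- w)"
      have "(LINT t:U (Suc i) - U i|lebesgue. k0 + k1 * \<phi> t + k2 * exp (\<phi> t))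
        \<le> (LINT t:U (Suc i) - U i|lebesgue. f (\<phi> t - \<kappa>))"
      proof (rule set_integral_mono_AE[OF lin_int[OF i] int_f[OF D]])
        show "AE t\<in>U (Suc i) - U i in lebesgue. k0 + k1 * \<phi> t + k2 * exp (\<phi> t) \<le> f (\<phi> t - \<kappa>)"
          using AEle[of i "Suc i", OF less_imp_le[OF i]]
        proof eventually_elim
          case (elim t)
          show ?case
          proof
            assume "t \<in> U (Suc i) - U i"
            \<comment> \<open>On the added set \<phi> is at most the old level, which exceeds the
              tangent parameter by at most \<open>a + h\<close>, the range of the plane
              inequality.\<close>
            then have "\<phi> t - w \<le> a + h" using elim w SA[of i] by simp
            from bellman_kernel_plane_le[OF a(1,3) ker h1 _ this, of "w - \<kappa>"]
            have "f (w - \<kappa>) + f1 (w - \<kappa>) * (\<phi> t - w) + m * (exp (\<phi> t - w) - 1 - (\<phi> t - w)) \<le> f (\<phi> t - \<kappa>)"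
              using a h by (simp add: m_def)
            moreover have "exp (\<phi> t - w) = exp (- w) * exp (\<phi> t)" by (simp add: exp_add[symmetric])
            ultimately show "k0 + k1 * \<phi> t + k2 * exp (\<phi> t) \<le> f (\<phi> t - \<kappa>)"
              by (simp add: k0_def k1_def k2_def algebra_simps)
          qed
        qed
      qed
      then have "k0 * (A (Suc i) - A i) + k1 * (S (Suc i) - S i) + k2 * (P (Suc i) - P i) \<le> R (Suc i) \<kappa> - R i \<kappa>"
        unfolding lin[OF i] Rdiff .
      then show ?thesis unfolding m_def[symmetric] by (simp add: k0_def k1_def k2_def algebra_simps)
    qed
    have Rb: "R i \<kappa> \<le> (B + 2 * \<delta>) powr p * A i" if i: "i \<le> n" and \<kappa>: "\<bar>\<kappa> - S i / A i\<bar> \<le> h" for i \<kappa>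
    proof -
      let ?r = "((B + 2 * \<delta>) / B) powr (p - 1)" and ?s = "(B + 2 * \<delta>) powr (p - 1)"
      let ?q0 = "f (\<alpha> 0 - \<kappa>) - f1 (\<alpha> 0 - \<kappa>) * \<alpha> 0" and ?q1 = "f1 (\<alpha> 0 - \<kappa>)"
      have i0: "set_integrable lebesgue (U 0) (\<lambda>t. ?q0)" by (rule set_integrable_const(1)[OF U])
      have i1: "set_integrable lebesgue (U 0) (\<lambda>t. ?q1 * \<phi> t)"
        by (intro set_integrable_mult_right set_integrable_sub(1) U)
      \<comment> \<open>Jensen's inequality on \<open>U 0\<close>, in tangent form, puts \<phi> back
        in place of its mean, so that \<open>Aosc\<close> becomes applicable.\<close>
      have "A 0 * f (\<alpha> 0 - \<kappa>) = (LINT t:U 0|lebesgue. ?q0 + ?q1 * \<phi> t)"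
        unfolding set_integral_add(2)[OF i0 i1] set_integrable_const(2)[OF U]
        by (simp add: Aint A_def[symmetric]) (simp add: algebra_simps)
      also have "\<dots> \<le> (LINT t:U 0|lebesgue. f (\<phi> t - \<kappa>))"
      proof (rule set_integral_mono[OF set_integral_add(1)[OF i0 i1] int_f[OF U]])
        fix t show "?q0 + ?q1 * \<phi> t \<le> f (\<phi> t - \<kappa>)"
          using ftan[of "\<alpha> 0 - \<kappa>" "\<phi> t - \<kappa>"] by (simp add: algebra_simps)
      qed
      finally have "R i \<kappa> \<le> (LINT t:U 0|lebesgue. f (\<phi> t - \<kappa>)) + (LINT t:U i - U 0|lebesgue. f (\<phi> t - \<kappa>))"
        by (simp add: R_def)
      also have "\<dots> = (LINT t:U 0 \<union> (U i - U 0)|lebesgue. f (\<phi> t - \<kappa>))"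
        by (rule set_integral_Un[symmetric]) (auto intro!: int_f U D)
      also have "U 0 \<union> (U i - U 0) = U i" using U0 by auto
      also have "(LINT t:U i|lebesgue. f (\<phi> t - \<kappa>))
        \<le> (LINT t:U i|lebesgue. ?r * \<bar>\<phi> t - \<alpha> i\<bar> powr p + ?s * (2 * \<delta>))"
      proof (rule set_integral_mono[OF int_f[OF U]])
        show "set_integrable lebesgue (U i)
            (\<lambda>t. ?r * \<bar>\<phi> t - \<alpha> i\<bar> powr p + ?s * (2 * \<delta>))"
          by (intro set_integral_add set_integrable_mult_right set_integrable_sub(2) set_integrable_const(1) U)
        fix t
        \<comment> \<open>Moving the centre from \<kappa> to \<open>\<alpha> i\<close> costs at most
          h < \<delta>, and the smoothing costs another \<delta>.\<close>
        have "\<bar>\<phi> t - \<kappa>\<bar> + \<delta> \<le> \<bar>\<phi> t - \<alpha> i\<bar> + 2 * \<delta>" using \<kappa> h unfolding SA by linarith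
        then have "(\<bar>\<phi> t - \<kappa>\<bar> + \<delta>) powr p \<le> (\<bar>\<phi> t - \<alpha> i\<bar> + 2 * \<delta>) powr p"
          using p \<delta> by (intro powr_mono2) auto
        also have "\<dots> \<le> ?r * \<bar>\<phi> t - \<alpha> i\<bar> powr p + ?s * (2 * \<delta>)"
          by (rule powr_add_le) (use B \<delta> p in auto)
        finally show "f (\<phi> t - \<kappa>) \<le> ?r * \<bar>\<phi> t - \<alpha> i\<bar> powr p + ?s * (2 * \<delta>)"
          using fle[of "\<phi> t - \<kappa>"] by linarith
      qed
      also have "\<dots> = ?r * (LINT t:U i|lebesgue. \<bar>\<phi> t - \<alpha> i\<bar> powr p) + ?s * (2 * \<delta>) * A i"
      proof -
        have j0: "set_integrable lebesgue (U i) (\<lambda>t. ?r * \<bar>\<phi> t - \<alpha> i\<bar> powr p)"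
          by (intro set_integrable_mult_right set_integrable_sub(2) U)
        have j1: "set_integrable lebesgue (U i) (\<lambda>t. ?s * (2 * \<delta>))"
          by (intro set_integrable_const(1) U)
        show ?thesis unfolding set_integral_add(2)[OF j0 j1] set_integrable_const(2)[OF U] A_def by simp
      qed
      also have "\<dots> \<le> ?r * (B powr p * A i) + ?s * (2 * \<delta>) * A i"
        using Aosc[OF i] by (intro add_right_mono mult_left_mono) auto
      also have "?r * (B powr p * A i) = ?s * B * A i"
      proof -
        have "B powr p = B powr (p - 1) * B" using powr_mult_base[of B "p - 1"] B by (simp add: mult.commute)
        then show ?thesis using B \<delta> by (simp add: powr_divide)
      qed
      also have "?s * B * A i + ?s * (2 * \<delta>) * A i
        = (B + 2 * \<delta>) * ?s * A i" by (simp add: algebra_simps)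
      also have "\<dots> = (B + 2 * \<delta>) powr p * A i"
        using powr_mult_base[of "B + 2 * \<delta>" "p - 1"] B \<delta> by simp
      finally show ?thesis .
    qed
    have ok: "(1 - a) * exp (a - (S i + t * (S (Suc i) - S i)) / (A i + t * (A (Suc i) - A i)))
       * (P i + t * (P (Suc i) - P i)) \<le> A i + t * (A (Suc i) - A i)" if "i < n" "0 \<le> t" "t \<le> 1" for i t
      by (rule bellman_chain[where R = R and n = n, OF a(1,3) ker h1 _ A0 Amono _ _ P0 plane _ Rb big that])
         (use h in \<open>auto simp: SA \<alpha>Suc, auto simp: R_def set_lebesgue_integral_def SA\<close>)
    have "S 0 / A 0 - S n / A n = l" by (simp add: SA \<alpha>0 \<alpha>n)
    moreover have "P i \<le> P (Suc i)" for i
    proof -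
      have "0 \<le> (LINT t:U (Suc i) - U i|lebesgue. exp (\<phi> t))"
        unfolding set_lebesgue_integral_def by (rule integral_nonneg_AE) auto
      then show ?thesis using Pdiff[of i] by linarith
    qed
    ultimately have "l \<le> - ln (1 - a) \<or> 2 * A 0 \<le> A n * exp ((- ln (1 - a) - l) / a)"
      using weak_type_chain[where A = A and S = S and P = P, OF a(1,3) n0 A0 Amono P0 _ jensen ok] l by simp
    then show ?thesis using sub_le An by auto
  qed
qed

end

section \<open>Oscillation of the logarithm\<close>

lemma FTC_nonneg_Ioo_0_1:
  fixes f F :: "real \<Rightarrow> real"
  assumes D: "\<And>x. 0 < x \<Longrightarrow> x < 1 \<Longrightarrow> (F has_real_derivative f x) (at x)"
    and cont: "\<And>x. 0 < x \<Longrightarrow> x < 1 \<Longrightarrow> isCont f x"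
    and nonneg: "\<And>x. 0 < x \<Longrightarrow> x < 1 \<Longrightarrow> 0 \<le> f x"
    and A: "(F \<longlongrightarrow> A) (at_right 0)" and B: "(F \<longlongrightarrow> B) (at_left 1)"
  shows "set_integrable lebesgue {0<..<1} f" "(LINT x:{0<..<1}|lebesgue. f x) = B - A"
proof -
  have *: "set_integrable lborel (einterval (ereal 0) (ereal 1)) f" "(LBINT x=ereal 0..ereal 1. f x) = B - A"
    by (rule interval_integral_FTC_nonneg[where F = F];
        use assms in \<open>auto simp: ereal_tendsto_simps simp del: zero_ereal_def one_ereal_def\<close>)+
  have m: "(\<lambda>x. indicator {0<..<1} x *\<^sub>R f x) \<in> borel_measurable lborel"
    using borel_measurable_integrable[OF *(1)[unfolded set_integrable_def einterval_eq]] .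
  show "set_integrable lebesgue {0<..<1} f"
    using *(1) integrable_completion[OF m] by (simp add: set_integrable_def)
  have "(LINT x:{0<..<1}|lebesgue. f x) = (LBINT x:{0<..<1}. f x)"
    unfolding set_lebesgue_integral_def by (rule integral_completion[OF m])
  also have "\<dots> = (LBINT x=ereal 0..ereal 1. f x)"
    by (simp add: interval_lebesgue_integral_def del: zero_ereal_def one_ereal_def)
  finally show "(LINT x:{0<..<1}|lebesgue. f x) = B - A" using *(2) by simp
qed

lemma minus_ln_integral:
  "set_integrable lebesgue {0<..<1} (\<lambda>u::real. - ln u)" "(LINT u:{0<..<1}|lebesgue. - ln u :: real) = 1"
proof -
  define F :: "real \<Rightarrow> real" where "F u = u - u * ln u" for u
  have D: "(F has_real_derivative - ln x) (at x)" if "0 < x" for x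
    unfolding F_def using that by (auto intro!: derivative_eq_intros)
  \<comment> \<open>Substituting y = - ln u turns the critical term - u ln u at 0 into y / exp y at
    infinity.\<close>
  have "((\<lambda>y::real. y ^ 1 / exp y) \<longlongrightarrow> 0) at_top" by (rule tendsto_power_div_exp_0)
  moreover have "filterlim (\<lambda>u::real. - ln u) at_top (at_right 0)"
    using ln_at_0 by (simp add: filterlim_uminus_at_top)
  ultimately have "((\<lambda>u::real. (- ln u) ^ 1 / exp (- ln u)) \<longlongrightarrow> 0) (at_right 0)"
    by (rule filterlim_compose)
  then have "((\<lambda>u::real. u + (- ln u) ^ 1 / exp (- ln u)) \<longlongrightarrow> 0 + 0) (at_right 0)"
    by (intro tendsto_intros)
  moreover have "\<forall>\<^sub>F u in at_right 0. u + (- ln u) ^ 1 / exp (- ln u) = F u"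
    by (rule eventually_mono[OF eventually_at_right_less]) (auto simp: F_def exp_minus divide_inverse)
  ultimately have 0: "(F \<longlongrightarrow> 0) (at_right 0)" by (simp add: filterlim_cong)
  have "isCont F 1" using DERIV_isCont[OF D] by simp
  then have 1: "(F \<longlongrightarrow> F 1) (at_left 1)" by (simp add: isCont_def filterlim_at_split)
  have c: "isCont (\<lambda>u. - ln u) x" if "0 < x" for x :: real using that by (intro continuous_intros) auto
  show "set_integrable lebesgue {0<..<1} (\<lambda>u::real. - ln u)"
    by (rule FTC_nonneg_Ioo_0_1(1)[OF D c _ 0 1]) auto
  have "(LINT u:{0<..<1}|lebesgue. - ln u :: real) = F 1 - 0"
    by (rule FTC_nonneg_Ioo_0_1(2)[OF D c _ 0 1]) auto
  then show "(LINT u:{0<..<1}|lebesgue. - ln u :: real) = 1" by (simp add: F_def)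
qed

lemma log_osc_integral:
  assumes p: "1 < p" "p \<le> 2"
  shows "set_integrable lebesgue {0<..<1} (\<lambda>u. \<bar>- ln u - 1\<bar> powr p)"
    "(LINT u:{0<..<1}|lebesgue. \<bar>- ln u - 1\<bar> powr p) = log_osc p"
proof -
  \<comment> \<open>\<open>G y\<close> is the integral of
    \<open>\<bar>r\<bar> powr p * exp (- r - 1)\<close> over r > y, integrated by parts; the
    substitution r = - ln u - 1 makes \<open>F\<close> an antiderivative of the integrand.\<close>
  define G where "G y = exp (- 1) * (\<bar>y\<bar> powr p * exp (- y) + p * exp_tail p y)" for y
  define F where "F u = G (- ln u - 1)" for u
  have DG: "(G has_real_derivative - (exp (- 1) * (\<bar>y\<bar> powr p * exp (- y)))) (at y)" for y
  proof -
    have "(G has_real_derivative exp (- 1) * ((p * signed_powr (p - 1) y * exp (- y) + - exp (- y) * \<bar>y\<bar> powr p)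
        + p * - (signed_powr (p - 1) y * exp (- y)))) (at y)"
      unfolding G_def
      by (intro DERIV_cmult DERIV_add DERIV_mult DERIV_abs_powr DERIV_exp_tail p) (auto intro!: derivative_eq_intros)
    then show ?thesis by (simp add: algebra_simps)
  qed
  have D: "(F has_real_derivative \<bar>- ln x - 1\<bar> powr p) (at x)" if "0 < x" for x
  proof -
    have "((\<lambda>x. - ln x - 1) has_real_derivative - 1 / x) (at x)" using that by (auto intro!: derivative_eq_intros)
    from DERIV_chain2[OF DG this]
    have "(F has_real_derivative - (exp (- 1) * (\<bar>- ln x - 1\<bar> powr p * exp (- (- ln x - 1)))) * (- 1 / x)) (at x)"
      by (simp add: F_def[abs_def])
    also have "- (exp (- 1) * (\<bar>- ln x - 1\<bar> powr p * exp (- (- ln x - 1)))) * (- 1 / x) = \<bar>- ln x - 1\<bar> powr p"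
      using that by (simp add: exp_add exp_minus field_simps)
    finally show ?thesis .
  qed
  have "((\<lambda>y. exp (- 1) * (\<bar>y\<bar> powr p * exp (- y) + p * exp_tail p y)) \<longlongrightarrow> exp (- 1) * (0 + p * 0)) at_top"
    by (intro tendsto_intros abs_powr_exp_tendsto_0 exp_tail_tendsto_0 p)
  then have G0: "(G \<longlongrightarrow> 0) at_top" by (simp add: G_def[abs_def])
  have "filterlim (\<lambda>u::real. - ln u) at_top (at_right 0)"
    using ln_at_0 by (simp add: filterlim_uminus_at_top)
  then have "filterlim (\<lambda>u::real. - 1 + - ln u) at_top (at_right 0)"
    by (rule filterlim_tendsto_add_at_top[OF tendsto_const])
  moreover have "(\<lambda>u::real. - 1 + - ln u) = (\<lambda>u. - ln u - 1)" by auto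
  ultimately have "filterlim (\<lambda>u::real. - ln u - 1) at_top (at_right 0)" by (simp only:)
  from filterlim_compose[OF G0 this] have 0: "(F \<longlongrightarrow> 0) (at_right 0)" by (simp add: F_def[abs_def])
  have "isCont F 1" using DERIV_isCont[OF D] by simp
  then have 1: "(F \<longlongrightarrow> F 1) (at_left 1)" by (simp add: isCont_def filterlim_at_split)
  have c: "isCont (\<lambda>u. \<bar>- ln u - 1\<bar> powr p) x" if "0 < x" for x
  proof -
    have "isCont (\<lambda>v. \<bar>v\<bar> powr p) (- ln x - 1)" by (rule DERIV_isCont[OF DERIV_abs_powr[OF p(1)]])
    moreover have "isCont (\<lambda>u. - ln u - 1) x" using that by (intro continuous_intros) auto
    ultimately show ?thesis using isCont_o2[of x "\<lambda>u. - ln u - 1" "\<lambda>v. \<bar>v\<bar> powr p"] by simp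
  qed
  show "set_integrable lebesgue {0<..<1} (\<lambda>u. \<bar>- ln u - 1\<bar> powr p)"
    by (rule FTC_nonneg_Ioo_0_1(1)[OF D c _ 0 1]) auto
  have "(LINT u:{0<..<1}|lebesgue. \<bar>- ln u - 1\<bar> powr p) = F 1 - 0"
    by (rule FTC_nonneg_Ioo_0_1(2)[OF D c _ 0 1]) auto
  then show "(LINT u:{0<..<1}|lebesgue. \<bar>- ln u - 1\<bar> powr p) = log_osc p"
    by (simp add: F_def G_def log_osc_def exp_minus field_simps)
qed

lemma not_AE_notin_Ioo_0_1: "\<not> (AE u in lebesgue. u \<notin> {0<..<1::real})"
proof
  assume "AE u in lebesgue. u \<notin> {0<..<1::real}"
  then have "emeasure lebesgue {0<..<1::real} = 0"
  proof (subst AE_iff_measurable[symmetric, where P = "\<lambda>u. u \<notin> {0<..<1::real}"])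
    show "{u \<in> space lebesgue. \<not> u \<notin> {0<..<1::real}} = {0<..<1}" by auto
  qed auto
  then show False by simp
qed

lemma ex_nonneg_of_integral_nonneg:
  fixes r :: "real \<Rightarrow> real"
  assumes r: "set_integrable lebesgue {0<..<1} r" and 0: "0 \<le> (LINT u:{0<..<1}|lebesgue. r u)"
  shows "\<exists>u\<in>{0<..<1}. 0 \<le> r u"
proof (rule ccontr)
  assume "\<not> ?thesis"
  then have neg: "r u < 0" if "u \<in> {0<..<1}" for u using that by (meson not_le)
  define s where "s u = - (indicator {0<..<1} u *\<^sub>R r u)" for u
  have s: "integrable lebesgue s" using r unfolding s_def set_integrable_def by (rule integrable_minus)
  have s0: "0 \<le> s u" for u using neg[of u] by (auto simp: s_def split: split_indicator)
  have "(LINT u|lebesgue. s u) = - (LINT u:{0<..<1}|lebesgue. r u)"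
    unfolding s_def set_lebesgue_integral_def by simp
  moreover have "0 \<le> (LINT u|lebesgue. s u)" by (rule integral_nonneg_AE) (use s0 in auto)
  ultimately have "(LINT u|lebesgue. s u) = 0" using 0 by linarith
  then have "AE u in lebesgue. s u = 0" using integral_nonneg_eq_0_iff_AE[OF s] s0 by auto
  then have "AE u in lebesgue. u \<notin> {0<..<1::real}"
    by eventually_elim (use neg in \<open>force simp: s_def split: split_indicator_asm\<close>)
  then show False using not_AE_notin_Ioo_0_1 by contradiction
qed

text \<open>Mean-zero functions \<open>x\<close> and \<open>r\<close> that are both nonincreasing satisfy
  \<open>\<integral> signed_powr (p - 1) x * r \<ge> 0\<close>, so adding \<open>r\<close> to \<open>x\<close> cannot decrease the \<open>p\<close>-th moment.\<close>

lemma comonotone_powr_le: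
  fixes x r :: "real \<Rightarrow> real"
  assumes p: "1 < p"
    and x: "\<And>s t. 0 < s \<Longrightarrow> s \<le> t \<Longrightarrow> t < 1 \<Longrightarrow> x t \<le> x s"
    and r: "\<And>s t. 0 < s \<Longrightarrow> s \<le> t \<Longrightarrow> t < 1 \<Longrightarrow> r t \<le> r s" "continuous_on {0<..<1} r"
      "set_integrable lebesgue {0<..<1} r" "(LINT u:{0<..<1}|lebesgue. r u) = 0"
  obtains k where "\<And>u. u \<in> {0<..<1} \<Longrightarrow> \<bar>x u\<bar> powr p \<le> \<bar>x u + r u\<bar> powr p - k * r u"
proof -
  obtain u1 where u1: "u1 \<in> {0<..<1}" "0 \<le> r u1"
    using ex_nonneg_of_integral_nonneg[OF r(3)] r(4) by auto
  have i: "set_integrable lebesgue {0<..<1} (\<lambda>u. - r u)" using r(3) by (simp add: set_integrable_def)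
  have "(LINT u:{0<..<1}|lebesgue. - r u) = 0" using set_integral_uminus[OF r(3)] r(4) by simp
  then obtain u2 where u2: "u2 \<in> {0<..<1}" "r u2 \<le> 0"
    using ex_nonneg_of_integral_nonneg[OF i] by auto
  obtain u0 where u0: "u0 \<in> {0<..<1}" "r u0 = 0"
  proof (cases "u1 \<le> u2")
    case True
    have "continuous_on {u1..u2} r" using u1 u2 by (intro continuous_on_subset[OF r(2)]) auto
    then obtain u where "u1 \<le> u" "u \<le> u2" "r u = 0" using IVT2'[of r u2 0 u1] u1 u2 True by auto
    then show ?thesis using that[of u] u1 u2 by auto
  next
    case False
    then have "r u1 \<le> r u2" using r(1)[of u2 u1] u1 u2 by auto
    then show ?thesis using that[of u1] u1 u2 by auto
  qed
  \<comment> \<open>Chebyshev's argument in pointwise form: r changes sign at \<open>u0\<close>, and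
    by monotonicity \<open>signed_powr (p - 1) (x u)\<close> minus its value at \<open>u0\<close>
    has a nonnegative product with \<open>r u\<close>. The remaining multiple of \<open>r u\<close>
    integrates to 0.\<close>
  show ?thesis
  proof (rule that[of "p * signed_powr (p - 1) (x u0)"])
    fix u :: real assume u: "u \<in> {0<..<1}"
    have "convex_on UNIV (\<lambda>v::real. \<bar>v\<bar> powr p)"
      by (rule convex_on_realI[of _ _ "\<lambda>v. p * signed_powr (p - 1) v"])
         (use p mono_signed_powr[of "p - 1"] in \<open>auto intro!: DERIV_abs_powr\<close>)
    from convex_on_imp_above_tangent[OF this, of "x u" "x u + r u" "p * signed_powr (p - 1) (x u)"]
    have 1: "\<bar>x u\<bar> powr p + p * signed_powr (p - 1) (x u) * r u \<le> \<bar>x u + r u\<bar> powr p"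
      using DERIV_abs_powr[OF p, of "x u"] by simp
    have "0 \<le> (signed_powr (p - 1) (x u) - signed_powr (p - 1) (x u0)) * r u"
    proof (cases "u \<le> u0")
      case True
      then have "0 \<le> r u" "x u0 \<le> x u" using r(1)[of u u0] x[of u u0] u u0 by auto
      then show ?thesis using mono_signed_powr[of "p - 1" "x u0" "x u"] p by simp
    next
      case False
      then have "r u \<le> 0" "x u \<le> x u0" using r(1)[of u0 u] x[of u0 u] u u0 by auto
      then show ?thesis using mono_signed_powr[of "p - 1" "x u" "x u0"] p by (simp add: mult_nonpos_nonpos)
    qed
    then have "p * signed_powr (p - 1) (x u0) * r u \<le> p * signed_powr (p - 1) (x u) * r u"
      using p by (simp add: algebra_simps)
    then show "\<bar>x u\<bar> powr p \<le> \<bar>x u + r u\<bar> powr p - p * signed_powr (p - 1) (x u0) * r u"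
      using 1 by linarith
  qed
qed

text \<open>An affine substitution has moved the interval to (0, 1). The difference \<open>r\<close>
  between \<open>- ln u - 1\<close> and the centred function \<open>x\<close> is
  \<open>ln (c / u + (d - c))\<close> up to a constant. It is nonincreasing because c \<ge> 0, as is
  \<open>x\<close>, so the comonotone comparison applies: intervals starting at 0 have the largest
  oscillation.\<close>

lemma minus_ln_affine_osc:
  fixes c d :: real
  assumes p: "1 < p" "p \<le> 2" and cd: "0 \<le> c" "c < d" "d \<le> 1"
  defines "X \<equiv> \<lambda>u. - ln (c + (d - c) * u)"
  defines "\<nu> \<equiv> (LINT u:{0<..<1}|lebesgue. X u)"
  shows "set_integrable lebesgue {0<..<1} X"
    "set_integrable lebesgue {0<..<1} (\<lambda>u. \<bar>X u - \<nu>\<bar> powr p)"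
    "(LINT u:{0<..<1}|lebesgue. \<bar>X u - \<nu>\<bar> powr p) \<le> log_osc p"
proof -
  have pos: "0 < c + (d - c) * u" "c + (d - c) * u < d" if "u \<in> {0<..<1}" for u
  proof -
    show "0 < c + (d - c) * u" using cd that by (simp add: add_nonneg_pos)
    have "(d - c) * u < (d - c) * 1" using cd that by (intro mult_strict_left_mono) auto
    then show "c + (d - c) * u < d" by simp
  qed
  have contX: "continuous_on {0<..<1} X"
    unfolding X_def using pos by (intro continuous_intros) (auto simp: less_le)
  have meas: "set_borel_measurable lebesgue {0<..<1} g" if "continuous_on {0<..<1} g" for g :: "real \<Rightarrow> real"
  proof -
    have "(\<lambda>u. indicator {0<..<1} u *\<^sub>R g u) \<in> borel_measurable borel"
      using borel_measurable_continuous_on_indicator[OF _ that] by simp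
    then show ?thesis unfolding set_borel_measurable_def
      using measurable_completion by (metis lborel_def measurable_lborel2)
  qed
  have const: "set_integrable lebesgue {0<..<1::real} (\<lambda>u. k)" "(LINT u:{0<..<1::real}|lebesgue. k) = k" for k :: real
  proof -
    have "integrable lebesgue (indicat_real {0<..<1::real})" by (rule integrable_real_indicator) auto
    then show "set_integrable lebesgue {0<..<1::real} (\<lambda>u. k)" "(LINT u:{0<..<1::real}|lebesgue. k) = k"
      by (simp_all add: set_integrable_def set_lebesgue_integral_def)
  qed
  show intX: "set_integrable lebesgue {0<..<1} X"
  proof (rule set_integrable_bound[OF set_integral_add(1)[OF const(1)[of "- ln (d - c)"] minus_ln_integral(1)] meas[OF contX]])
    show "AE u in lebesgue. u \<in> {0<..<1} \<longrightarrow> norm (X u) \<le> norm (- ln (d - c) + - ln u)"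
    proof (rule AE_I2, rule impI)
      fix u :: real assume u: "u \<in> {0<..<1}"
      have "0 \<le> X u" unfolding X_def using pos[OF u] cd by (simp add: ln_le_zero_iff)
      moreover have "ln ((d - c) * u) \<le> ln (c + (d - c) * u)" using u cd by (intro ln_mono) auto
      then have "X u \<le> - ln (d - c) + - ln u" unfolding X_def using u cd by (simp add: ln_mult)
      ultimately show "norm (X u) \<le> norm (- ln (d - c) + - ln u)" by simp
    qed
  qed
  define x where "x u = X u - \<nu>" for u
  define r where "r u = (- ln u - 1) - x u" for u
  have intr: "set_integrable lebesgue {0<..<1} r"
    unfolding r_def x_def by (intro set_integral_diff minus_ln_integral(1) const(1) intX)
  have r0: "(LINT u:{0<..<1}|lebesgue. r u) = 0"
    unfolding r_def x_def
    unfolding set_integral_diff(2)[OF set_integral_diff(1)[OF minus_ln_integral(1) const(1)] set_integral_diff(1)[OF intX const(1)]]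
      set_integral_diff(2)[OF minus_ln_integral(1) const(1)] set_integral_diff(2)[OF intX const(1)]
      const(2) minus_ln_integral(2) \<nu>_def[symmetric] by simp
  have contr: "continuous_on {0<..<1} r"
    unfolding r_def x_def using contX by (intro continuous_intros) auto
  have x_dec: "x t \<le> x s" if "0 < s" "s \<le> t" "t < 1" for s t
  proof -
    have "ln (c + (d - c) * s) \<le> ln (c + (d - c) * t)"
      using pos[of s] that cd by (intro ln_mono add_left_mono mult_left_mono) auto
    then show ?thesis by (simp add: x_def X_def)
  qed
  have r_dec: "r t \<le> r s" if st: "0 < s" "s \<le> t" "t < 1" for s t
  proof -
    have eq: "r u = ln (c / u + (d - c)) + (\<nu> - 1)" if "u \<in> {0<..<1}" for u
    proof -
      have "c / u + (d - c) = (c + (d - c) * u) / u" using that by (simp add: field_simps)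
      then have "ln (c / u + (d - c)) = ln (c + (d - c) * u) - ln u"
        using that pos[OF that] by (simp add: ln_div)
      then show ?thesis by (simp add: r_def x_def X_def)
    qed
    have "c / t \<le> c / s" using st cd by (intro divide_left_mono) auto
    moreover have "0 < c / t + (d - c)" using st cd by (intro add_nonneg_pos) auto
    ultimately have "ln (c / t + (d - c)) \<le> ln (c / s + (d - c))" by (intro ln_mono) auto
    then show ?thesis using eq[of t] eq[of s] st by simp
  qed
  obtain k where k: "\<And>u. u \<in> {0<..<1} \<Longrightarrow> \<bar>x u\<bar> powr p \<le> \<bar>x u + r u\<bar> powr p - k * r u"
    using comonotone_powr_le[where x = x and r = r, OF p(1) x_dec r_dec contr intr r0] by blast
  then have k': "\<bar>x u\<bar> powr p \<le> \<bar>- ln u - 1\<bar> powr p - k * r u" if "u \<in> {0<..<1}" for u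
    using k[OF that] by (simp add: r_def)
  have intk: "set_integrable lebesgue {0<..<1} (\<lambda>u. k * r u)" using intr by simp
  have intR: "set_integrable lebesgue {0<..<1} (\<lambda>u. \<bar>- ln u - 1\<bar> powr p - k * r u)"
    by (rule set_integral_diff(1)[OF log_osc_integral(1)[OF p] intk])
  have intx: "set_integrable lebesgue {0<..<1} (\<lambda>u. \<bar>x u\<bar> powr p)"
  proof (rule set_integrable_bound[OF intR meas])
    show "continuous_on {0<..<1} (\<lambda>u. \<bar>x u\<bar> powr p)"
      using contX p unfolding x_def by (intro continuous_on_powr' continuous_intros) auto
    show "AE u in lebesgue. u \<in> {0<..<1} \<longrightarrow> norm (\<bar>x u\<bar> powr p) \<le> norm (\<bar>- ln u - 1\<bar> powr p - k * r u)"
    proof (rule AE_I2, rule impI)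
      fix u :: real assume "u \<in> {0<..<1}"
      from k'[OF this] show "norm (\<bar>x u\<bar> powr p) \<le> norm (\<bar>- ln u - 1\<bar> powr p - k * r u)"
        by (simp add: abs_le_iff order_trans[OF powr_ge_zero])
    qed
  qed
  have "(LINT u:{0<..<1}|lebesgue. \<bar>x u\<bar> powr p) \<le> (LINT u:{0<..<1}|lebesgue. \<bar>- ln u - 1\<bar> powr p - k * r u)"
    by (rule set_integral_mono[OF intx intR k'])
  also have "\<dots> = log_osc p"
    by (simp add: set_integral_diff(2)[OF log_osc_integral(1)[OF p] intk] log_osc_integral(2)[OF p] r0)
  finally show "(LINT u:{0<..<1}|lebesgue. \<bar>X u - \<nu>\<bar> powr p) \<le> log_osc p" by (simp add: x_def)
  show "set_integrable lebesgue {0<..<1} (\<lambda>u. \<bar>X u - \<nu>\<bar> powr p)" using intx by (simp add: x_def)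
qed

section \<open>Averages over intervals of any kind, and the norm of the logarithm\<close>

lemma subinterval_end_points:
  assumes "J \<in> subintervals Q"
  obtains c d where "c < d" "{c<..<d} \<subseteq> J" "J \<subseteq> {c..d}"
proof -
  have J: "is_interval J" "bounded J" "interior J \<noteq> {}" using assms by (auto simp: subintervals_def)
  obtain x e where x: "0 < e" "cball x e \<subseteq> J" using J(3) by (auto simp: mem_interior_cball)
  have ne: "J \<noteq> {}" using x by auto
  have bdd: "bdd_below J" "bdd_above J" using J(2) by (auto intro: bounded_imp_bdd_below bounded_imp_bdd_above)
  have mem: "x - e \<in> J" "x + e \<in> J" using x by (auto intro!: subsetD[OF x(2)] simp: dist_real_def)
  show ?thesis
  proof (rule that[of "Inf J" "Sup J"])
    have "Inf J \<le> x - e" "x + e \<le> Sup J" using mem bdd by (auto intro: cInf_lower cSup_upper)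
    then show "Inf J < Sup J" using x(1) by simp
    show "J \<subseteq> {Inf J..Sup J}" using bdd by (auto intro: cInf_lower cSup_upper)
    show "{Inf J<..<Sup J} \<subseteq> J"
    proof
      fix t assume "t \<in> {Inf J<..<Sup J}"
      then obtain y z where "y \<in> J" "y < t" "z \<in> J" "t < z"
        using cInf_less_iff[OF ne bdd(1)] less_cSup_iff[OF ne bdd(2)] by auto
      then show "t \<in> J" using J(1) unfolding is_interval_1 by (meson less_imp_le)
    qed
  qed
qed

lemma Ioo_in_subintervals:
  assumes "J \<in> subintervals Q" "{u<..<v} \<subseteq> J" "u < v"
  shows "{u<..<v} \<in> subintervals Q"
  using assms by (auto simp: subintervals_def is_interval_oo)

context
  fixes J :: "real set" and c d :: real
  assumes J: "c < d" "{c<..<d} \<subseteq> J" "J \<subseteq> {c..d}"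
begin

lemma AE_interval_iff: "AE t in lebesgue. t \<in> J \<longleftrightarrow> t \<in> {c<..<d}"
proof -
  have "{c, d} \<in> null_sets lebesgue" by (simp add: negligible_iff_null_sets[symmetric])
  from AE_not_in[OF this] show ?thesis by eventually_elim (use J in force)
qed

lemma interval_sets: "J \<in> sets lebesgue"
proof -
  have "J = {c<..<d} \<union> (J \<inter> {c, d})" using J by force
  moreover have "J \<inter> {c, d} \<in> sets lebesgue" by (intro negligible_imp_sets negligible_finite) auto
  ultimately show ?thesis by (metis lmeasurable_box sets.Un fmeasurableD box_real(1))
qed

lemma emeasure_interval: "emeasure lebesgue J = ennreal (d - c)"
proof -
  have "emeasure lebesgue J = emeasure lebesgue {c<..<d}"
    by (rule emeasure_eq_AE[OF AE_interval_iff interval_sets]) auto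
  then show ?thesis using J by simp
qed

lemma measure_interval: "measure lebesgue J = d - c"
  using emeasure_interval J(1) by (simp add: measure_def)

lemma set_integral_interval: "set_integrable lebesgue {c<..<d} f \<Longrightarrow>
    (LINT t:J|lebesgue. f t) = (LINT t:{c<..<d}|lebesgue. f t)" for f :: "real \<Rightarrow> real"
proof -
  assume f: "set_integrable lebesgue {c<..<d} f"
  have neg: "negligible {x \<in> {c<..<d} - J. f x \<noteq> 0}" "negligible {x \<in> J - {c<..<d}. f x \<noteq> 0}"
    by (rule negligible_subset[of "{c, d}"]; use J in force)+
  have fJ: "set_integrable lebesgue J f" by (rule absolutely_integrable_spike_set[OF f neg])
  have "integral J f = integral {c<..<d} f" by (rule integral_spike_set) (use neg in auto)
  then show ?thesis using f fJ by (simp add: set_lebesgue_integral_eq_integral)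
qed

lemma nn_avg_interval: "nn_avg J f = (\<integral>\<^sup>+t\<in>{c<..<d}. f t \<partial>lebesgue) / ennreal (d - c)"
proof -
  have "(\<integral>\<^sup>+t\<in>J. f t \<partial>lebesgue) = (\<integral>\<^sup>+t\<in>{c<..<d}. f t \<partial>lebesgue)"
    using AE_interval_iff by (intro nn_integral_cong_AE) (auto elim!: eventually_mono split: split_indicator)
  then show ?thesis by (simp add: nn_avg_def emeasure_interval)
qed

lemma avg_interval:
  "set_integrable lebesgue {c<..<d} f \<Longrightarrow> avg J f = (LINT t:{c<..<d}|lebesgue. f t) / (d - c)"
  by (simp add: avg_def set_integral_interval measure_interval)

end

lemma epowr_le:
  assumes "0 < a" "0 \<le> L" "x \<le> ennreal L"
  shows "epowr x a \<le> ennreal (L powr a)"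
proof -
  have "x \<noteq> \<infinity>" using assms(3) by (auto simp: top_unique)
  moreover have "enn2real x \<le> L" using assms by (metis enn2real_ennreal enn2real_mono ennreal_less_top)
  ultimately show ?thesis using assms by (auto simp: epowr_def intro!: ennreal_leI powr_mono2)
qed

lemma minus_ln_bmo_norm_le:
  assumes p: "1 < p" "p \<le> 2"
  shows "bmo_norm p {0<..<1} (\<lambda>t. - ln t) \<le> ennreal (log_osc p powr (1 / p))"
  unfolding bmo_norm_def
proof (rule SUP_least)
  fix J :: "real set" assume JQ: "J \<in> subintervals {0<..<1}"
  obtain c d where J: "c < d" "{c<..<d} \<subseteq> J" "J \<subseteq> {c..d}" by (rule subinterval_end_points[OF JQ])
  have JQ': "J \<subseteq> {0<..<1}" using JQ by (auto simp: subintervals_def)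
  have cd: "0 \<le> c" "d \<le> 1"
  proof -
    have "{c<..<d} \<subseteq> {0<..<1}" using J JQ' by auto
    then have "closure {c<..<d} \<subseteq> closure {0<..<1}" by (rule closure_mono)
    then show "0 \<le> c" "d \<le> 1" using J(1) by auto
  qed
  have sub: "{c<..<d} \<subseteq> {0<..<1}" using cd by auto
  define X where "X u = - ln (c + (d - c) * u)" for u
  define \<nu> where "\<nu> = (LINT u:{0<..<1}|lebesgue. X u)"
  note osc = minus_ln_affine_osc[OF p cd(1) J(1) cd(2), folded X_def, folded \<nu>_def]
  have iff: "c + (d - c) * u \<in> {c<..<d} \<longleftrightarrow> u \<in> {0<..<1}" for u
  proof -
    have "c + (d - c) * u < d \<longleftrightarrow> (d - c) * u < (d - c) * 1" by auto
    then have 1: "c + (d - c) * u < d \<longleftrightarrow> u < 1" using J(1) by (simp only: mult_less_cancel_left_pos diff_gt_0_iff_gt)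
    have 2: "c < c + (d - c) * u \<longleftrightarrow> 0 < u" using J(1) by (simp add: zero_less_mult_iff)
    show ?thesis by (simp only: greaterThanLessThan_iff 1 2)
  qed
  have int: "set_integrable lebesgue {c<..<d} (\<lambda>t::real. - ln t)"
    by (rule set_integrable_subset[OF minus_ln_integral(1) _ sub]) simp
  have "(LINT t:{c<..<d}|lebesgue. - ln t) = (LINT t|lborel. indicator {c<..<d} t *\<^sub>R - ln t)"
    unfolding set_lebesgue_integral_def by (rule integral_completion) simp
  also have "\<dots> = (d - c) * (LINT u|lborel. indicator {c<..<d} (c + (d - c) * u) *\<^sub>R - ln (c + (d - c) * u))"
    using J(1) lborel_integral_real_affine[of "d - c" "\<lambda>t. indicator {c<..<d} t *\<^sub>R - ln t" c] by simp
  also have "(\<lambda>u. indicator {c<..<d} (c + (d - c) * u) *\<^sub>R - ln (c + (d - c) * u)) = (\<lambda>u. indicator {0<..<1} u *\<^sub>R X u)"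
    using iff by (auto simp: X_def fun_eq_iff indicator_def)
  also have "(LINT u|lborel. indicator {0<..<1} u *\<^sub>R X u) = \<nu>"
    unfolding \<nu>_def set_lebesgue_integral_def by (rule integral_completion[symmetric]) (simp add: X_def)
  finally have avg: "avg J (\<lambda>t. - ln t) = \<nu>" using avg_interval[OF J int] J(1) by simp
  have "(\<integral>\<^sup>+t\<in>{c<..<d}. ennreal (\<bar>- ln t - \<nu>\<bar> powr p) \<partial>lebesgue)
     = (\<integral>\<^sup>+t. ennreal (\<bar>- ln t - \<nu>\<bar> powr p) * indicator {c<..<d} t \<partial>lborel)"
    by (rule nn_integral_completion)
  also have "\<dots> = ennreal (d - c) * (\<integral>\<^sup>+u. ennreal (\<bar>- ln (c + (d - c) * u) - \<nu>\<bar> powr p) * indicator {c<..<d} (c + (d - c) * u) \<partial>lborel)"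
    using J(1) nn_integral_real_affine[of "\<lambda>t. ennreal (\<bar>- ln t - \<nu>\<bar> powr p) * indicator {c<..<d} t" "d - c" c] by simp
  also have "(\<lambda>u. ennreal (\<bar>- ln (c + (d - c) * u) - \<nu>\<bar> powr p) * indicator {c<..<d} (c + (d - c) * u))
     = (\<lambda>u. ennreal (indicator {0<..<1} u *\<^sub>R (\<bar>X u - \<nu>\<bar> powr p)))"
    using iff by (auto simp: X_def fun_eq_iff indicator_def)
  also have "(\<integral>\<^sup>+u. ennreal (indicator {0<..<1} u *\<^sub>R (\<bar>X u - \<nu>\<bar> powr p)) \<partial>lborel)
     = (\<integral>\<^sup>+u. ennreal (indicator {0<..<1} u *\<^sub>R (\<bar>X u - \<nu>\<bar> powr p)) \<partial>lebesgue)"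
    by (rule nn_integral_completion[symmetric])
  also have "\<dots> = ennreal (LINT u:{0<..<1}|lebesgue. \<bar>X u - \<nu>\<bar> powr p)"
    unfolding set_lebesgue_integral_def using osc(2) unfolding set_integrable_def
    by (intro nn_integral_eq_integral) auto
  finally have "nn_avg J (\<lambda>t. ennreal (\<bar>- ln t - \<nu>\<bar> powr p))
      = ennreal (d - c) * ennreal (LINT u:{0<..<1}|lebesgue. \<bar>X u - \<nu>\<bar> powr p) / ennreal (d - c)"
    by (simp add: nn_avg_interval[OF J])
  also have "\<dots> = ennreal (LINT u:{0<..<1}|lebesgue. \<bar>X u - \<nu>\<bar> powr p)"
    using J(1) by (simp add: ennreal_mult_divide_eq mult.commute[of "ennreal (d - c)"])
  also have "\<dots> \<le> ennreal (log_osc p)" by (rule ennreal_leI[OF osc(3)])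
  finally show "epowr (nn_avg J (\<lambda>t. ennreal (\<bar>- ln t - avg J (\<lambda>t. - ln t)\<bar> powr p))) (1 / p)
      \<le> ennreal (log_osc p powr (1 / p))"
    unfolding avg using p log_osc_integral(2)[OF p]
    by (intro epowr_le) (auto simp: set_lebesgue_integral_def intro!: integral_nonneg_AE simp flip: log_osc_integral(2)[OF p])
qed

lemma nn_integral_inverse_Ioo: "(\<integral>\<^sup>+t\<in>{0<..<1}. ennreal (exp (- ln t)) \<partial>lebesgue) = \<infinity>"
proof (rule ccontr)
  assume "\<not> ?thesis"
  then obtain m where m: "0 \<le> m" "(\<integral>\<^sup>+t\<in>{0<..<1}. ennreal (exp (- ln t)) \<partial>lebesgue) = ennreal m"
    by (metis ennreal_cases infinity_ennreal_def)
  \<comment> \<open>With this cut-off the integral of 1 / t over \<open>{\<delta>..1}\<close> is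
    \<open>m + 1\<close>, more than the supposed finite value.\<close>
  define \<delta> where "\<delta> = exp (- (m + 1))"
  have \<delta>: "0 < \<delta>" "\<delta> \<le> 1" using m by (auto simp: \<delta>_def)
  have "(\<integral>\<^sup>+t. ennreal (1 / t) * indicator {\<delta>..1} t \<partial>lborel) = ennreal (ln 1 - ln \<delta>)"
    using \<delta> by (intro nn_integral_FTC_Icc) (auto intro!: derivative_eq_intros)
  then have "ennreal (m + 1) = (\<integral>\<^sup>+t. ennreal (1 / t) * indicator {\<delta>..1} t \<partial>lebesgue)"
    by (simp add: \<delta>_def nn_integral_completion add.commute)
  also have "\<dots> \<le> (\<integral>\<^sup>+t\<in>{0<..<1}. ennreal (exp (- ln t)) \<partial>lebesgue)"
  proof (rule nn_integral_mono_AE)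
    have "{1::real} \<in> null_sets lebesgue" by (simp add: negligible_iff_null_sets[symmetric])
    from AE_not_in[OF this]
    show "AE t in lebesgue. ennreal (1 / t) * indicator {\<delta>..1} t \<le> ennreal (exp (- ln t)) * indicator {0<..<1} t"
      by eventually_elim (use \<delta> in \<open>auto simp: exp_minus divide_inverse split: split_indicator\<close>)
  qed
  also have "\<dots> = ennreal m" by (rule m(2))
  finally show False using m(1) by (simp add: ennreal_le_iff)
qed

lemma JN_constant_le:
  assumes p: "1 < p" "p \<le> 2"
  shows "JN_constant p \<le> log_osc p powr (1 / p)"
proof -
  define N where "N = log_osc p powr (1 / p)"
  have N0: "0 \<le> N" by (simp add: N_def)
  let ?\<phi> = "\<lambda>t::real. - ln t"
  have loc: "locally_integrable_on ?\<phi> {0<..<1}"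
    unfolding locally_integrable_on_def
  proof (intro allI impI)
    fix K :: "real set" assume K: "compact K \<and> K \<subseteq> {0<..<1}"
    then have "K \<in> sets lebesgue" by (simp add: borel_compact lborelD)
    then show "set_integrable lebesgue K ?\<phi>" using K by (intro set_integrable_subset[OF minus_ln_integral(1)]) auto
  qed
  have norm: "bmo_norm p {0<..<1} ?\<phi> \<le> ennreal N" unfolding N_def by (rule minus_ln_bmo_norm_le[OF p])
  have BMO: "?\<phi> \<in> BMO p {0<..<1}"
    unfolding BMO_def using loc norm by (auto simp: less_top top_unique intro: le_less_trans)
  have J: "{0<..<1::real} \<in> subintervals {0<..<1}" by (simp add: subintervals_def is_interval_oo)
  have top: "nn_avg {0<..<1} (\<lambda>t. ennreal (exp (- ln t))) = \<infinity>"
    unfolding nn_avg_def nn_integral_inverse_Ioo by (simp add: ennreal_top_divide)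
  have "exp_const N p = \<infinity>"
  proof -
    have "\<infinity> \<le> C" if "1 \<le> C \<and> (\<forall>\<phi>\<in>BMO p {0<..<1}. bmo_norm p {0<..<1} \<phi> \<le> ennreal N \<longrightarrow>
        (\<forall>J\<in>subintervals {0<..<1}. nn_avg J (\<lambda>t. ennreal (exp (\<phi> t))) \<le> C * ennreal (exp (avg J \<phi>))))" for C
    proof -
      have "\<infinity> \<le> C * ennreal (exp (avg {0<..<1} ?\<phi>))" using that BMO norm J top by fastforce
      then show ?thesis by (auto simp: top_unique ennreal_mult_eq_top_iff)
    qed
    then have "\<infinity> \<le> exp_const N p" unfolding exp_const_def by (intro Inf_greatest) blast
    then show ?thesis by (simp add: top_unique)
  qed
  \<comment> \<open>If e were larger than \<open>N\<close>, then \<open>N\<close> itself would be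
    among the tested values of \<epsilon>, and \<open>exp_const N p\<close> would be finite.\<close>
  then have le: "e \<le> N" if "0 \<le> e \<and> (\<forall>\<epsilon>. 0 \<le> \<epsilon> \<and> \<epsilon> < e \<longrightarrow> exp_const \<epsilon> p < \<infinity>)" for e
    using that N0 by (metis less_irrefl not_le)
  show ?thesis unfolding JN_constant_def N_def[symmetric]
    by (rule cSup_least) (use le in \<open>auto intro!: exI[of _ 0]\<close>)
qed

section \<open>The weak-type inequality\<close>

text \<open>The nonnegative integrand vanishes on (0, 1) only at \<open>exp (- 1)\<close>, so its
  integral is not 0.\<close>

lemma log_osc_pos:
  assumes p: "1 < p" "p \<le> 2"
  shows "0 < log_osc p"
proof -
  have nn: "0 \<le> (LINT u:{0<..<1}|lebesgue. \<bar>- ln u - 1\<bar> powr p)"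
    unfolding set_lebesgue_integral_def by (rule integral_nonneg_AE) auto
  define f where "f u = indicator {0<..<1} u *\<^sub>R (\<bar>- ln u - 1\<bar> powr p)" for u :: real
  have f: "integrable lebesgue f" using log_osc_integral(1)[OF p] by (simp add: set_integrable_def f_def[abs_def])
  have "log_osc p \<noteq> 0"
  proof
    assume "log_osc p = 0"
    then have "(LINT u|lebesgue. f u) = 0"
      using log_osc_integral(2)[OF p] by (simp add: set_lebesgue_integral_def f_def[abs_def])
    moreover have "AE u in lebesgue. 0 \<le> f u" by (simp add: f_def)
    ultimately have "AE u in lebesgue. f u = 0" using integral_nonneg_eq_0_iff_AE[OF f] by blast
    moreover have "AE u in lebesgue. u \<notin> {exp (- 1)}"
      by (rule AE_not_in) (simp add: negligible_iff_null_sets[symmetric])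
    ultimately have "AE u in lebesgue. u \<notin> {0<..<1::real}"
    proof eventually_elim
      case (elim u)
      show ?case
      proof
        assume u: "u \<in> {0<..<1}"
        then have "- ln u - 1 = 0" using elim(1) by (simp add: f_def)
        then have "u = exp (- 1)" using u by (metis add.inverse_inverse exp_ln greaterThanLessThan_iff right_minus_eq)
        then show False using elim(2) by simp
      qed
    qed
    then show False using not_AE_notin_Ioo_0_1 by contradiction
  qed
  then show ?thesis using nn log_osc_integral(2)[OF p] by simp
qed

context osc_bounded begin

text \<open>Applied with the factor - 1 to reach the lower tail, and with a positive factor to
  normalise the oscillation.\<close>

lemma osc_bounded_cmult:
  assumes p: "0 < p" and B: "0 \<le> B" and \<tau>: "\<tau> \<noteq> 0"
  shows "osc_bounded p (\<bar>\<tau>\<bar> * B) c d (\<lambda>t. \<tau> * \<phi> t)"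
proof
  have eq: "\<bar>\<tau> * \<phi> t - \<kappa>\<bar> powr p = \<bar>\<tau>\<bar> powr p * \<bar>\<phi> t - \<kappa> / \<tau>\<bar> powr p" for t \<kappa>
  proof -
    have "\<tau> * \<phi> t - \<kappa> = \<tau> * (\<phi> t - \<kappa> / \<tau>)" using \<tau> by (simp add: field_simps)
    then show ?thesis by (simp only: abs_mult powr_mult abs_ge_zero)
  qed
  show "c < d" by (rule cd)
  show "set_integrable lebesgue {c<..<d} (\<lambda>t. \<tau> * \<phi> t)" using integrable by simp
  show "set_integrable lebesgue {c<..<d} (\<lambda>t. \<bar>\<tau> * \<phi> t - \<kappa>\<bar> powr p)" for \<kappa>
    unfolding eq by (intro set_integrable_mult_right integrable_powr)
  fix u v assume uv: "c \<le> u" "u < v" "v \<le> d"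
  have "(LINT t:{u<..<v}|lebesgue. \<bar>\<tau> * \<phi> t - (LINT t:{u<..<v}|lebesgue. \<tau> * \<phi> t) / (v - u)\<bar> powr p)
    = \<bar>\<tau>\<bar> powr p * (LINT t:{u<..<v}|lebesgue. \<bar>\<phi> t - (LINT t:{u<..<v}|lebesgue. \<phi> t) / (v - u)\<bar> powr p)"
    unfolding eq set_integral_mult_right using \<tau> by simp
  also have "\<dots> \<le> \<bar>\<tau>\<bar> powr p * (B powr p * (v - u))"
    by (intro mult_left_mono osc uv) simp
  also have "\<dots> = (\<bar>\<tau>\<bar> * B) powr p * (v - u)" using B by (simp add: powr_mult)
  finally show "(LINT t:{u<..<v}|lebesgue. \<bar>\<tau> * \<phi> t - (LINT t:{u<..<v}|lebesgue. \<tau> * \<phi> t) / (v - u)\<bar> powr p)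
    \<le> (\<bar>\<tau>\<bar> * B) powr p * (v - u)" .
qed

lemma mean_cmult:
  assumes "osc_bounded p B' c d (\<lambda>t. \<tau> * \<phi> t)"
  shows "osc_bounded.mean c d (\<lambda>t. \<tau> * \<phi> t) = \<tau> * mean"
  unfolding osc_bounded.mean_def[OF assms] mean_def by simp

lemma deviation_sets: "{t \<in> {c<..<d}. l < \<bar>\<phi> t - mean\<bar>} \<in> sets lebesgue"
proof -
  have "\<phi> -` {v. l < \<bar>v - mean\<bar>} \<inter> {c<..<d} \<in> sets lebesgue"
  proof (rule set_borel_measurable_sets)
    show "set_borel_measurable lebesgue {c<..<d} \<phi>"
      using measurable_compose_phi[OF continuous_on_id, of "{c<..<d}"] by simp
    show "{v. l < \<bar>v - mean\<bar>} \<in> sets borel" by measurable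
  qed simp
  moreover have "\<phi> -` {v. l < \<bar>v - mean\<bar>} \<inter> {c<..<d} = {t \<in> {c<..<d}. l < \<bar>\<phi> t - mean\<bar>}" by auto
  ultimately show ?thesis by simp
qed

theorem two_sided_tail:
  assumes p: "1 < p" "p \<le> 2" and a: "0 < a" "2 - p \<le> a" "a < 1"
    and B: "0 < B" "B powr p < a powr p * log_osc p" and l: "0 < l"
  shows "measure lebesgue {t \<in> {c<..<d}. l < \<bar>\<phi> t - mean\<bar>}
    \<le> (d - c) * ((1 - a) powr (- (1 / a)) * exp (- (l / a)))"
proof -
  interpret neg: osc_bounded p B c d "\<lambda>t. - 1 * \<phi> t"
    using osc_bounded_cmult[of "- 1"] p B by simp
  have nm: "neg.mean = - mean" using mean_cmult[OF neg.osc_bounded_axioms] by (simp only: mult_minus1)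
  have K: "(1 - a) powr (- (1 / a)) * exp (- (l / a)) = exp ((- ln (1 - a) - l) / a)"
    using a by (simp add: powr_def exp_add[symmetric] diff_divide_distrib)
  let ?U = "{t \<in> {c<..<d}. mean + l < \<phi> t}" and ?L = "{t \<in> {c<..<d}. neg.mean + l < - 1 * \<phi> t}"
  have sets: "?U \<in> sets lebesgue" "?L \<in> sets lebesgue" by (rule superlevel_sets neg.superlevel_sets)+
  have eq: "{t \<in> {c<..<d}. l < \<bar>\<phi> t - mean\<bar>} = ?U \<union> ?L" unfolding nm by auto
  \<comment> \<open>For small l the right-hand side is at least d - c, so the bound is trivial;
    otherwise \<open>upper_tail\<close> gives half of it for each tail.\<close>
  show ?thesis
  proof (cases "l \<le> - ln (1 - a)")
    case True
    have "measure lebesgue (?U \<union> ?L) \<le> measure lebesgue {c<..<d}"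
      by (rule measure_mono_fmeasurable[OF _ sets.Un[OF sets] lmeasurable_interval(2)]) blast
    also have "\<dots> = (d - c) * 1" using cd by simp
    also have "\<dots> \<le> (d - c) * exp ((- ln (1 - a) - l) / a)"
      using True a cd by (intro mult_left_mono) auto
    finally show ?thesis unfolding eq K .
  next
    case False
    have "measure lebesgue (?U \<union> ?L) \<le> measure lebesgue ?U + measure lebesgue ?L"
      by (rule measure_Un_le[OF sets])
    moreover have "2 * measure lebesgue ?U \<le> (d - c) * exp ((- ln (1 - a) - l) / a)"
      using upper_tail[OF p a B l] False by blast
    moreover have "2 * measure lebesgue ?L \<le> (d - c) * exp ((- ln (1 - a) - l) / a)"
      using neg.upper_tail[OF p a B l] False by blast
    ultimately show ?thesis unfolding eq K by linarith
  qed
qed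

end

section \<open>Passage from the BMO norm to one interval, and the limits in the parameters\<close>

lemma le_of_epowr_le:
  assumes "0 < p" "0 \<le> N" "epowr x (1 / p) \<le> ennreal N"
  shows "x \<le> ennreal (N powr p)"
proof -
  have x: "x \<noteq> \<infinity>" using assms by (auto simp: epowr_def top_unique)
  then have "ennreal (enn2real x powr (1 / p)) \<le> ennreal N" using assms by (simp add: epowr_def)
  then have "enn2real x powr (1 / p) \<le> N" using assms by (simp add: ennreal_le_iff)
  then have "(enn2real x powr (1 / p)) powr p \<le> N powr p" using assms by (intro powr_mono2) auto
  then have "enn2real x \<le> N powr p" using assms by (simp add: powr_powr)
  then have "ennreal (enn2real x) \<le> ennreal (N powr p)" by (rule ennreal_leI)
  moreover have "ennreal (enn2real x) = x" using x by (simp add: less_top)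
  ultimately show ?thesis by (simp only:)
qed

text \<open>Until \<phi> is known to be integrable on (c, d), the number \<open>avg\<close> may be
  the default value 0. A finite norm makes \<open>\<bar>\<phi> t - \<nu>\<bar> powr p\<close>
  integrable, and whatever constant \<nu> is, this forces \<phi> to be integrable because p > 1, so
  \<open>avg\<close> is the true mean. Since c and d may lie outside Q, measurability is obtained on
  compact intervals exhausting (c, d).\<close>

lemma osc_bounded_of_BMO:
  assumes p: "1 < p" and \<phi>: "\<phi> \<in> BMO p Q" and JQ: "J \<in> subintervals Q"
    and J: "c < d" "{c<..<d} \<subseteq> J" "J \<subseteq> {c..d}"
  shows "osc_bounded p (enn2real (bmo_norm p Q \<phi>)) c d \<phi>"
proof -
  define N where "N = enn2real (bmo_norm p Q \<phi>)"
  have N: "bmo_norm p Q \<phi> = ennreal N" "0 \<le> N" using \<phi> by (auto simp: N_def BMO_def less_top)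
  have QJ: "J \<subseteq> Q" using JQ by (simp add: subintervals_def)
  define e where "e n = inverse (real (Suc n))" for n
  have epos: "0 < e n" for n by (simp add: e_def)
  have elim: "e \<longlonglongrightarrow> 0" unfolding e_def by (rule LIMSEQ_inverse_real_of_nat)
  define K where "K n = {c + e n .. d - e n}" for n
  have Kmeas: "(\<lambda>t. indicator (K n) t *\<^sub>R \<phi> t) \<in> borel_measurable lebesgue" for n
  proof -
    have "K n \<subseteq> {c<..<d}" unfolding K_def using epos[of n] by auto
    then have "K n \<subseteq> Q" using J QJ by auto
    moreover have "compact (K n)" by (simp add: K_def)
    ultimately have "set_integrable lebesgue (K n) \<phi>" using \<phi> by (auto simp: BMO_def locally_integrable_on_def)
    then show ?thesis unfolding set_integrable_def by (rule borel_measurable_integrable)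
  qed
  have lim: "(\<lambda>n. indicator (K n) t *\<^sub>R \<phi> t) \<longlonglongrightarrow> indicator {c<..<d} t *\<^sub>R \<phi> t" for t
  proof (cases "t \<in> {c<..<d}")
    case True
    have "\<forall>\<^sub>F n in sequentially. e n < min (t - c) (d - t)"
      by (rule order_tendstoD(2)[OF elim]) (use True in auto)
    then have "\<forall>\<^sub>F n in sequentially. indicator (K n) t *\<^sub>R \<phi> t = indicator {c<..<d} t *\<^sub>R \<phi> t"
      by eventually_elim (use True in \<open>auto simp: K_def split: split_indicator\<close>)
    then show ?thesis by (rule tendsto_eventually)
  next
    case False
    have "t \<notin> K n" for n using False epos[of n] unfolding K_def by auto
    then show ?thesis using False by simp
  qed
  have meas: "(\<lambda>t. indicator {c<..<d} t *\<^sub>R \<phi> t) \<in> borel_measurable lebesgue"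
    by (rule borel_measurable_LIMSEQ_metric[OF Kmeas lim])
  have meas_comp: "set_borel_measurable lebesgue {u<..<v} (\<lambda>t. f (\<phi> t))"
    if f: "continuous_on UNIV f" and uv: "c \<le> u" "v \<le> d" for f :: "real \<Rightarrow> real" and u v
  proof -
    have "(\<lambda>t. f (indicator {c<..<d} t *\<^sub>R \<phi> t)) \<in> borel_measurable lebesgue"
      by (rule measurable_compose[OF meas borel_measurable_continuous_onI[OF f]])
    then have "(\<lambda>t. indicator {u<..<v} t *\<^sub>R f (indicator {c<..<d} t *\<^sub>R \<phi> t)) \<in> borel_measurable lebesgue"
      by (intro borel_measurable_scaleR borel_measurable_indicator) auto
    moreover have "(\<lambda>t. indicator {u<..<v} t *\<^sub>R f (indicator {c<..<d} t *\<^sub>R \<phi> t)) = (\<lambda>t. indicator {u<..<v} t *\<^sub>R f (\<phi> t))"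
      using uv by (auto simp: fun_eq_iff split: split_indicator)
    ultimately show ?thesis by (simp add: set_borel_measurable_def)
  qed
  have cont: "continuous_on UNIV (\<lambda>v. \<bar>v - \<kappa>\<bar> powr p)" for \<kappa> :: real
    using p by (intro continuous_on_powr' continuous_intros) auto
  have main: "set_integrable lebesgue {u<..<v} (\<lambda>t. \<bar>\<phi> t - avg {u<..<v} \<phi>\<bar> powr p)"
    "(LINT t:{u<..<v}|lebesgue. \<bar>\<phi> t - avg {u<..<v} \<phi>\<bar> powr p) \<le> N powr p * (v - u)"
    if uv: "c \<le> u" "u < v" "v \<le> d" for u v
  proof -
    let ?g = "\<lambda>t. \<bar>\<phi> t - avg {u<..<v} \<phi>\<bar> powr p"
    have I: "{u<..<v} \<in> subintervals Q"
      by (rule Ioo_in_subintervals[OF JQ]) (use J uv in auto)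
    have "epowr (nn_avg {u<..<v} (\<lambda>t. ennreal (?g t))) (1 / p) \<le> bmo_norm p Q \<phi>"
      unfolding bmo_norm_def by (rule SUP_upper[OF I])
    then have "nn_avg {u<..<v} (\<lambda>t. ennreal (?g t)) \<le> ennreal (N powr p)"
      unfolding N(1) by (intro le_of_epowr_le) (use p N in auto)
    then have "nn_avg {u<..<v} (\<lambda>t. ennreal (?g t)) * ennreal (v - u) \<le> ennreal (N powr p) * ennreal (v - u)"
      by (rule mult_right_mono) simp
    moreover have "nn_avg {u<..<v} (\<lambda>t. ennreal (?g t)) * ennreal (v - u) = (\<integral>\<^sup>+t\<in>{u<..<v}. ennreal (?g t) \<partial>lebesgue)"
      using uv by (simp add: nn_avg_def ennreal_divide_times)
    ultimately have le: "(\<integral>\<^sup>+t\<in>{u<..<v}. ennreal (?g t) \<partial>lebesgue) \<le> ennreal (N powr p * (v - u))"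
      using uv by (simp add: ennreal_mult)
    have eq: "(\<integral>\<^sup>+t\<in>{u<..<v}. ennreal (?g t) \<partial>lebesgue) = (\<integral>\<^sup>+t. ennreal (indicator {u<..<v} t *\<^sub>R ?g t) \<partial>lebesgue)"
      by (intro nn_integral_cong) (auto split: split_indicator)
    have m: "(\<lambda>t. indicator {u<..<v} t *\<^sub>R ?g t) \<in> borel_measurable lebesgue"
      using meas_comp[OF cont uv(1,3)] by (simp add: set_borel_measurable_def)
    have "integrable lebesgue (\<lambda>t. indicator {u<..<v} t *\<^sub>R ?g t)"
      using le unfolding eq by (intro integrableI_nonneg[OF m]) (auto simp: less_top top_unique intro: le_less_trans)
    then show int: "set_integrable lebesgue {u<..<v} ?g" by (simp add: set_integrable_def)
    have "ennreal (LINT t:{u<..<v}|lebesgue. ?g t) = (\<integral>\<^sup>+t. ennreal (indicator {u<..<v} t *\<^sub>R ?g t) \<partial>lebesgue)"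
      unfolding set_lebesgue_integral_def using int unfolding set_integrable_def
      by (intro nn_integral_eq_integral[symmetric]) auto
    also have "\<dots> \<le> ennreal (N powr p * (v - u))" using le unfolding eq .
    finally show "(LINT t:{u<..<v}|lebesgue. ?g t) \<le> N powr p * (v - u)"
      using uv by (simp add: ennreal_le_iff)
  qed
  define \<nu> where "\<nu> = avg {c<..<d} \<phi>"
  note i0 = main(1)[OF order_refl J(1) order_refl, folded \<nu>_def]
  have const: "set_integrable lebesgue {c<..<d} (\<lambda>t. k :: real)" for k
    unfolding set_integrable_def using J(1) by simp
  have int: "set_integrable lebesgue {c<..<d} \<phi>"
  proof (rule set_integrable_bound[OF set_integral_add(1)[OF const[of "1 + \<bar>\<nu>\<bar>"] i0]])
    show "set_borel_measurable lebesgue {c<..<d} \<phi>" using meas by (simp add: set_borel_measurable_def)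
    show "AE t in lebesgue. t \<in> {c<..<d} \<longrightarrow> norm (\<phi> t) \<le> norm (1 + \<bar>\<nu>\<bar> + \<bar>\<phi> t - \<nu>\<bar> powr p)"
    proof (rule AE_I2, rule impI)
      fix t
      have "\<bar>\<phi> t - \<nu>\<bar> \<le> 1 + \<bar>\<phi> t - \<nu>\<bar> powr p"
      proof (cases "\<bar>\<phi> t - \<nu>\<bar> \<le> 1")
        case False
        then have "\<bar>\<phi> t - \<nu>\<bar> powr 1 \<le> \<bar>\<phi> t - \<nu>\<bar> powr p" using p by (intro powr_mono) auto
        then show ?thesis using False by simp
      qed (simp add: add_increasing2)
      moreover have "0 \<le> \<bar>\<phi> t - \<nu>\<bar> powr p" by simp
      ultimately show "norm (\<phi> t) \<le> norm (1 + \<bar>\<nu>\<bar> + \<bar>\<phi> t - \<nu>\<bar> powr p)" unfolding real_norm_def by linarith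
    qed
  qed
  have intp: "set_integrable lebesgue {c<..<d} (\<lambda>t. \<bar>\<phi> t - \<kappa>\<bar> powr p)" for \<kappa>
  proof -
    define \<eta> where "\<eta> = \<bar>\<nu> - \<kappa>\<bar> + 1"
    have \<eta>: "0 < \<eta>" by (simp add: \<eta>_def)
    let ?g = "\<lambda>t. ((1 + \<eta>) / 1) powr (p - 1) * \<bar>\<phi> t - \<nu>\<bar> powr p + (1 + \<eta>) powr (p - 1) * \<eta>"
    show ?thesis
    proof (rule set_integrable_bound[OF set_integral_add(1)[OF set_integrable_mult_right[OF i0] const] meas_comp[OF cont order_refl order_refl]])
      show "AE t in lebesgue. t \<in> {c<..<d} \<longrightarrow> norm (\<bar>\<phi> t - \<kappa>\<bar> powr p)
          \<le> norm (?g t)"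
      proof (rule AE_I2, rule impI)
        fix t
        have "\<bar>\<phi> t - \<kappa>\<bar> powr p \<le> (\<bar>\<phi> t - \<nu>\<bar> + \<eta>) powr p"
          using p by (intro powr_mono2) (auto simp: \<eta>_def)
        also have "\<dots> \<le> ?g t"
          by (rule powr_add_le) (use \<eta> p in auto)
        finally have "\<bar>\<phi> t - \<kappa>\<bar> powr p \<le> ?g t" .
        moreover have "0 \<le> \<bar>\<phi> t - \<kappa>\<bar> powr p" by simp
        ultimately show "norm (\<bar>\<phi> t - \<kappa>\<bar> powr p)
          \<le> norm (?g t)"
          unfolding real_norm_def by linarith
      qed
    qed
  qed
  show ?thesis unfolding N_def[symmetric]
  proof
    fix u v assume uv: "c \<le> u" "u < v" "v \<le> d"
    have "avg {u<..<v} \<phi> = (LINT t:{u<..<v}|lebesgue. \<phi> t) / (v - u)" using uv by (simp add: avg_def)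
    then show "(LINT t:{u<..<v}|lebesgue. \<bar>\<phi> t - (LINT t:{u<..<v}|lebesgue. \<phi> t) / (v - u)\<bar> powr p)
        \<le> N powr p * (v - u)"
      using main(2)[OF uv] by simp
  qed (use J int intp in auto)
qed

lemma BMO_tail:
  assumes p: "1 < p" "p \<le> 2" and a: "0 < a" "2 - p \<le> a" "a < 1"
    and \<phi>: "\<phi> \<in> BMO p Q" "0 < bmo_norm p Q \<phi>" and JQ: "J \<in> subintervals Q" and l: "0 \<le> l"
  shows "measure lebesgue {t\<in>J. l \<le> \<bar>\<phi> t - avg J \<phi>\<bar>} / measure lebesgue J
    \<le> (1 - a) powr (- (1 / a)) * exp (- (log_osc p powr (1 / p) * l / enn2real (bmo_norm p Q \<phi>)))"
proof -
  define b where "b = enn2real (bmo_norm p Q \<phi>)"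
  have b: "0 < b" using \<phi> by (auto simp: b_def enn2real_positive_iff BMO_def)
  define N where "N = log_osc p powr (1 / p)"
  have N: "0 < N" "N powr p = log_osc p" using log_osc_pos[OF p] p by (auto simp: N_def powr_powr)
  define K where "K = (1 - a) powr (- (1 / a))"
  have K: "1 \<le> K"
  proof -
    have "0 \<le> - (1 / a) * ln (1 - a)" using a by (simp add: divide_nonpos_pos)
    then show ?thesis using a by (simp add: K_def powr_def)
  qed
  obtain c d where J: "c < d" "{c<..<d} \<subseteq> J" "J \<subseteq> {c..d}" by (rule subinterval_end_points[OF JQ])
  interpret osc_bounded p b c d \<phi> unfolding b_def by (rule osc_bounded_of_BMO[OF p(1) \<phi>(1) JQ J])
  have avg: "avg J \<phi> = mean" using avg_interval[OF J integrable] by (simp add: mean_def)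
  let ?E = "{t\<in>J. l \<le> \<bar>\<phi> t - avg J \<phi>\<bar>}"
  have AE: "AE t in lebesgue. t \<in> J \<longleftrightarrow> t \<in> {c<..<d}" by (rule AE_interval_iff[OF J])
  have mJ: "measure lebesgue J = d - c" by (rule measure_interval[OF J])
  have bound: "measure lebesgue ?E \<le> measure lebesgue S"
    if S: "S \<in> sets lebesgue" "S \<subseteq> {c<..<d}" "\<And>t. t \<in> {c<..<d} \<Longrightarrow> l \<le> \<bar>\<phi> t - mean\<bar> \<Longrightarrow> t \<in> S" for S
  proof -
    have "emeasure lebesgue ?E \<le> emeasure lebesgue S"
      by (rule emeasure_mono_AE[OF _ S(1)]) (use AE S(3) in \<open>auto elim!: eventually_mono simp: avg\<close>)
    moreover have "emeasure lebesgue S \<le> emeasure lebesgue {c<..<d}" using S by (intro emeasure_mono) auto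
    then have "emeasure lebesgue S < top" using J(1) by (simp add: le_less_trans)
    ultimately show ?thesis unfolding measure_def by (rule enn2real_mono)
  qed
  have "measure lebesgue ?E \<le> (d - c) * (K * exp (- (N * l / b)))"
  proof (cases "l = 0")
    case True
    have "measure lebesgue ?E \<le> measure lebesgue {c<..<d}" by (rule bound) auto
    also have "\<dots> = (d - c) * 1" using J(1) by simp
    also have "\<dots> \<le> (d - c) * K" using K J(1) by (intro mult_left_mono) auto
    finally show ?thesis using True by simp
  next
    case False
    then have l: "0 < l" using l by simp
    have scaled: "measure lebesgue ?E \<le> (d - c) * (K * exp (- (\<theta>\<^sup>2 * N * l / b)))"
      if \<theta>: "0 < \<theta>" "\<theta> < 1" for \<theta>
    proof -
      \<comment> \<open>This factor brings the oscillation bound to \<open>\<theta> * a * N\<close>,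
        strictly below the threshold. A second factor \<theta> lowers the height, because
        \<open>two_sided_tail\<close> concerns a strict inequality and the present set a weak one.
        Both losses vanish as \<theta> tends to 1.\<close>
      define \<tau> where "\<tau> = \<theta> * a * N / b"
      have \<tau>: "0 < \<tau>" using \<theta> a N b by (simp add: \<tau>_def)
      have \<tau>b: "\<bar>\<tau>\<bar> * b = \<theta> * a * N" using \<theta> a N b by (simp add: \<tau>_def abs_of_pos)
      interpret s: osc_bounded p "\<theta> * a * N" c d "\<lambda>t. \<tau> * \<phi> t"
        using osc_bounded_cmult[of \<tau>] p b \<tau> unfolding \<tau>b by simp
      have sm: "s.mean = \<tau> * mean" by (rule mean_cmult[OF s.osc_bounded_axioms])
      have "\<theta> powr p < 1" using powr_less_mono2[of p \<theta> 1] \<theta> p by simp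
      then have small: "(\<theta> * a * N) powr p < a powr p * log_osc p"
        using \<theta> a N log_osc_pos[OF p] by (simp add: powr_mult)
      have pos: "0 < \<theta> * a * N" "0 < \<theta> * \<tau> * l" using \<theta> a N \<tau> l by auto
      let ?S = "{t \<in> {c<..<d}. \<theta> * \<tau> * l < \<bar>\<tau> * \<phi> t - s.mean\<bar>}"
      have "measure lebesgue ?E \<le> measure lebesgue ?S"
      proof (rule bound)
        show "?S \<in> sets lebesgue" by (rule s.deviation_sets)
        fix t assume t: "t \<in> {c<..<d}" "l \<le> \<bar>\<phi> t - mean\<bar>"
        have "\<theta> * (\<tau> * l) < \<tau> * l" using \<theta> \<tau> l by simp
        also have "\<dots> \<le> \<tau> * \<bar>\<phi> t - mean\<bar>" using t \<tau> by simp
        also have "\<dots> = \<bar>\<tau> * \<phi> t - s.mean\<bar>"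
          using \<tau> by (simp add: sm abs_mult flip: right_diff_distrib)
        finally show "t \<in> ?S" using t by (simp add: mult.assoc)
      qed auto
      also have "\<dots> \<le> (d - c) * (K * exp (- (\<theta> * \<tau> * l / a)))"
        unfolding K_def by (rule s.two_sided_tail[OF p a pos(1) small pos(2)])
      \<comment> \<open>The parameter \<open>a\<close> cancels from the exponent and survives only
        in \<open>K\<close>.\<close>
      also have "\<theta> * \<tau> * l / a = \<theta>\<^sup>2 * N * l / b"
        using a by (simp add: \<tau>_def power2_eq_square)
      finally show ?thesis .
    qed
    have "((\<lambda>\<theta>. (d - c) * (K * exp (- (\<theta>\<^sup>2 * N * l / b)))) \<longlongrightarrow> (d - c) * (K * exp (- (1\<^sup>2 * N * l / b)))) (at_left 1)"
      using b by (intro tendsto_intros) auto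
    moreover have "\<forall>\<^sub>F \<theta> in at_left 1. measure lebesgue ?E \<le> (d - c) * (K * exp (- (\<theta>\<^sup>2 * N * l / b)))"
      using scaled by (auto simp: eventually_at_left[of 0] intro!: exI[of _ 0])
    ultimately have "measure lebesgue ?E \<le> (d - c) * (K * exp (- (1\<^sup>2 * N * l / b)))"
      by (rule tendsto_lowerbound) simp
    then show ?thesis by simp
  qed
  then have "measure lebesgue ?E / (d - c) \<le> K * exp (- (N * l / b))"
    using J(1) by (simp add: pos_divide_le_eq mult.commute)
  then show ?thesis unfolding mJ K_def N_def b_def .
qed

text \<open>The logarithm of the expression is the difference quotient of - ln (1 - a) at 0.\<close>

lemma powr_tendsto_exp_1:
  "((\<lambda>a::real. (1 - a) powr (- (1 / a))) \<longlongrightarrow> exp 1) (at_right 0)"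
proof -
  have "((\<lambda>a::real. - ln (1 - a)) has_real_derivative 1) (at 0)"
    by (auto intro!: derivative_eq_intros)
  then have "((\<lambda>a::real. - ln (1 - a) / a) \<longlongrightarrow> 1) (at 0)" by (simp add: DERIV_def)
  then have "((\<lambda>a::real. - ln (1 - a) / a) \<longlongrightarrow> 1) (at_right 0)" by (rule tendsto_within_subset) simp
  then have "((\<lambda>a::real. exp (- ln (1 - a) / a)) \<longlongrightarrow> exp 1) (at_right 0)" by (rule tendsto_exp)
  moreover have "\<forall>\<^sub>F a in at_right (0::real). exp (- ln (1 - a) / a) = (1 - a) powr (- (1 / a))"
    by (auto simp: eventually_at_right[of _ 1] powr_def intro!: exI[of _ 1])
  ultimately show ?thesis by (rule Lim_transform_eventually)
qed

theorem theorem1p3: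
  fixes p :: real
  assumes "1 < p" and "p \<le> 2"
  shows "(\<forall>Q \<phi> J l.
      is_interval Q \<and> \<phi> \<in> BMO p Q \<and> 0 < bmo_norm p Q \<phi> \<and> J \<in> subintervals Q \<and> 0 \<le> l \<longrightarrow>
        measure lebesgue {t\<in>J. l \<le> \<bar>\<phi> t - avg J \<phi>\<bar>} / measure lebesgue J
          \<le> (if p = 2 then exp 1 else (p - 1) powr (- (1 / (2 - p))))
             * exp (- (JN_constant p * l / enn2real (bmo_norm p Q \<phi>))))
    \<and> weak_type_JN p (JN_constant p)"
proof -
  let ?K = "if p = 2 then exp 1 else (p - 1) powr (- (1 / (2 - p)))"
  define N where "N = log_osc p powr (1 / p)"
  have main: "measure lebesgue {t\<in>J. l \<le> \<bar>\<phi> t - avg J \<phi>\<bar>} / measure lebesgue J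
          \<le> ?K * exp (- (JN_constant p * l / enn2real (bmo_norm p Q \<phi>)))"
    if \<phi>: "\<phi> \<in> BMO p Q" "0 < bmo_norm p Q \<phi>" and J: "J \<in> subintervals Q" and l: "0 \<le> l" for Q \<phi> J l
  proof -
    let ?b = "enn2real (bmo_norm p Q \<phi>)"
    let ?m = "measure lebesgue {t\<in>J. l \<le> \<bar>\<phi> t - avg J \<phi>\<bar>} / measure lebesgue J"
    have tail: "?m \<le> (1 - a) powr (- (1 / a)) * exp (- (N * l / ?b))" if "0 < a" "2 - p \<le> a" "a < 1" for a
      unfolding N_def by (rule BMO_tail[OF assms that \<phi> J l])
    have "?m \<le> ?K * exp (- (N * l / ?b))"
    proof (cases "p = 2")
      case True
      have "((\<lambda>a. (1 - a) powr (- (1 / a)) * exp (- (N * l / ?b))) \<longlongrightarrow> exp 1 * exp (- (N * l / ?b))) (at_right 0)"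
        by (intro tendsto_mult tendsto_const powr_tendsto_exp_1)
      moreover have "\<forall>\<^sub>F a in at_right 0. ?m \<le> (1 - a) powr (- (1 / a)) * exp (- (N * l / ?b))"
        using tail True by (auto simp: eventually_at_right[of _ 1] intro!: exI[of _ 1])
      ultimately have "?m \<le> exp 1 * exp (- (N * l / ?b))" by (rule tendsto_lowerbound) simp
      then show ?thesis using True by simp
    next
      case False
      then show ?thesis using tail[of "2 - p"] assms by simp
    qed
    also have "\<dots> \<le> ?K * exp (- (JN_constant p * l / ?b))"
    proof (rule mult_left_mono)
      have "JN_constant p * l / ?b \<le> N * l / ?b"
        unfolding N_def using l by (intro divide_right_mono mult_right_mono JN_constant_le assms) auto
      then show "exp (- (N * l / ?b)) \<le> exp (- (JN_constant p * l / ?b))" by simp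
    qed simp
    finally show ?thesis .
  qed
  have "0 < ?K" using assms by simp
  then have "weak_type_JN p (JN_constant p)" unfolding weak_type_JN_def using main by blast
  then show ?thesis using main by blast
qed

end
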